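(* Let $N\ge3$, assume (K0) and (F0), and let $p>p_S(\alpha)$. Then for every $\mu\in\mathbb{R}$ there is a unique $u\in C^2(0,\infty)$, denoted $u^*_\mu$, solving $$u''+\frac{N-1}{r}u'+K(r)\max\{u,0\}^p+\mu f(r)=0\ \ (r>0),\qquad \lim_{r\to0}r^{\theta}u(r)=\gamma.$$ Furthermore: (1) $(r,\mu)\mapsto u^*_\mu(r)$ is $C^1$; (2) for each $r>0$ the set $\mathcal{P}_r:=\{\mu\in\mathbb{R}: u^*_\mu(\rho)>0\text{ for all }\rho\in(0,r]\}$ is an open subset of $\mathbb{R}$, and $\mu\mapsto u^*_\mu(r)$ and $\mu\mapsto \frac{d}{dr}u^*_\mu(r)$ are real analytic on each connected component of $\mathcal{P}_r$.
   Context: (K0): $K:(0,\infty)\to(0,\infty)$ is continuous and $K(r)=(k_0+o(1))r^{\alpha}$ as $r\to0$ for some $\alpha>-2$, $k_0>0$. (F0): $f:(0,\infty)\to[0,\infty)$ is continuous, not identically zero, and $f(r)=O(r^{\nu})$ as $r\to0$ for some $\nu>-2$. $p_S(\alpha)=\frac{N+2+2\alpha}{N-2}$, $\theta:=\frac{2+\alpha}{p-1}$, $\gamma:=k_0^{-1/(p-1)}\big(\theta(N-2-\theta)\big)^{1/(p-1)}$. *)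

theory Defs
  imports "HOL-Analysis.Analysis" "HOL-Library.Landau_Symbols"
begin

definition C2_on_pos :: "(real \<Rightarrow> real) \<Rightarrow> (real \<Rightarrow> real) \<Rightarrow> (real \<Rightarrow> real) \<Rightarrow> bool" where
  "C2_on_pos u u' u'' \<longleftrightarrow>
     (\<forall>r>0. (u has_real_derivative u' r) (at r) \<and> (u' has_real_derivative u'' r) (at r))
     \<and> continuous_on {0<..} u''"

definition solves_sing ::
  "nat \<Rightarrow> (real \<Rightarrow> real) \<Rightarrow> (real \<Rightarrow> real) \<Rightarrow> real \<Rightarrow> real \<Rightarrow> real \<Rightarrow> real
     \<Rightarrow> (real \<Rightarrow> real) \<Rightarrow> bool" where
  "solves_sing N K f p \<theta> \<gamma> \<mu> u \<longleftrightarrow>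
     (\<exists>u' u''. C2_on_pos u u' u'' \<and>
        (\<forall>r>0. u'' r + (real N - 1) / r * u' r + K r * (max (u r) 0) powr p + \<mu> * f r = 0))
     \<and> ((\<lambda>r. r powr \<theta> * u r) \<longlongrightarrow> \<gamma>) (at_right 0)"

definition C1_on2 :: "(real \<times> real \<Rightarrow> real) \<Rightarrow> (real \<times> real) set \<Rightarrow> bool" where
  "C1_on2 g S \<longleftrightarrow> (\<exists>g1 g2. (\<forall>z\<in>S. (g has_derivative (\<lambda>h. g1 z * fst h + g2 z * snd h)) (at z))
       \<and> continuous_on S g1 \<and> continuous_on S g2)"

definition real_analytic_on :: "(real \<Rightarrow> real) \<Rightarrow> real set \<Rightarrow> bool" where
  "real_analytic_on g S \<longleftrightarrow>
     (\<forall>x\<in>S. \<exists>d>0. \<exists>c::nat \<Rightarrow> real. \<forall>y. \<bar>y - x\<bar> < d \<longrightarrow> (\<lambda>n. c n * (y - x) ^ n) sums g y)"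

end

theory Submission
  imports Defs "HOL-Complex_Analysis.Cauchy_Integral_Formula"
begin

text \<open>With \<open>r = exp t\<close> and \<open>u r = r powr (- \<theta>) * (\<gamma> + z (ln r))\<close> the equation becomes
  \<open>z'' + a z' + c z = F t z\<close> with \<open>a, c > 0\<close>, where \<open>a > 0\<close> is the condition \<open>p > p\<^sub>S(\<alpha>)\<close> and the
  Lipschitz constant of \<open>F\<close> near \<open>z = 0\<close> is small for \<open>t\<close> close to minus infinity. Both
  characteristic roots have negative real part, so solutions that tend to \<open>0\<close> at minus infinity are
  exactly the fixed points of \<open>z = A (F z)\<close>, where \<open>A\<close> is an iterated Duhamel integral from minus
  infinity. In a weighted supremum norm this is a contraction. The solution cannot blow up to the right
  because the superlinear term only pushes it down.

  If \<open>y\<close> solves the linearised equation, then \<open>z\<^sub>\<nu> - z\<^sub>\<mu> - (\<nu> - \<mu>) y\<close> satisfies a linear fixed point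
  equation with a forcing of order \<open>o(\<nu> - \<mu>)\<close>, uniformly in \<open>\<mu>\<close>. For real \<open>\<mu>\<close> this gives the
  \<open>C\<^sup>1\<close> dependence. Along a positive solution the nonlinearity is holomorphic, so the same estimate
  for complex \<open>\<mu>\<close> gives complex differentiability, hence analyticity.\<close>

subsection \<open>Bounded solutions of a stable first order equation\<close>

text \<open>The condition at \<open>r = 0\<close> becomes a condition at minus infinity, so there
  are no initial values to start from; boundedness to the left takes their place. This selects a
  single solution because every nonzero solution of the homogeneous linear equation is unbounded at
  minus infinity. The characteristic roots may form a conjugate pair, so the integral equations are
  posed over the complex numbers even for real data, and reality is recovered afterwards from
  uniqueness. One fixed point theorem and one a priori estimate then serve three equations: the real
  nonlinear one, its linearisation and the complexified one. All estimates hold uniformly on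
  half-lines \<open>{..<T}\<close>, so the noncompact end at the singularity causes no loss when a
  solution is perturbed in \<open>\<mu>\<close>.\<close>

definition bounded_cont :: "real \<Rightarrow> (real \<Rightarrow> 'a::real_normed_vector) \<Rightarrow> bool" where
  "bounded_cont T F \<longleftrightarrow> continuous_on {..<T} F \<and> bounded (F ` {..<T})"

lemma bounded_contI:
  assumes "continuous_on {..<T} F" "\<And>t. t < T \<Longrightarrow> norm (F t) \<le> M"
  shows "bounded_cont T F"
  using assms by (auto simp: bounded_cont_def bounded_iff)

lemma bounded_contD:
  assumes "bounded_cont T F"
  shows "\<exists>M>0. \<forall>t<T. norm (F t) \<le> M"
  using assms by (force simp: bounded_cont_def bounded_pos)

lemma bounded_cont_continuous: "bounded_cont T F \<Longrightarrow> continuous_on {..<T} F"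
  by (simp add: bounded_cont_def)

lemma bounded_cont_add: "bounded_cont T F \<Longrightarrow> bounded_cont T G \<Longrightarrow> bounded_cont T (\<lambda>s. F s + G s)"
  by (auto simp: bounded_cont_def intro: continuous_intros bounded_plus_comp)

lemma bounded_cont_diff: "bounded_cont T F \<Longrightarrow> bounded_cont T G \<Longrightarrow> bounded_cont T (\<lambda>s. F s - G s)"
  by (auto simp: bounded_cont_def intro: continuous_intros bounded_minus_comp)

lemma bounded_cont_mult:
  fixes F G :: "real \<Rightarrow> 'a::real_normed_algebra"
  assumes "bounded_cont T F" "bounded_cont T G"
  shows "bounded_cont T (\<lambda>s. F s * G s)"
proof -
  obtain M where M: "M > 0" "\<And>t. t < T \<Longrightarrow> norm (F t) \<le> M"
    using bounded_contD[OF assms(1)] by blast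
  obtain N where "N > 0" "\<And>t. t < T \<Longrightarrow> norm (G t) \<le> N"
    using bounded_contD[OF assms(2)] by blast
  with M have "norm (F t * G t) \<le> M * N" if "t < T" for t
    using that by (intro order_trans[OF norm_mult_ineq] mult_mono) (auto intro: less_imp_le)
  with assms show ?thesis
    by (intro bounded_contI) (auto simp: bounded_cont_def intro: continuous_intros)
qed

lemma bounded_cont_const: "bounded_cont T (\<lambda>s. c)"
  by (rule bounded_contI[where M = "norm c"]) auto

lemma bounded_cont_of_real:
  "bounded_cont T F \<Longrightarrow> bounded_cont T (\<lambda>s. of_real (F s) :: 'a::real_normed_algebra_1)"
  unfolding bounded_cont_def by (auto simp: bounded_iff intro: continuous_intros)

lemma bounded_cont_mono: "bounded_cont T F \<Longrightarrow> T' \<le> T \<Longrightarrow> bounded_cont T' F"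
  unfolding bounded_cont_def
  by (meson bounded_subset continuous_on_subset image_mono lessThan_subset_iff)

lemma bounded_cont_cong: "(\<And>t. t < T \<Longrightarrow> F t = G t) \<Longrightarrow> bounded_cont T F = bounded_cont T G"
  unfolding bounded_cont_def by (metis continuous_on_cong image_cong lessThan_iff)

lemma has_integral_exp_atMost:
  fixes a c :: real
  assumes "a > 0"
  shows "((\<lambda>s. exp (a * s)) has_integral exp (a * c) / a) {..c}"
proof -
  have 1: "((\<lambda>x. exp (-a * x)) has_integral exp (-a * (-c)) / a) {-c..}"
    by (rule has_integral_exp_minus_to_infinity[OF assms])
  then have "(\<lambda>x. exp (-a * x)) absolutely_integrable_on {-c..}"
    by (intro nonnegative_absolutely_integrable_1) (auto simp: has_integral_iff)
  then have "(\<lambda>x. exp (-a * (-x))) absolutely_integrable_on {..c} \<and>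
      integral {..c} (\<lambda>x. exp (-a * (-x))) = exp (a * c) / a"
    by (subst has_absolute_integral_reflect_real[where B = "{-c..}"])
      (use 1 in \<open>auto simp: has_integral_iff\<close>)
  then show ?thesis
    by (simp add: has_integral_iff set_lebesgue_integral_eq_integral(1))
qed

text \<open>The solution of \<open>y' = l y + F\<close> that stays bounded to the left. For
  \<open>Re l < 0\<close> and bounded \<open>F\<close> the integrand is of order
  \<open>exp (- Re l * s)\<close>, so the integral from minus infinity converges and no initial
  value enters.\<close>

definition duhamel :: "complex \<Rightarrow> (real \<Rightarrow> complex) \<Rightarrow> real \<Rightarrow> complex" where
  "duhamel l F t = exp (l * of_real t) * integral {..t} (\<lambda>s. exp (- l * of_real s) * F s)"

lemma duhamel_integrable:
  assumes "Re l < 0" "bounded_cont T F" "t < T"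
  shows "(\<lambda>s. exp (- l * of_real s) * F s) integrable_on {..t}"
proof -
  obtain M where M: "M > 0" "\<And>t. t < T \<Longrightarrow> norm (F t) \<le> M"
    using bounded_contD[OF assms(2)] by blast
  have cont: "continuous_on {..t} F"
    using assms(2,3) by (auto simp: bounded_cont_def intro: continuous_on_subset)
  have int: "(\<lambda>s. M * exp (- Re l * s)) integrable_on {..t}"
    using has_integral_exp_atMost[of "- Re l" t] assms(1)
    by (auto intro!: integrable_on_mult_right simp: has_integral_iff)
  show ?thesis
  proof (rule measurable_bounded_by_integrable_imp_integrable[OF _ int])
    show "(\<lambda>s. exp (- l * of_real s) * F s) \<in> borel_measurable (lebesgue_on {..t})"
      by (intro continuous_imp_measurable_on_sets_lebesgue continuous_intros cont) auto
    show "norm (exp (- l * of_real s) * F s) \<le> M * exp (- Re l * s)" if "s \<in> {..t}" for s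
      using M(2)[of s] that assms(3) by (auto simp: norm_mult mult.commute intro!: mult_mono)
  qed auto
qed

text \<open>The majorant has a constant and an exponential part because the weight \<open>wt\<close>
  has. The exponential part gains \<open>1 / (kap + L)\<close> instead of \<open>1 / kap\<close>;
  this is what lets a large \<open>L\<close> compensate a large Lipschitz constant.\<close>

lemma duhamel_bound:
  assumes l: "Re l \<le> - kap" "kap > 0" and bc: "bounded_cont T F" and t: "t < T"
    and le: "\<And>s. s \<le> t \<Longrightarrow> norm (F s) \<le> c0 + c1 * exp (L * s)" and nn: "L \<ge> 0" "c0 \<ge> 0" "c1 \<ge> 0"
  shows "norm (duhamel l F t) \<le> c0 / kap + c1 * exp (L * t) / (kap + L)"
proof -
  \<comment> \<open>The integration uses the exact rate; it is weakened to \<open>kap\<close> only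
    at the end, so that both roots share one constant.\<close>
  define m where "m = - Re l"
  have m: "m \<ge> kap" using l by (simp add: m_def)
  have I: "((\<lambda>s. c0 * exp (m * s) + c1 * exp ((m + L) * s)) has_integral
        c0 * (exp (m * t) / m) + c1 * (exp ((m + L) * t) / (m + L))) {..t}"
    using m l nn by (intro has_integral_add has_integral_mult_right has_integral_exp_atMost) auto
  have "norm (integral {..t} (\<lambda>s. exp (- l * of_real s) * F s))
      \<le> integral {..t} (\<lambda>s. c0 * exp (m * s) + c1 * exp ((m + L) * s))"
  proof (rule integral_norm_bound_integral)
    show "(\<lambda>s. exp (- l * of_real s) * F s) integrable_on {..t}"
      using duhamel_integrable[OF _ bc t] l by auto
    show "(\<lambda>s. c0 * exp (m * s) + c1 * exp ((m + L) * s)) integrable_on {..t}"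
      using I by (auto simp: has_integral_iff)
    fix s assume "s \<in> {..t}"
    then have "norm (exp (- l * of_real s) * F s) \<le> exp (m * s) * (c0 + c1 * exp (L * s))"
      using le by (auto simp: norm_mult m_def intro!: mult_left_mono)
    then show "norm (exp (- l * of_real s) * F s) \<le> c0 * exp (m * s) + c1 * exp ((m + L) * s)"
      by (simp add: algebra_simps exp_add)
  qed
  also have "\<dots> = c0 * (exp (m * t) / m) + c1 * (exp ((m + L) * t) / (m + L))"
    using I by (auto simp: has_integral_iff)
  finally have "norm (duhamel l F t) \<le> exp (- m * t) * \<dots>"
    by (auto simp: duhamel_def norm_mult m_def intro!: mult_left_mono)
  also have "\<dots> = c0 / m + c1 * exp (L * t) / (m + L)"
  proof -
    have "exp (- m * t) * exp (m * t) = 1" "exp (- m * t) * exp ((m + L) * t) = exp (L * t)"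
      by (simp_all flip: exp_add add: algebra_simps)
    moreover have "exp (- m * t) * (c0 * (exp (m * t) / m) + c1 * (exp ((m + L) * t) / (m + L)))
        = c0 * (exp (- m * t) * exp (m * t)) / m + c1 * (exp (- m * t) * exp ((m + L) * t)) / (m + L)"
      by (simp only: distrib_left times_divide_eq_right mult_ac)
    ultimately show ?thesis by simp
  qed
  also have "\<dots> \<le> c0 / kap + c1 * exp (L * t) / (kap + L)"
    using m l nn by (intro add_mono divide_left_mono mult_pos_pos) auto
  finally show ?thesis .
qed

lemma duhamel_deriv:
  assumes l: "Re l < 0" and bc: "bounded_cont T F" and t: "t < T"
  shows "(duhamel l F has_vector_derivative l * duhamel l F t + F t) (at t)"
proof -
  let ?h = "\<lambda>s. exp (- l * of_real s) * F s"
  define b where "b = (t + T) / 2"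
  have b: "t < b" "b < T" using t by (auto simp: b_def)
  define I where "I = integral {..t - 1} ?h"
  have cont: "continuous_on {t - 1..b} ?h"
    using bc b by (intro continuous_intros) (auto simp: bounded_cont_def intro: continuous_on_subset)
  \<comment> \<open>Cutting off a fixed tail at \<open>t - 1\<close> leaves a compact interval for
    the fundamental theorem of calculus; \<open>b > t\<close> gives room for a two-sided
    derivative.\<close>
  have split: "integral {..x} ?h = I + integral {t - 1..x} ?h" if "x \<in> {t - 1..b}" for x
  proof -
    have int: "?h integrable_on {t - 1..x}"
      using cont that by (intro integrable_continuous_real) (auto intro: continuous_on_subset)
    have "?h integrable_on {..t - 1}" using duhamel_integrable[OF l bc] t by auto
    then have "(?h has_integral (I + integral {t - 1..x} ?h)) ({..t - 1} \<union> {t - 1..x})"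
      using int unfolding I_def
      by (intro has_integral_Un) (auto simp: has_integral_iff intro!: negligible_subset[OF negligible_sing[of "t - 1"]])
    moreover have "{..t - 1} \<union> {t - 1..x} = {..x}" using that by auto
    ultimately show ?thesis by (auto simp: has_integral_iff)
  qed
  have d1: "((\<lambda>x. integral {t - 1..x} ?h) has_vector_derivative ?h t) (at t)"
    using integral_has_vector_derivative[OF cont, of t] b at_within_interior[of t "{t - 1..b}"]
    by (auto simp: interior_atLeastAtMost_real)
  have "((\<lambda>x. integral {..x} ?h) has_vector_derivative ?h t) (at t)"
  proof (rule has_vector_derivative_transform_within_open)
    show "((\<lambda>x. I + integral {t - 1..x} ?h) has_vector_derivative ?h t) (at t)"
      using has_vector_derivative_add[OF has_vector_derivative_const d1] by simp
    show "t \<in> {t - 1<..<b}" using b by auto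
  qed (use split in auto)
  moreover have "((\<lambda>x. exp (l * of_real x)) has_vector_derivative l * exp (l * of_real t)) (at t)"
    by (rule has_vector_derivative_real_field) (auto intro!: derivative_eq_intros)
  ultimately have "((\<lambda>x. exp (l * of_real x) * integral {..x} ?h) has_vector_derivative
     exp (l * of_real t) * ?h t + l * exp (l * of_real t) * integral {..t} ?h) (at t)"
    by (intro has_vector_derivative_mult)
  moreover have "exp (l * of_real t) * ?h t = F t"
    by (simp only: mult.assoc[symmetric] exp_add[symmetric]) simp
  ultimately show ?thesis
    unfolding duhamel_def[abs_def] by (simp only: add.commute mult.assoc)
qed

lemma duhamel_bound_const:
  assumes l: "Re l \<le> - kap" "kap > 0" and bc: "bounded_cont T F" and t: "t < T"
    and le: "\<And>s. s \<le> t \<Longrightarrow> norm (F s) \<le> c"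
  shows "norm (duhamel l F t) \<le> c / kap"
  using duhamel_bound[OF l bc t, of c 0 0] le[of t] order_trans[OF norm_ge_zero le[of t]] le by auto

lemma bounded_cont_duhamel:
  assumes l: "Re l < 0" and bc: "bounded_cont T F"
  shows "bounded_cont T (duhamel l F)"
proof -
  obtain M where M: "\<And>t. t < T \<Longrightarrow> norm (F t) \<le> M"
    using bounded_contD[OF bc] by blast
  show ?thesis
  proof (rule bounded_contI)
    show "continuous_on {..<T} (duhamel l F)"
      using duhamel_deriv[OF l bc] has_vector_derivative_continuous
      by (metis continuous_at_imp_continuous_on lessThan_iff)
    show "norm (duhamel l F t) \<le> M / (- Re l)" if "t < T" for t
      using l that M by (intro duhamel_bound_const[OF _ _ bc]) auto
  qed
qed

lemma duhamel_diff:
  assumes "Re l < 0" "bounded_cont T F" "bounded_cont T G" "t < T"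
  shows "duhamel l F t - duhamel l G t = duhamel l (\<lambda>s. F s - G s) t"
proof -
  have "integral {..t} (\<lambda>s. exp (- l * of_real s) * (F s - G s))
     = integral {..t} (\<lambda>s. exp (- l * of_real s) * F s) - integral {..t} (\<lambda>s. exp (- l * of_real s) * G s)"
    using integral_diff[OF duhamel_integrable[OF assms(1,2,4)] duhamel_integrable[OF assms(1,3,4)]]
    by (simp add: right_diff_distrib)
  then show ?thesis by (simp add: duhamel_def right_diff_distrib)
qed

lemma duhamel_scale: "duhamel l (\<lambda>s. c * F s) t = c * duhamel l F t"
proof -
  have "integral {..t} (\<lambda>s. exp (- l * of_real s) * (c * F s))
     = integral {..t} (\<lambda>s. c * (exp (- l * of_real s) * F s))"
    by (intro arg_cong[where f = "integral _"]) (auto simp: algebra_simps)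
  then show ?thesis by (simp add: duhamel_def algebra_simps)
qed

lemma duhamel_cong: "(\<And>s. s \<le> t \<Longrightarrow> F s = G s) \<Longrightarrow> duhamel l F t = duhamel l G t"
  unfolding duhamel_def by (intro arg_cong2[where f = times] refl integral_cong) auto

text \<open>Two solutions differ by \<open>C * exp (l * t)\<close>, which is unbounded at minus
  infinity unless \<open>C = 0\<close>.\<close>

lemma duhamel_unique:
  assumes l: "Re l < 0" and bc: "bounded_cont T F"
    and y: "\<And>t. t < T \<Longrightarrow> (y has_vector_derivative l * y t + F t) (at t)"
    and bd: "\<And>t. t < T \<Longrightarrow> norm (y t) \<le> M" and t: "t < T"
  shows "y t = duhamel l F t"
proof -
  define e where "e s = exp (- l * of_real s) * (y s - duhamel l F s)" for s
  have "(e has_vector_derivative 0) (at s)" if "s < T" for s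
  proof -
    have "((\<lambda>x. exp (- l * of_real x)) has_vector_derivative - l * exp (- l * of_real s)) (at s)"
      by (rule has_vector_derivative_real_field) (auto intro!: derivative_eq_intros)
    from has_vector_derivative_mult[OF this has_vector_derivative_diff[OF y[OF that] duhamel_deriv[OF l bc that]]]
    show ?thesis unfolding e_def[abs_def] by (simp add: algebra_simps)
  qed
  then obtain C where C: "\<And>s. s < T \<Longrightarrow> e s = C"
    using has_vector_derivative_zero_constant[of "{..<T}" e]
    by (metis convex_real_interval(4) has_vector_derivative_at_within lessThan_iff)
  obtain M' where M': "\<And>t. t < T \<Longrightarrow> norm (duhamel l F t) \<le> M'"
    using bounded_contD[OF bounded_cont_duhamel[OF l bc]] by blast
  have "norm C \<le> exp (- Re l * s) * (M + M')" if "s < T" for s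
  proof -
    have "norm C = exp (- Re l * s) * norm (y s - duhamel l F s)"
      using C[OF that] by (auto simp: e_def norm_mult)
    also have "\<dots> \<le> exp (- Re l * s) * (M + M')"
      using bd[OF that] M'[OF that] by (intro mult_left_mono norm_triangle_le_diff) auto
    finally show ?thesis .
  qed
  then have "eventually (\<lambda>s. norm C \<le> exp (- Re l * s) * (M + M')) at_bot"
    unfolding eventually_at_bot_dense by blast
  moreover have "((\<lambda>s. exp (- Re l * s) * (M + M')) \<longlongrightarrow> 0 * (M + M')) at_bot"
    using l by (intro tendsto_intros filterlim_compose[OF exp_at_bot]
      filterlim_tendsto_pos_mult_at_bot[OF tendsto_const _ filterlim_ident]) auto
  ultimately have "norm C \<le> 0 * (M + M')"
    by (intro tendsto_lowerbound[of _ "0 * (M + M')" at_bot]) auto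
  then have "e t = 0" using C[OF t] by auto
  then show ?thesis by (simp add: e_def)
qed

subsection \<open>Fixed points of the second order solution operator\<close>

text \<open>Up to \<open>T0\<close> the Lipschitz constant \<open>ell\<close> is small enough for a contraction; beyond \<open>T0\<close> it is
  arbitrary and absorbed by the exponential weight.\<close>

definition wt :: "real \<Rightarrow> real \<Rightarrow> real \<Rightarrow> real" where
  "wt L T0 s = 1 + exp (L * (s - T0))"

definition ell :: "real \<Rightarrow> real \<Rightarrow> real \<Rightarrow> real \<Rightarrow> real" where
  "ell kap L T0 s = (if s \<le> T0 then kap\<^sup>2 / 4 else L\<^sup>2 / 4)"

lemma wt_ge_1: "1 \<le> wt L T0 s" by (simp add: wt_def)

lemma wt_mono: "0 \<le> L \<Longrightarrow> s \<le> t \<Longrightarrow> wt L T0 s \<le> wt L T0 t"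
  by (simp add: wt_def mult_left_mono)

lemma ell_nonneg: "0 \<le> ell kap L T0 s" by (simp add: ell_def)

lemma ell_le: "ell kap L T0 s \<le> kap\<^sup>2 / 4 + L\<^sup>2 / 4" by (simp add: ell_def)

locale decay =
  fixes l1 l2 :: complex and kap :: real
  assumes kap: "kap > 0" and l1: "Re l1 \<le> - kap" and l2: "Re l2 \<le> - kap"
begin

text \<open>Inverts \<open>(D - l2) (D - l1)\<close>, that is
  \<open>z'' - (l1 + l2) z' + l1 l2 z = F\<close>, one factor at a time. Nothing is divided by
  \<open>l1 - l2\<close>, so a double root is no special case.\<close>

definition response :: "(real \<Rightarrow> complex) \<Rightarrow> real \<Rightarrow> complex" where
  "response F = duhamel l2 (duhamel l1 F)"

lemma re_neg: "Re l1 < 0" "Re l2 < 0"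
  using kap l1 l2 by auto

lemma bounded_cont_duhamel1: "bounded_cont T F \<Longrightarrow> bounded_cont T (duhamel l1 F)"
  by (rule bounded_cont_duhamel[OF re_neg(1)])

lemma bounded_cont_response: "bounded_cont T F \<Longrightarrow> bounded_cont T (response F)"
  unfolding response_def by (intro bounded_cont_duhamel re_neg)

lemma response_diff:
  assumes "bounded_cont T F" "bounded_cont T G" "t < T"
  shows "response F t - response G t = response (\<lambda>s. F s - G s) t"
proof -
  have "response F t - response G t = duhamel l2 (\<lambda>s. duhamel l1 F s - duhamel l1 G s) t"
    unfolding response_def by (intro duhamel_diff[where T = T] re_neg bounded_cont_duhamel assms)
  also have "\<dots> = response (\<lambda>s. F s - G s) t"
    unfolding response_def using assms re_neg by (intro duhamel_cong duhamel_diff[where T = T]) auto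
  finally show ?thesis .
qed

lemma response_scale: "response (\<lambda>s. c * F s) t = c * response F t"
  unfolding response_def using duhamel_scale[of l1 c F] by (simp add: duhamel_scale[abs_def])

lemma response_cong: "(\<And>s. s \<le> t \<Longrightarrow> F s = G s) \<Longrightarrow> response F t = response G t"
  unfolding response_def by (intro duhamel_cong) auto

lemma response_bound:
  assumes bc: "bounded_cont T F" and t: "t < T"
    and le: "\<And>s. s \<le> t \<Longrightarrow> norm (F s) \<le> c0 + c1 * exp (L * s)" and nn: "L \<ge> 0" "c0 \<ge> 0" "c1 \<ge> 0"
  shows "norm (response F t) \<le> c0 / kap\<^sup>2 + c1 * exp (L * t) / (kap + L)\<^sup>2"
proof -
  have "norm (duhamel l1 F s) \<le> c0 / kap + c1 / (kap + L) * exp (L * s)" if "s \<le> t" for s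
    using duhamel_bound[OF l1 kap bc _ _ nn, of s] le t that by auto
  from duhamel_bound[OF l2 kap bounded_cont_duhamel1[OF bc] t this]
  show ?thesis using nn kap by (simp add: response_def power2_eq_square)
qed

lemma response_bound_const:
  assumes "bounded_cont T F" "t < T" "\<And>s. s \<le> t \<Longrightarrow> norm (F s) \<le> c"
  shows "norm (response F t) \<le> c / kap\<^sup>2"
  using response_bound[of T F t c 0 0] assms order_trans[OF norm_ge_zero assms(3)[of t]] by auto

text \<open>This explains the quarters in \<open>ell\<close>. Up to \<open>T0\<close> the weight is
  at most \<open>2\<close>, so \<open>ell * wt\<close> is at most \<open>kap\<^sup>2 / 2\<close>,
  and two Duhamel steps divide by \<open>kap\<^sup>2\<close>. Beyond \<open>T0\<close> the weight is
  at most twice its exponential part, which leaves \<open>L\<^sup>2 / 2\<close>, and the two steps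
  divide by \<open>(kap + L)\<^sup>2\<close>. Either way a factor \<open>1 / 2\<close>
  remains.\<close>

lemma response_bound_wt:
  assumes bc: "bounded_cont T F" and t: "t < T" and nn: "L \<ge> 0" "D \<ge> 0" "\<beta> \<ge> 0"
    and le: "\<And>s. s \<le> t \<Longrightarrow> norm (F s) \<le> ell kap L T0 s * (D * wt L T0 s) + \<beta>"
  shows "norm (response F t) \<le> D / 2 * wt L T0 t + \<beta> / kap\<^sup>2"
proof -
  have "norm (F s) \<le> (D * kap\<^sup>2 / 2 + \<beta>) + (D * L\<^sup>2 / 2 * exp (- L * T0)) * exp (L * s)"
    if "s \<le> t" for s
  proof -
    have e: "exp (- L * T0) * exp (L * s) = exp (L * (s - T0))"
      by (simp add: algebra_simps flip: exp_add)
    have "ell kap L T0 s * wt L T0 s \<le> kap\<^sup>2 / 2 + L\<^sup>2 / 2 * exp (L * (s - T0))"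
    proof (cases "s \<le> T0")
      case True
      have "exp (L * (s - T0)) \<le> 1" using True nn by (simp add: mult_nonneg_nonpos)
      then have "kap\<^sup>2 / 4 * (1 + exp (L * (s - T0))) \<le> kap\<^sup>2 / 4 * 2" by (intro mult_left_mono) auto
      also have "\<dots> \<le> kap\<^sup>2 / 2 + L\<^sup>2 / 2 * exp (L * (s - T0))" by simp
      finally show ?thesis using True by (simp add: ell_def wt_def)
    next
      case False
      have "1 \<le> exp (L * (s - T0))" using False nn by simp
      then have "L\<^sup>2 / 4 * (1 + exp (L * (s - T0))) \<le> L\<^sup>2 / 4 * (2 * exp (L * (s - T0)))"
        by (intro mult_left_mono) auto
      also have "\<dots> \<le> kap\<^sup>2 / 2 + L\<^sup>2 / 2 * exp (L * (s - T0))" by simp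
      finally show ?thesis using False by (simp add: ell_def wt_def)
    qed
    from mult_left_mono[OF this nn(2)]
    have "ell kap L T0 s * (D * wt L T0 s) \<le> D * kap\<^sup>2 / 2 + D * L\<^sup>2 / 2 * exp (L * (s - T0))"
      by (simp add: algebra_simps)
    moreover have "D * L\<^sup>2 / 2 * exp (- L * T0) * exp (L * s) = D * L\<^sup>2 / 2 * exp (L * (s - T0))"
      using e by (simp only: mult.assoc)
    ultimately show ?thesis using le[OF that] by linarith
  qed
  from response_bound[OF bc t this] nn
  have "norm (response F t) \<le> (D * kap\<^sup>2 / 2 + \<beta>) / kap\<^sup>2
      + D * L\<^sup>2 / 2 * exp (- L * T0) * exp (L * t) / (kap + L)\<^sup>2" by auto
  also have "(D * kap\<^sup>2 / 2 + \<beta>) / kap\<^sup>2 = D / 2 + \<beta> / kap\<^sup>2" using kap by (simp add: field_simps)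
  also have "D * L\<^sup>2 / 2 * exp (- L * T0) * exp (L * t) / (kap + L)\<^sup>2
      = D / 2 * exp (L * (t - T0)) * (L\<^sup>2 / (kap + L)\<^sup>2)"
    by (simp add: algebra_simps exp_diff exp_minus divide_simps)
  also have "\<dots> \<le> D / 2 * exp (L * (t - T0)) * 1"
    using nn kap by (intro mult_left_mono) (auto simp: divide_le_eq_1 intro!: power_mono)
  finally show ?thesis by (simp add: wt_def algebra_simps)
qed

text \<open>The weighted supremum \<open>D\<close> of \<open>E\<close> satisfies \<open>D \<le> D / 2 + \<beta> / kap\<^sup>2\<close>.\<close>

lemma response_gronwall:
  assumes E: "bounded_cont T E" and G: "bounded_cont T G" and L: "L \<ge> 0" and \<beta>: "\<beta> \<ge> 0"
    and eq: "\<And>t. t < T \<Longrightarrow> E t = response G t"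
    and le: "\<And>s. s < T \<Longrightarrow> norm (G s) \<le> ell kap L T0 s * norm (E s) + \<beta>"
    and t: "t < T"
  shows "norm (E t) \<le> 2 * \<beta> / kap\<^sup>2 * wt L T0 t"
proof -
  define q where "q s = norm (E s) / wt L T0 s" for s
  define D where "D = (SUP s\<in>{..<T}. q s)"
  have wt0: "wt L T0 s > 0" for s using wt_ge_1[of L T0 s] by linarith
  obtain M where M: "M > 0" "\<And>s. s < T \<Longrightarrow> norm (E s) \<le> M" using bounded_contD[OF E] by blast
  have q: "q s \<le> M" if "s < T" for s
  proof -
    have "norm (E s) \<le> M * wt L T0 s"
      using mult_mono[OF M(2)[OF that] wt_ge_1[of L T0 s]] M(1) by auto
    then show ?thesis using wt0 by (simp add: q_def pos_divide_le_eq)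
  qed
  \<comment> \<open>\<open>E\<close> is bounded and the weight is at least \<open>1\<close>, so the
    supremum \<open>D\<close> is finite and an inequality of \<open>D\<close> against
    \<open>D / 2\<close> can be solved.\<close>
  then have bdd: "bdd_above (q ` {..<T})" by (intro bdd_aboveI2[of _ _ M]) auto
  have qD: "q s \<le> D" if "s < T" for s
    unfolding D_def using that bdd by (intro cSUP_upper) auto
  then have ED: "norm (E s) \<le> D * wt L T0 s" if "s < T" for s
    using mult_right_mono[OF qD[OF that], of "wt L T0 s"] wt0[of s] by (simp add: q_def)
  have D0: "D \<ge> 0" using qD[OF t] wt0[of t] by (auto simp: q_def intro: order_trans[rotated])
  have "q s \<le> D / 2 + \<beta> / kap\<^sup>2" if s: "s < T" for s
  proof -
    have "norm (G r) \<le> ell kap L T0 r * (D * wt L T0 r) + \<beta>" if "r \<le> s" for r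
      using that s by (intro order_trans[OF le] add_mono mult_left_mono ED ell_nonneg) auto
    from response_bound_wt[OF G s L D0 \<beta> this] eq[OF s]
    have "norm (E s) \<le> D / 2 * wt L T0 s + \<beta> / kap\<^sup>2 * 1" by auto
    also have "\<dots> \<le> D / 2 * wt L T0 s + \<beta> / kap\<^sup>2 * wt L T0 s"
      using \<beta> wt_ge_1 by (intro add_left_mono mult_left_mono) auto
    finally show ?thesis using wt0[of s] by (simp add: q_def pos_divide_le_eq distrib_right)
  qed
  then have "D \<le> D / 2 + \<beta> / kap\<^sup>2" unfolding D_def using t by (intro cSUP_least) auto
  then have "D \<le> 2 * \<beta> / kap\<^sup>2" by simp
  then have "D * wt L T0 t \<le> 2 * \<beta> / kap\<^sup>2 * wt L T0 t"
    using wt0 by (intro mult_right_mono) (auto intro: less_imp_le)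
  with ED[OF t] show ?thesis by linarith
qed

text \<open>With \<open>\<beta> = 0\<close> this is uniqueness, with \<open>\<beta>\<close>
  proportional to a parameter change it is Lipschitz dependence.\<close>

corollary response_diff_le:
  assumes xy: "bounded_cont T x" "bounded_cont T y" and FG: "bounded_cont T F" "bounded_cont T G"
    and L: "L \<ge> 0" and \<beta>: "\<beta> \<ge> 0"
    and x: "\<And>t. t < T \<Longrightarrow> x t = response F t" and y: "\<And>t. t < T \<Longrightarrow> y t = response G t"
    and le: "\<And>s. s < T \<Longrightarrow> norm (F s - G s) \<le> ell kap L T0 s * norm (x s - y s) + \<beta>"
    and t: "t < T"
  shows "norm (x t - y t) \<le> 2 * \<beta> / kap\<^sup>2 * wt L T0 t"
  by (rule response_gronwall[OF bounded_cont_diff[OF xy] bounded_cont_diff[OF FG] L \<beta> _ le t])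
    (simp_all add: response_diff[OF FG] x y)

text \<open>Picard iteration under a pointwise constraint \<open>z s \<in> S s\<close>, so the
  nonlinearity has to be controlled on \<open>S s\<close> only. The constraint will be void for the
  linearised equation, reality together with smallness near minus infinity for the nonlinear one,
  and a tube around a known solution for the complexified one.\<close>

lemma response_fixed_point:
  assumes L: "L \<ge> 0" and clo: "\<And>s. s < T \<Longrightarrow> closed (S s)"
    and cont: "\<And>z. bounded_cont T z \<Longrightarrow> (\<And>s. s < T \<Longrightarrow> z s \<in> S s) \<Longrightarrow> continuous_on {..<T} (\<lambda>s. H s (z s))"
    and lip: "\<And>s x y. s < T \<Longrightarrow> x \<in> S s \<Longrightarrow> y \<in> S s \<Longrightarrow> norm (H s x - H s y) \<le> ell kap L T0 s * norm (x - y)"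
    and inv: "\<And>z t. bounded_cont T z \<Longrightarrow> (\<And>s. s < T \<Longrightarrow> z s \<in> S s) \<Longrightarrow> t < T
        \<Longrightarrow> bounded_cont T (\<lambda>s. H s (z s)) \<Longrightarrow> response (\<lambda>s. H s (z s)) t \<in> S t"
    and z0: "bounded_cont T z0" "\<And>s. s < T \<Longrightarrow> z0 s \<in> S s" and H0: "bounded_cont T (\<lambda>s. H s (z0 s))"
  obtains z where "bounded_cont T z" "\<And>s. s < T \<Longrightarrow> z s \<in> S s" "bounded_cont T (\<lambda>s. H s (z s))"
    "\<And>t. t < T \<Longrightarrow> z t = response (\<lambda>s. H s (z s)) t"
proof -
  define C where "C = kap\<^sup>2 / 4 + L\<^sup>2 / 4"
  have C0: "C \<ge> 0" and ellC: "\<And>s. ell kap L T0 s \<le> C" using ell_le by (auto simp: C_def)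
  \<comment> \<open>One admissible function with bounded forcing suffices: the Lipschitz bound
    carries boundedness over to all others.\<close>
  have bH: "bounded_cont T (\<lambda>s. H s (z s))" if z: "bounded_cont T z" "\<And>s. s < T \<Longrightarrow> z s \<in> S s" for z
  proof -
    obtain M M0 where M: "\<And>s. s < T \<Longrightarrow> norm (z s - z0 s) \<le> M" "\<And>s. s < T \<Longrightarrow> norm (H s (z0 s)) \<le> M0"
      using bounded_contD[OF bounded_cont_diff[OF z(1) z0(1)]] bounded_contD[OF H0] by blast
    show ?thesis
    proof (rule bounded_contI[OF cont[OF z]])
      fix s assume s: "s < T"
      have "norm (H s (z s)) \<le> norm (H s (z0 s)) + norm (H s (z s) - H s (z0 s))"
        by (metis add.commute diff_add_cancel norm_triangle_ineq)
      also have "\<dots> \<le> M0 + C * M"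
        using s z z0 M by (intro add_mono order_trans[OF lip] mult_mono ellC C0) auto
      finally show "norm (H s (z s)) \<le> M0 + C * M" .
    qed auto
  qed
  define Z where "Z n = ((\<lambda>z. response (\<lambda>s. H s (z s))) ^^ n) z0" for n
  have ZS: "Z (Suc n) = response (\<lambda>s. H s (Z n s))" for n by (simp add: Z_def)
  have Z: "bounded_cont T (Z n) \<and> (\<forall>s<T. Z n s \<in> S s)" for n
  proof (induction n)
    case 0 then show ?case using z0 by (simp add: Z_def)
  next
    case (Suc n)
    then have "bounded_cont T (\<lambda>s. H s (Z n s))" by (intro bH) auto
    with Suc show ?case by (auto simp: ZS intro!: bounded_cont_response inv)
  qed
  then have HZ: "bounded_cont T (\<lambda>s. H s (Z n s))" for n by (intro bH) auto
  obtain D where D: "D > 0" "\<And>t. t < T \<Longrightarrow> norm (Z (Suc 0) t - Z 0 t) \<le> D"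
    using bounded_contD[OF bounded_cont_diff, of T "Z (Suc 0)" "Z 0"] Z by blast
  have step: "t < T \<Longrightarrow> norm (Z (Suc n) t - Z n t) \<le> D * (1/2) ^ n * wt L T0 t" for n t
  proof (induction n arbitrary: t)
    case 0 then show ?case using D mult_mono[OF D(2)[OF 0] wt_ge_1] by simp
  next
    case (Suc n)
    have "Z (Suc (Suc n)) t - Z (Suc n) t = response (\<lambda>s. H s (Z (Suc n) s) - H s (Z n s)) t"
      using response_diff[OF HZ[of "Suc n"] HZ[of n] Suc.prems] unfolding ZS[symmetric] .
    moreover have "norm \<dots> \<le> (D * (1/2) ^ n) / 2 * wt L T0 t + 0 / kap\<^sup>2"
    proof (rule response_bound_wt[OF bounded_cont_diff[OF HZ HZ] Suc.prems L])
      fix s assume "s \<le> t"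
      then have s: "s < T" using Suc.prems by simp
      show "norm (H s (Z (Suc n) s) - H s (Z n s)) \<le> ell kap L T0 s * (D * (1/2) ^ n * wt L T0 s) + 0"
        using s Z[of "Suc n"] Z[of n]
        by (auto intro!: order_trans[OF lip] mult_left_mono Suc.IH ell_nonneg)
    qed (use D in auto)
    ultimately show ?case by simp
  qed
  define W where "W = wt L T0 T"
  have W: "wt L T0 t \<le> W" if "t < T" for t using that wt_mono[OF L] by (simp add: W_def)
  \<comment> \<open>The weight is bounded by \<open>W\<close> on \<open>{..<T}\<close>, so halving
    in the weighted norm gives an unweighted geometric majorant.\<close>
  have "uniform_limit {..<T} (\<lambda>n t. \<Sum>i<n. Z (Suc i) t - Z i t) (\<lambda>t. \<Sum>i. Z (Suc i) t - Z i t) sequentially"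
  proof (rule Weierstrass_m_test)
    show "norm (Z (Suc n) t - Z n t) \<le> D * W * (1/2) ^ n" if "t \<in> {..<T}" for n t
    proof -
      have "D * (1/2) ^ n * wt L T0 t \<le> D * (1/2) ^ n * W"
        using that W D by (intro mult_left_mono) auto
      with step[of t n] that show ?thesis by (simp add: mult_ac)
    qed
    show "summable (\<lambda>n. D * W * (1/2) ^ n)" by (intro summable_mult summable_geometric) auto
  qed
  moreover have "(\<Sum>i<n. Z (Suc i) t - Z i t) = Z n t - Z 0 t" for n t
    by (induction n) auto
  ultimately have lim0: "uniform_limit {..<T} (\<lambda>n t. Z n t - Z 0 t) (\<lambda>t. \<Sum>i. Z (Suc i) t - Z i t) sequentially"
    by simp
  define z where "z t = Z 0 t + (\<Sum>i. Z (Suc i) t - Z i t)" for t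
  have lim: "uniform_limit {..<T} Z z sequentially"
    using uniform_limit_add[OF uniform_limit_const lim0, of "Z 0"] by (simp add: z_def[abs_def])
  have lim_pt: "(\<lambda>n. Z n t) \<longlonglongrightarrow> z t" if "t < T" for t
    using tendsto_uniform_limitI[OF lim, of t] that by simp
  have zS: "z s \<in> S s" if "s < T" for s
    using closed_sequentially[OF clo[OF that] _ lim_pt[OF that]] Z that by auto
  have zb: "bounded_cont T z"
  proof -
    have "eventually (\<lambda>n. \<forall>t\<in>{..<T}. dist (Z n t) (z t) < 1) sequentially"
      using uniform_limitD[OF lim, of 1] by simp
    then obtain n where n: "\<forall>t\<in>{..<T}. dist (Z n t) (z t) < 1"
      by (auto simp: eventually_sequentially)
    obtain M where M: "\<And>t. t < T \<Longrightarrow> norm (Z n t) \<le> M" using bounded_contD[of T "Z n"] Z by blast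
    show ?thesis
    proof (rule bounded_contI)
      show "continuous_on {..<T} z"
        using Z by (intro uniform_limit_theorem[OF _ lim]) (auto simp: bounded_cont_def)
      show "norm (z t) \<le> M + 1" if "t < T" for t
      proof -
        have "norm (z t) \<le> norm (Z n t) + dist (Z n t) (z t)"
          unfolding dist_norm by (metis norm_minus_commute norm_triangle_sub)
        moreover have "dist (Z n t) (z t) < 1" using n that by simp
        ultimately show ?thesis using M[OF that] by linarith
      qed
    qed
  qed
  have "z t = response (\<lambda>s. H s (z s)) t" if t: "t < T" for t
  proof (rule LIMSEQ_unique)
    show "(\<lambda>n. Z (Suc n) t) \<longlonglongrightarrow> z t" using lim_pt[OF t] by (rule LIMSEQ_Suc)
    show "(\<lambda>n. Z (Suc n) t) \<longlonglongrightarrow> response (\<lambda>s. H s (z s)) t"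
    proof (rule metric_LIMSEQ_I)
      fix e :: real assume e: "e > 0"
      \<comment> \<open>A change of \<open>z\<close> by \<open>d\<close> moves the response by at
        most \<open>C * d / kap\<^sup>2 = e * C / (2 * (C + 1)) < e\<close>.\<close>
      define d where "d = e * kap\<^sup>2 / (2 * (C + 1))"
      have C1: "C + 1 > 0" using C0 by linarith
      have d: "d > 0" using e kap C1 unfolding d_def by (intro divide_pos_pos mult_pos_pos) auto
      obtain n0 where n0: "\<And>n s. n \<ge> n0 \<Longrightarrow> s < T \<Longrightarrow> dist (Z n s) (z s) < d"
        using uniform_limitD[OF lim d] unfolding eventually_sequentially Ball_def lessThan_iff by blast
      show "\<exists>n0. \<forall>n\<ge>n0. dist (Z (Suc n) t) (response (\<lambda>s. H s (z s)) t) < e"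
      proof (intro exI allI impI)
        fix n assume n: "n \<ge> n0"
        have "norm (response (\<lambda>s. H s (Z n s) - H s (z s)) t) \<le> (C * d) / kap\<^sup>2"
        proof (rule response_bound_const[OF bounded_cont_diff[OF HZ bH[OF zb zS]] t])
          fix s assume "s \<le> t"
          then have s: "s < T" using t by simp
          show "norm (H s (Z n s) - H s (z s)) \<le> C * d"
            using s Z[of n] zS[OF s] n0[OF n s] C0
            by (auto intro!: order_trans[OF lip] mult_mono ellC simp: dist_norm)
        qed auto
        also have "\<dots> = e * (C / (2 * (C + 1)))"
          using kap unfolding d_def by (simp only: times_divide_eq_right) simp
        also have "\<dots> < e * 1"
          using C0 e by (intro mult_strict_left_mono) (simp_all add: divide_less_eq)
        finally show "dist (Z (Suc n) t) (response (\<lambda>s. H s (z s)) t) < e"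
          using response_diff[OF HZ bH[OF zb zS] t] ZS by (simp add: dist_norm)
      qed
    qed
  qed
  with zb zS bH[OF zb zS] that show ?thesis by blast
qed

end

subsection \<open>Dependence on parameters\<close>

text \<open>One \<open>d\<close> serves all base points and all \<open>t < T\<close>. Uniformity in
  the base point makes the derivative continuous without a further estimate, and the general field
  covers real and complex parameters together.\<close>

definition uniform_deriv ::
  "'a::real_normed_field set \<Rightarrow> real \<Rightarrow> ('a \<Rightarrow> real \<Rightarrow> 'a) \<Rightarrow> ('a \<Rightarrow> real \<Rightarrow> 'a) \<Rightarrow> bool" where
  "uniform_deriv I T z y \<longleftrightarrow> (\<forall>e>0. \<exists>d>0. \<forall>\<mu>\<in>I. \<forall>\<nu>\<in>I. norm (\<nu> - \<mu>) < d \<longrightarrow>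
    (\<forall>t<T. norm (z \<nu> t - z \<mu> t - (\<nu> - \<mu>) * y \<mu> t) \<le> e * norm (\<nu> - \<mu>)))"

lemma uniform_derivD:
  assumes "uniform_deriv I T z y" "e > 0"
  shows "\<exists>d>0. \<forall>\<mu> \<nu> t. \<mu> \<in> I \<longrightarrow> \<nu> \<in> I \<longrightarrow> norm (\<nu> - \<mu>) < d \<longrightarrow> t < T \<longrightarrow>
    norm (z \<nu> t - z \<mu> t - (\<nu> - \<mu>) * y \<mu> t) \<le> e * norm (\<nu> - \<mu>)"
proof -
  obtain d where d: "d > 0" "\<forall>\<mu>\<in>I. \<forall>\<nu>\<in>I. norm (\<nu> - \<mu>) < d \<longrightarrow>
    (\<forall>t<T. norm (z \<nu> t - z \<mu> t - (\<nu> - \<mu>) * y \<mu> t) \<le> e * norm (\<nu> - \<mu>))"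
    using assms(1)[unfolded uniform_deriv_def, rule_format, OF assms(2)] by (elim exE conjE)
  show ?thesis
    by (intro exI[of _ d] conjI allI impI d(1) d(2)[rule_format])
qed

lemma uniform_deriv_has_field_derivative:
  assumes z: "uniform_deriv I T z y" and J: "open J" "J \<subseteq> I" "\<mu> \<in> J" and t: "t < T"
  shows "((\<lambda>\<mu>. z \<mu> t) has_field_derivative y \<mu> t) (at \<mu>)"
proof -
  have "\<exists>d>0. \<forall>\<nu>\<in>J. norm (\<nu> - \<mu>) < d \<longrightarrow> norm (z \<nu> t - z \<mu> t - y \<mu> t * (\<nu> - \<mu>)) \<le> e * norm (\<nu> - \<mu>)"
    if e: "e > 0" for e
  proof -
    obtain d where "d > 0" "\<And>\<mu> \<nu> t. \<mu> \<in> I \<Longrightarrow> \<nu> \<in> I \<Longrightarrow> norm (\<nu> - \<mu>) < d \<Longrightarrow> t < T \<Longrightarrow>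
        norm (z \<nu> t - z \<mu> t - (\<nu> - \<mu>) * y \<mu> t) \<le> e * norm (\<nu> - \<mu>)"
      using uniform_derivD[OF z e] by blast
    then show ?thesis using J t unfolding mult.commute[of "y \<mu> t"] by blast
  qed
  then have "((\<lambda>\<mu>. z \<mu> t) has_derivative (*) (y \<mu> t)) (at \<mu> within J)"
    unfolding has_derivative_within_alt using bounded_linear_mult_right by blast
  then show ?thesis unfolding has_field_derivative_def at_within_open[OF J(3,1)] .
qed

lemma uniform_deriv_continuous:
  assumes z: "uniform_deriv I T z y" and \<mu>: "\<mu> \<in> I" and y: "bounded_cont T (y \<mu>)" and e: "e > 0"
  shows "\<exists>d>0. \<forall>\<nu>\<in>I. norm (\<nu> - \<mu>) < d \<longrightarrow> (\<forall>t<T. norm (z \<nu> t - z \<mu> t) \<le> e)"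
proof -
  obtain M where M: "M > 0" "\<And>t. t < T \<Longrightarrow> norm (y \<mu> t) \<le> M" using bounded_contD[OF y] by blast
  obtain d where d: "d > 0" "\<And>\<nu> t. \<nu> \<in> I \<Longrightarrow> norm (\<nu> - \<mu>) < d \<Longrightarrow> t < T \<Longrightarrow>
      norm (z \<nu> t - z \<mu> t - (\<nu> - \<mu>) * y \<mu> t) \<le> 1 * norm (\<nu> - \<mu>)"
    using uniform_derivD[OF z zero_less_one] \<mu> by blast
  have "norm (z \<nu> t - z \<mu> t) \<le> e" if \<nu>: "\<nu> \<in> I" "norm (\<nu> - \<mu>) < min d (e / (M + 1))" and t: "t < T" for \<nu> t
  proof -
    have "norm (z \<nu> t - z \<mu> t) \<le> norm (z \<nu> t - z \<mu> t - (\<nu> - \<mu>) * y \<mu> t) + norm ((\<nu> - \<mu>) * y \<mu> t)"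
      using norm_triangle_ineq[of "z \<nu> t - z \<mu> t - (\<nu> - \<mu>) * y \<mu> t" "(\<nu> - \<mu>) * y \<mu> t"] by simp
    also have "\<dots> \<le> 1 * norm (\<nu> - \<mu>) + norm (\<nu> - \<mu>) * M"
      unfolding norm_mult using d(2)[OF \<nu>(1) _ t] M(2)[OF t] \<nu>(2) by (intro add_mono mult_left_mono) auto
    also have "\<dots> = norm (\<nu> - \<mu>) * (M + 1)" by (simp add: algebra_simps)
    also have "\<dots> \<le> e / (M + 1) * (M + 1)" using \<nu>(2) M by (intro mult_right_mono) auto
    finally show ?thesis using M by simp
  qed
  then show ?thesis using d(1) M(1) e by (intro exI[of _ "min d (e / (M + 1))"]) auto
qed

text \<open>Exchanging \<open>\<mu>\<close> and \<open>\<nu>\<close> in the estimate and adding shows that the derivative is continuous.\<close>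

lemma uniform_deriv_deriv_continuous:
  assumes z: "uniform_deriv I T z y" and \<mu>: "\<mu> \<in> I" and e: "e > 0"
  shows "\<exists>d>0. \<forall>\<nu>\<in>I. norm (\<nu> - \<mu>) < d \<longrightarrow> (\<forall>t<T. norm (y \<nu> t - y \<mu> t) \<le> e)"
proof -
  obtain d where d: "d > 0" "\<And>\<mu> \<nu> t. \<mu> \<in> I \<Longrightarrow> \<nu> \<in> I \<Longrightarrow> norm (\<nu> - \<mu>) < d \<Longrightarrow> t < T \<Longrightarrow>
      norm (z \<nu> t - z \<mu> t - (\<nu> - \<mu>) * y \<mu> t) \<le> e / 2 * norm (\<nu> - \<mu>)"
    using uniform_derivD[OF z half_gt_zero[OF e]] by blast
  have "norm (y \<nu> t - y \<mu> t) \<le> e" if \<nu>: "\<nu> \<in> I" "norm (\<nu> - \<mu>) < d" and t: "t < T" for \<nu> t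
  proof (cases "\<nu> = \<mu>")
    case False
    let ?A = "z \<nu> t - z \<mu> t - (\<nu> - \<mu>) * y \<mu> t" and ?B = "z \<mu> t - z \<nu> t - (\<mu> - \<nu>) * y \<nu> t"
    have "norm ?A \<le> e / 2 * norm (\<nu> - \<mu>)" "norm ?B \<le> e / 2 * norm (\<nu> - \<mu>)"
      using d(2)[OF \<mu> \<nu>(1) _ t] d(2)[OF \<nu>(1) \<mu> _ t] \<nu>(2) by (simp_all add: norm_minus_commute)
    then have le: "norm (?A + ?B) \<le> e / 2 * norm (\<nu> - \<mu>) + e / 2 * norm (\<nu> - \<mu>)"
      by (intro order_trans[OF norm_triangle_ineq] add_mono)
    have "?A + ?B = (\<nu> - \<mu>) * (y \<nu> t - y \<mu> t)" by (simp add: algebra_simps)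
    then have "norm (\<nu> - \<mu>) * norm (y \<nu> t - y \<mu> t) \<le> norm (\<nu> - \<mu>) * e"
      using le unfolding norm_mult[symmetric] by (simp add: mult.commute)
    then show ?thesis using False by simp
  qed (use e in auto)
  with d(1) show ?thesis by blast
qed

text \<open>The time derivative of a response is \<open>l2\<close> times the response plus
  \<open>duhamel l1\<close> of the forcing; this rule carries parameter differentiability over to
  it.\<close>

lemma uniform_deriv_cmult_add:
  assumes z: "uniform_deriv I T z y" and z': "uniform_deriv I T z' y'"
  shows "uniform_deriv I T (\<lambda>\<mu> t. c * z \<mu> t + z' \<mu> t) (\<lambda>\<mu> t. c * y \<mu> t + y' \<mu> t)"
  unfolding uniform_deriv_def
proof (intro allI impI)
  fix e :: real assume e: "e > 0"
  define e1 where "e1 = e / (norm c + 1)"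
  have n: "norm c + 1 > 0" by (simp add: add_nonneg_pos)
  have e1: "e1 > 0" using e n by (simp add: e1_def)
  have "(norm c + 1) * e1 = e" unfolding e1_def using n by simp
  then have e1_sum: "norm c * e1 + e1 = e" by (simp add: distrib_right)
  obtain d where d: "d > 0" "\<And>\<mu> \<nu> t. \<mu> \<in> I \<Longrightarrow> \<nu> \<in> I \<Longrightarrow> norm (\<nu> - \<mu>) < d \<Longrightarrow> t < T \<Longrightarrow>
      norm (z \<nu> t - z \<mu> t - (\<nu> - \<mu>) * y \<mu> t) \<le> e1 * norm (\<nu> - \<mu>)"
    using uniform_derivD[OF z e1] by blast
  obtain d' where d': "d' > 0" "\<And>\<mu> \<nu> t. \<mu> \<in> I \<Longrightarrow> \<nu> \<in> I \<Longrightarrow> norm (\<nu> - \<mu>) < d' \<Longrightarrow> t < T \<Longrightarrow>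
      norm (z' \<nu> t - z' \<mu> t - (\<nu> - \<mu>) * y' \<mu> t) \<le> e1 * norm (\<nu> - \<mu>)"
    using uniform_derivD[OF z' e1] by blast
  have "norm (c * z \<nu> t + z' \<nu> t - (c * z \<mu> t + z' \<mu> t) - (\<nu> - \<mu>) * (c * y \<mu> t + y' \<mu> t)) \<le> e * norm (\<nu> - \<mu>)"
    if I: "\<mu> \<in> I" "\<nu> \<in> I" and near: "norm (\<nu> - \<mu>) < min d d'" and t: "t < T" for \<mu> \<nu> t
  proof -
    let ?A = "z \<nu> t - z \<mu> t - (\<nu> - \<mu>) * y \<mu> t" and ?B = "z' \<nu> t - z' \<mu> t - (\<nu> - \<mu>) * y' \<mu> t"
    have "c * z \<nu> t + z' \<nu> t - (c * z \<mu> t + z' \<mu> t) - (\<nu> - \<mu>) * (c * y \<mu> t + y' \<mu> t) = c * ?A + ?B"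
      by (simp add: algebra_simps)
    also have "norm \<dots> \<le> norm c * norm ?A + norm ?B" unfolding norm_mult[symmetric] by (rule norm_triangle_ineq)
    also have "\<dots> \<le> norm c * (e1 * norm (\<nu> - \<mu>)) + e1 * norm (\<nu> - \<mu>)"
      using d(2)[OF I _ t] d'(2)[OF I _ t] near by (intro add_mono mult_left_mono) auto
    also have "\<dots> = (norm c * e1 + e1) * norm (\<nu> - \<mu>)" by (simp add: algebra_simps)
    finally show ?thesis unfolding e1_sum .
  qed
  then show "\<exists>d>0. \<forall>\<mu>\<in>I. \<forall>\<nu>\<in>I. norm (\<nu> - \<mu>) < d \<longrightarrow> (\<forall>t<T.
      norm (c * z \<nu> t + z' \<nu> t - (c * z \<mu> t + z' \<mu> t) - (\<nu> - \<mu>) * (c * y \<mu> t + y' \<mu> t)) \<le> e * norm (\<nu> - \<mu>))"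
    using d(1) d'(1) by (intro exI[of _ "min d d'"]) auto
qed

text \<open>Real families are treated inside the complex theory with parameters embedded as
  \<open>of_real r\<close>; this leads back to real derivatives.\<close>

lemma uniform_deriv_Re:
  assumes "uniform_deriv I T z y" "\<And>r. r \<in> J \<Longrightarrow> complex_of_real r \<in> I"
  shows "uniform_deriv J T (\<lambda>r t. Re (z (of_real r) t)) (\<lambda>r t. Re (y (of_real r) t))"
  unfolding uniform_deriv_def
proof (intro allI impI)
  fix e :: real assume "e > 0"
  then obtain d where d: "d > 0" "\<And>\<mu> \<nu> t. \<mu> \<in> I \<Longrightarrow> \<nu> \<in> I \<Longrightarrow> norm (\<nu> - \<mu>) < d \<Longrightarrow> t < T \<Longrightarrow>
      norm (z \<nu> t - z \<mu> t - (\<nu> - \<mu>) * y \<mu> t) \<le> e * norm (\<nu> - \<mu>)"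
    using uniform_derivD[OF assms(1)] by blast
  have "norm (Re (z (of_real s) t) - Re (z (of_real r) t) - (s - r) * Re (y (of_real r) t)) \<le> e * norm (s - r)"
    if J: "r \<in> J" "s \<in> J" and near: "norm (s - r) < d" and t: "t < T" for r s t
  proof -
    let ?A = "z (of_real s) t - z (of_real r) t - (of_real s - of_real r) * y (of_real r) t"
    have n: "norm (complex_of_real s - of_real r) = norm (s - r)" by (simp flip: of_real_diff)
    have "Re (z (of_real s) t) - Re (z (of_real r) t) - (s - r) * Re (y (of_real r) t) = Re ?A" by simp
    moreover have "norm ?A \<le> e * norm (s - r)"
      using d(2)[OF assms(2)[OF J(1)] assms(2)[OF J(2)] _ t] near unfolding n by blast
    ultimately show ?thesis using abs_Re_le_cmod[of ?A] by simp
  qed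
  with d(1) show "\<exists>d>0. \<forall>r\<in>J. \<forall>s\<in>J. norm (s - r) < d \<longrightarrow> (\<forall>t<T.
      norm (Re (z (of_real s) t) - Re (z (of_real r) t) - (s - r) * Re (y (of_real r) t)) \<le> e * norm (s - r))"
    by blast
qed

section \<open>Parameter derivatives of fixed points and bounded solutions of the second order
  equation\<close>

context decay
begin

text \<open>Its purpose is to turn remainders that are small relative to the change of
  \<open>z\<close> into remainders that are small relative to the change of
  \<open>\<mu>\<close>.\<close>

lemma response_parameter_lipschitz:
  assumes L: "L \<ge> 0" and g: "bounded_cont T g"
    and zb: "\<And>\<mu>. \<mu> \<in> I \<Longrightarrow> bounded_cont T (z \<mu>)"
    and Qb: "\<And>\<mu>. \<mu> \<in> I \<Longrightarrow> bounded_cont T (\<lambda>s. Q s (z \<mu> s))"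
    and eq: "\<And>\<mu> t. \<mu> \<in> I \<Longrightarrow> t < T \<Longrightarrow> z \<mu> t = response (\<lambda>s. Q s (z \<mu> s) - \<mu> * g s) t"
    and lip: "\<And>\<mu> \<nu> s. \<mu> \<in> I \<Longrightarrow> \<nu> \<in> I \<Longrightarrow> s < T \<Longrightarrow>
      norm (Q s (z \<nu> s) - Q s (z \<mu> s)) \<le> ell kap L T0 s * norm (z \<nu> s - z \<mu> s)"
  shows "\<exists>C>0. \<forall>\<mu>\<in>I. \<forall>\<nu>\<in>I. \<forall>t<T. norm (z \<nu> t - z \<mu> t) \<le> C * norm (\<nu> - \<mu>)"
proof -
  obtain M where M: "M > 0" "\<And>s. s < T \<Longrightarrow> norm (g s) \<le> M" using bounded_contD[OF g] by blast
  have gc: "bounded_cont T (\<lambda>s. \<mu> * g s)" for \<mu> by (intro bounded_cont_mult bounded_cont_const g)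
  have "norm (z \<nu> t - z \<mu> t) \<le> (2 * M / kap\<^sup>2 * wt L T0 T) * norm (\<nu> - \<mu>)"
    if I: "\<mu> \<in> I" "\<nu> \<in> I" and t: "t < T" for \<mu> \<nu> t
  proof -
    let ?F = "\<lambda>\<mu> s. Q s (z \<mu> s) - \<mu> * g s"
    have Fb: "bounded_cont T (?F \<nu>)" "bounded_cont T (?F \<mu>)"
      using I by (auto intro!: bounded_cont_diff Qb gc)
    have "norm (z \<nu> t - z \<mu> t) \<le> 2 * (M * norm (\<nu> - \<mu>)) / kap\<^sup>2 * wt L T0 t"
    proof (rule response_diff_le[OF zb[OF I(2)] zb[OF I(1)] Fb L _ eq[OF I(2)] eq[OF I(1)] _ t])
      fix s assume s: "s < T"
      have "?F \<nu> s - ?F \<mu> s = (Q s (z \<nu> s) - Q s (z \<mu> s)) - (\<nu> - \<mu>) * g s" by (simp add: algebra_simps)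
      then have "norm (?F \<nu> s - ?F \<mu> s) \<le> norm (Q s (z \<nu> s) - Q s (z \<mu> s)) + norm (\<nu> - \<mu>) * norm (g s)"
        by (metis norm_mult norm_triangle_ineq4)
      also have "\<dots> \<le> ell kap L T0 s * norm (z \<nu> s - z \<mu> s) + norm (\<nu> - \<mu>) * M"
        using lip[OF I s] M(2)[OF s] by (intro add_mono mult_left_mono) auto
      finally show "norm (?F \<nu> s - ?F \<mu> s) \<le> ell kap L T0 s * norm (z \<nu> s - z \<mu> s) + M * norm (\<nu> - \<mu>)"
        by (simp add: mult.commute)
    qed (use M in auto)
    also have "\<dots> \<le> 2 * (M * norm (\<nu> - \<mu>)) / kap\<^sup>2 * wt L T0 T"
      using M L t by (intro mult_left_mono wt_mono) auto
    finally show ?thesis by (simp add: mult_ac)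
  qed
  moreover have "2 * M / kap\<^sup>2 * wt L T0 T > 0"
    using M kap wt_ge_1[of L T0 T] by (intro mult_pos_pos divide_pos_pos) auto
  ultimately show ?thesis by blast
qed

text \<open>\<open>Q\<close> is kept abstract, and its first order expansion is required only
  between values taken by the family. Hence a real \<open>C\<^sup>1\<close> nonlinearity and a
  holomorphic one are both admissible. The second derivative family \<open>\<eta>\<close> belongs to
  the first Duhamel step and is what controls the time derivative of \<open>z\<close>.\<close>

lemma response_parameter_diff:
  assumes L: "L \<ge> 0" and g: "bounded_cont T g"
    and zb: "\<And>\<mu>. \<mu> \<in> I \<Longrightarrow> bounded_cont T (z \<mu>)"
    and Qb: "\<And>\<mu>. \<mu> \<in> I \<Longrightarrow> bounded_cont T (\<lambda>s. Q s (z \<mu> s))"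
    and eq: "\<And>\<mu> t. \<mu> \<in> I \<Longrightarrow> t < T \<Longrightarrow> z \<mu> t = response (\<lambda>s. Q s (z \<mu> s) - \<mu> * g s) t"
    and lip: "\<And>\<mu> \<nu> s. \<mu> \<in> I \<Longrightarrow> \<nu> \<in> I \<Longrightarrow> s < T \<Longrightarrow>
      norm (Q s (z \<nu> s) - Q s (z \<mu> s)) \<le> ell kap L T0 s * norm (z \<nu> s - z \<mu> s)"
    and Q'b: "\<And>\<mu>. \<mu> \<in> I \<Longrightarrow> bounded_cont T (\<lambda>s. Q' s (z \<mu> s))"
    and Q'le: "\<And>\<mu> s. \<mu> \<in> I \<Longrightarrow> s < T \<Longrightarrow> norm (Q' s (z \<mu> s)) \<le> ell kap L T0 s"
    and diff: "\<And>e. e > 0 \<Longrightarrow> \<exists>d>0. \<forall>\<mu>\<in>I. \<forall>\<nu>\<in>I. \<forall>s<T. norm (z \<nu> s - z \<mu> s) < d \<longrightarrow>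
      norm (Q s (z \<nu> s) - Q s (z \<mu> s) - Q' s (z \<mu> s) * (z \<nu> s - z \<mu> s)) \<le> e * norm (z \<nu> s - z \<mu> s)"
  obtains y \<eta> where "\<And>\<mu>. \<mu> \<in> I \<Longrightarrow> bounded_cont T (y \<mu>)" "\<And>\<mu>. \<mu> \<in> I \<Longrightarrow> bounded_cont T (\<eta> \<mu>)"
    "uniform_deriv I T z y" "uniform_deriv I T (\<lambda>\<mu>. duhamel l1 (\<lambda>s. Q s (z \<mu> s) - \<mu> * g s)) \<eta>"
proof -
  \<comment> \<open>The linearised equation is itself a fixed point problem, with the same Lipschitz
    bound \<open>ell\<close> and no constraint on the values.\<close>
  have "\<exists>y. bounded_cont T y \<and> (\<forall>t<T. y t = response (\<lambda>s. Q' s (z \<mu> s) * y s - g s) t)"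
    if I: "\<mu> \<in> I" for \<mu>
  proof -
    have Hb: "bounded_cont T (\<lambda>s. Q' s (z \<mu> s) * y s - g s)" if "bounded_cont T y" for y
      by (intro bounded_cont_diff bounded_cont_mult Q'b I that g)
    have lip': "norm (Q' s (z \<mu> s) * x - g s - (Q' s (z \<mu> s) * y - g s)) \<le> ell kap L T0 s * norm (x - y)"
      if "s < T" for s x y
    proof -
      have "Q' s (z \<mu> s) * x - g s - (Q' s (z \<mu> s) * y - g s) = Q' s (z \<mu> s) * (x - y)"
        by (simp add: algebra_simps)
      then show ?thesis using Q'le[OF I that] by (auto simp: norm_mult intro!: mult_right_mono)
    qed
    show ?thesis
      by (rule response_fixed_point[OF L, of T "\<lambda>_. UNIV" "\<lambda>s x. Q' s (z \<mu> s) * x - g s" T0 "\<lambda>_. 0"])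
        (use Hb[THEN bounded_cont_continuous] lip' Hb[OF bounded_cont_const, of 0] in \<open>auto intro: bounded_cont_const\<close>)
  qed
  then obtain y where yb: "\<And>\<mu>. \<mu> \<in> I \<Longrightarrow> bounded_cont T (y \<mu>)"
    and yeq: "\<And>\<mu> t. \<mu> \<in> I \<Longrightarrow> t < T \<Longrightarrow> y \<mu> t = response (\<lambda>s. Q' s (z \<mu> s) * y \<mu> s - g s) t"
    by metis
  define \<eta> where "\<eta> \<mu> = duhamel l1 (\<lambda>s. Q' s (z \<mu> s) * y \<mu> s - g s)" for \<mu>
  have db: "bounded_cont T (\<lambda>s. Q' s (z \<mu> s) * y \<mu> s - g s)" if "\<mu> \<in> I" for \<mu>
    using that by (intro bounded_cont_diff bounded_cont_mult Q'b yb g)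
  have "\<exists>C>0. \<forall>\<mu>\<in>I. \<forall>\<nu>\<in>I. \<forall>t<T. norm (z \<nu> t - z \<mu> t) \<le> C * norm (\<nu> - \<mu>)"
    by (rule response_parameter_lipschitz[where I = I and z = z and Q = Q and g = g and T = T and L = L and ?T0.0 = T0])
      (fact L g zb Qb eq lip)+
  then obtain C where C: "C > 0"
    "\<And>\<mu> \<nu> t. \<mu> \<in> I \<Longrightarrow> \<nu> \<in> I \<Longrightarrow> t < T \<Longrightarrow> norm (z \<nu> t - z \<mu> t) \<le> C * norm (\<nu> - \<mu>)"
    by blast
  \<comment> \<open>\<open>K1\<close> is the constant that the a priori estimate yields for the
    error \<open>E\<close>, and \<open>K2\<close> the resulting constant for the first Duhamel step;
    \<open>e1\<close> is then scaled so that both errors stay below \<open>e\<close>.\<close>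
  define K1 where "K1 = 2 * C / kap\<^sup>2 * wt L T0 T"
  define K2 where "K2 = ((kap\<^sup>2 / 4 + L\<^sup>2 / 4) * K1 + C) / kap"
  have "wt L T0 T > 0" using wt_ge_1[of L T0 T] by linarith
  then have K1: "K1 > 0" using C(1) kap by (simp add: K1_def)
  moreover have "(kap\<^sup>2 / 4 + L\<^sup>2 / 4) * K1 \<ge> 0" using K1 by (intro mult_nonneg_nonneg) auto
  then have "(kap\<^sup>2 / 4 + L\<^sup>2 / 4) * K1 + C > 0" using C(1) by linarith
  then have "K2 > 0" using kap by (simp add: K2_def)
  ultimately have K: "K1 > 0" "K2 > 0" by auto
  let ?\<zeta> = "\<lambda>\<mu>. duhamel l1 (\<lambda>s. Q s (z \<mu> s) - \<mu> * g s)"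
  have both: "\<exists>d>0. \<forall>\<mu>\<in>I. \<forall>\<nu>\<in>I. norm (\<nu> - \<mu>) < d \<longrightarrow> (\<forall>t<T.
       norm (z \<nu> t - z \<mu> t - (\<nu> - \<mu>) * y \<mu> t) \<le> e * norm (\<nu> - \<mu>) \<and>
       norm (?\<zeta> \<nu> t - ?\<zeta> \<mu> t - (\<nu> - \<mu>) * \<eta> \<mu> t) \<le> e * norm (\<nu> - \<mu>))" if e: "e > 0" for e
  proof -
    define e1 where "e1 = e / (K1 + K2)"
    have e1: "e1 > 0" using e K by (simp add: e1_def)
    have e1K: "e1 * K1 \<le> e" "e1 * K2 \<le> e" using e K by (auto simp: e1_def field_simps)
    obtain d where d: "d > 0" "\<And>\<mu> \<nu> s. \<mu> \<in> I \<Longrightarrow> \<nu> \<in> I \<Longrightarrow> s < T \<Longrightarrow> norm (z \<nu> s - z \<mu> s) < d \<Longrightarrow>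
      norm (Q s (z \<nu> s) - Q s (z \<mu> s) - Q' s (z \<mu> s) * (z \<nu> s - z \<mu> s)) \<le> e1 * norm (z \<nu> s - z \<mu> s)"
      using diff[OF e1] by blast
    \<comment> \<open>Since \<open>C\<close> is a Lipschitz constant in the parameter,
      \<open>norm (\<nu> - \<mu>) < d / C\<close> keeps the two solutions within \<open>d\<close>,
      where the expansion of \<open>Q\<close> is valid.\<close>
    have "norm (z \<nu> t - z \<mu> t - (\<nu> - \<mu>) * y \<mu> t) \<le> e * norm (\<nu> - \<mu>) \<and>
       norm (?\<zeta> \<nu> t - ?\<zeta> \<mu> t - (\<nu> - \<mu>) * \<eta> \<mu> t) \<le> e * norm (\<nu> - \<mu>)"
      if I: "\<mu> \<in> I" "\<nu> \<in> I" and near: "norm (\<nu> - \<mu>) < d / C" and t: "t < T" for \<mu> \<nu> t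
    proof -
      let ?F = "\<lambda>\<mu> s. Q s (z \<mu> s) - \<mu> * g s"
      let ?D = "\<lambda>s. (\<nu> - \<mu>) * (Q' s (z \<mu> s) * y \<mu> s - g s)"
      let ?G = "\<lambda>s. ?F \<nu> s - ?F \<mu> s - ?D s"
      define E where "E s = z \<nu> s - z \<mu> s - (\<nu> - \<mu>) * y \<mu> s" for s
      have gc: "bounded_cont T (\<lambda>s. \<mu> * g s)" for \<mu> by (intro bounded_cont_mult bounded_cont_const g)
      have Fb: "bounded_cont T (?F \<nu>)" "bounded_cont T (?F \<mu>)"
        using I by (auto intro!: bounded_cont_diff Qb gc)
      have FFb: "bounded_cont T (\<lambda>s. ?F \<nu> s - ?F \<mu> s)" by (intro bounded_cont_diff Fb)
      have Db: "bounded_cont T ?D" using db I by (intro bounded_cont_mult bounded_cont_const) auto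
      have Gb: "bounded_cont T ?G" by (intro bounded_cont_diff[OF FFb Db])
      have Eb: "bounded_cont T E"
        unfolding E_def using I by (intro bounded_cont_diff bounded_cont_mult bounded_cont_const zb yb)
      have small: "norm (Q s (z \<nu> s) - Q s (z \<mu> s) - Q' s (z \<mu> s) * (z \<nu> s - z \<mu> s)) \<le> e1 * (C * norm (\<nu> - \<mu>))"
        if s: "s < T" for s
      proof -
        have "norm (z \<nu> s - z \<mu> s) < d"
          using C(2)[OF I s] near C(1) by (simp add: pos_less_divide_eq mult.commute)
        from d(2)[OF I s this] C(2)[OF I s] e1 show ?thesis
          by (meson less_imp_le mult_left_mono order_trans)
      qed
      have Gle: "norm (?G s) \<le> ell kap L T0 s * norm (E s) + e1 * (C * norm (\<nu> - \<mu>))" if s: "s < T" for s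
      proof -
        \<comment> \<open>The terms with \<open>g\<close> cancel: what remains is the linearised
          operator applied to the error plus the Taylor remainder of \<open>Q\<close>.\<close>
        have "?G s = Q' s (z \<mu> s) * E s + (Q s (z \<nu> s) - Q s (z \<mu> s) - Q' s (z \<mu> s) * (z \<nu> s - z \<mu> s))"
          by (simp add: E_def algebra_simps)
        then have "norm (?G s) \<le> norm (Q' s (z \<mu> s)) * norm (E s)
           + norm (Q s (z \<nu> s) - Q s (z \<mu> s) - Q' s (z \<mu> s) * (z \<nu> s - z \<mu> s))"
          by (metis norm_mult norm_triangle_ineq)
        also have "\<dots> \<le> ell kap L T0 s * norm (E s) + e1 * (C * norm (\<nu> - \<mu>))"
          using Q'le[OF I(1) s] small[OF s] by (intro add_mono mult_right_mono) auto
        finally show ?thesis .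
      qed
      have Ele: "norm (E s) \<le> e1 * K1 * norm (\<nu> - \<mu>)" if s: "s < T" for s
      proof -
        have "norm (E s) \<le> 2 * (e1 * (C * norm (\<nu> - \<mu>))) / kap\<^sup>2 * wt L T0 s"
        proof (rule response_gronwall[OF Eb Gb L _ _ Gle s])
          show "E s = response ?G s" if "s < T" for s
            using response_diff[OF Fb that] response_diff[OF FFb Db that] I
            by (simp add: E_def response_scale yeq[OF I(1) that, symmetric] eq[OF _ that, symmetric])
        qed (use e1 C in auto)
        also have "\<dots> \<le> 2 * (e1 * (C * norm (\<nu> - \<mu>))) / kap\<^sup>2 * wt L T0 T"
          using e1 C s by (intro mult_left_mono wt_mono L) auto
        also have "\<dots> = e1 * K1 * norm (\<nu> - \<mu>)" by (simp add: K1_def mult_ac)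
        finally show ?thesis .
      qed
      have "norm (duhamel l1 ?G t) \<le>
        ((kap\<^sup>2 / 4 + L\<^sup>2 / 4) * (e1 * K1 * norm (\<nu> - \<mu>)) + e1 * (C * norm (\<nu> - \<mu>))) / kap"
      proof (rule duhamel_bound_const[OF l1 kap Gb t])
        fix s assume "s \<le> t"
        then have s: "s < T" using t by simp
        show "norm (?G s) \<le> (kap\<^sup>2 / 4 + L\<^sup>2 / 4) * (e1 * K1 * norm (\<nu> - \<mu>)) + e1 * (C * norm (\<nu> - \<mu>))"
          using Ele[OF s] by (intro order_trans[OF Gle[OF s]] add_right_mono mult_mono ell_le) auto
      qed
      also have "\<dots> = e1 * K2 * norm (\<nu> - \<mu>)" by (simp add: K2_def algebra_simps add_divide_distrib)
      also have "\<dots> \<le> e * norm (\<nu> - \<mu>)" using e1K by (intro mult_right_mono) auto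
      also have "duhamel l1 ?G t = duhamel l1 (?F \<nu>) t - duhamel l1 (?F \<mu>) t - (\<nu> - \<mu>) * \<eta> \<mu> t"
        using duhamel_diff[OF re_neg(1) Fb t] duhamel_diff[OF re_neg(1) FFb Db t]
        by (simp add: duhamel_scale \<eta>_def)
      finally show ?thesis
        using Ele[OF t] e1K(1) mult_right_mono[of "e1 * K1" e "norm (\<nu> - \<mu>)"] by (auto simp: E_def)
    qed
    then show ?thesis using C d by (intro exI[of _ "d / C"]) auto
  qed
  show ?thesis
  proof (rule that[of y \<eta>])
    show "uniform_deriv I T z y" unfolding uniform_deriv_def by (intro allI impI, drule both) blast
    show "uniform_deriv I T ?\<zeta> \<eta>" unfolding uniform_deriv_def by (intro allI impI, drule both) blast
  qed (use yb db in \<open>auto simp: \<eta>_def intro!: bounded_cont_duhamel1\<close>)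
qed

text \<open>Factorisation reduces this to two first order problems: \<open>z1 - l2 * z\<close>
  solves the equation with rate \<open>l1\<close>, and then \<open>z\<close> solves the one with
  rate \<open>l2\<close> and this forcing.\<close>

lemma response_unique:
  assumes F: "bounded_cont T F"
    and z: "\<And>t. t < T \<Longrightarrow> (z has_vector_derivative z1 t) (at t)"
    and z1: "\<And>t. t < T \<Longrightarrow> (z1 has_vector_derivative (l1 + l2) * z1 t - l1 * l2 * z t + F t) (at t)"
    and bd: "\<And>t. t < T \<Longrightarrow> norm (z t) \<le> M" "\<And>t. t < T \<Longrightarrow> norm (z1 t) \<le> M"
    and t: "t < T"
  shows "z t = response F t" "z1 t = l2 * response F t + duhamel l1 F t"
proof -
  define y where "y s = z1 s - l2 * z s" for s
  have y: "y s = duhamel l1 F s" if s: "s < T" for s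
  proof (rule duhamel_unique[OF re_neg(1) F _ _ s, where M = "M + norm l2 * M"])
    show "(y has_vector_derivative l1 * y s + F s) (at s)" if "s < T" for s
    proof -
      have "((\<lambda>s. l2 * z s) has_vector_derivative l2 * z1 s) (at s)"
        using has_vector_derivative_mult_right[OF z[OF that]] .
      from has_vector_derivative_diff[OF z1[OF that] this]
      show ?thesis by (simp add: y_def[abs_def] algebra_simps)
    qed
    show "norm (y s) \<le> M + norm l2 * M" if "s < T" for s
    proof -
      have "norm (y s) \<le> norm (z1 s) + norm (l2 * z s)" unfolding y_def by (rule norm_triangle_ineq4)
      also have "\<dots> \<le> M + norm l2 * M"
        using bd[OF that] by (auto simp: norm_mult intro!: add_mono mult_left_mono)
      finally show ?thesis .
    qed
  qed
  show "z t = response F t"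
    unfolding response_def
  proof (rule duhamel_unique[OF re_neg(2) bounded_cont_duhamel1[OF F] _ bd(1) t])
    show "(z has_vector_derivative l2 * z s + duhamel l1 F s) (at s)" if "s < T" for s
      using z[OF that] y[OF that] by (simp add: y_def algebra_simps)
  qed
  with y[OF t] show "z1 t = l2 * response F t + duhamel l1 F t" by (simp add: y_def algebra_simps)
qed

end

section \<open>Real equations with possibly complex characteristic roots\<close>

lemma has_vector_derivative_Re:
  "(z has_vector_derivative z1) F \<Longrightarrow> ((\<lambda>t. Re (z t)) has_real_derivative Re z1) F"
  unfolding has_real_derivative_iff_has_vector_derivative
  by (rule bounded_linear.has_vector_derivative[OF bounded_linear_Re])

lemma has_real_derivative_of_real:
  "(x has_real_derivative x1) F \<Longrightarrow>
    ((\<lambda>t. complex_of_real (x t)) has_vector_derivative complex_of_real x1) F"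
  unfolding has_real_derivative_iff_has_vector_derivative
  by (rule bounded_linear.has_vector_derivative[OF bounded_linear_of_real])

text \<open>\<open>x1 + a x\<close> has bounded slope, and by the mean value theorem it is bounded somewhere in every
  interval of length one.\<close>

lemma damped_derivative_bounded:
  fixes x x1 F :: "real \<Rightarrow> real"
  assumes x: "\<And>t. t < T \<Longrightarrow> (x has_real_derivative x1 t) (at t)"
    and x1: "\<And>t. t < T \<Longrightarrow> (x1 has_real_derivative - a * x1 t - c * x t + F t) (at t)"
    and bd: "\<And>t. t < T \<Longrightarrow> \<bar>x t\<bar> \<le> B" "\<And>t. t < T \<Longrightarrow> \<bar>F t\<bar> \<le> M" and t: "t < T"
  shows "\<bar>x1 t\<bar> \<le> 2 * B + 2 * (\<bar>a\<bar> * B) + \<bar>c\<bar> * B + M"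
proof -
  obtain \<xi> where \<xi>: "t - 1 < \<xi>" "\<xi> < t" "x t - x (t - 1) = (t - (t - 1)) * x1 \<xi>"
    using MVT2[of "t - 1" t x x1] x t by auto
  define y where "y s = x1 s + a * x s" for s
  have y: "(y has_real_derivative - c * x s + F s) (at s)" if "s < T" for s
    unfolding y_def[abs_def] by (auto intro!: derivative_eq_intros x x1 that simp: algebra_simps)
  obtain \<zeta> where \<zeta>: "\<xi> < \<zeta>" "\<zeta> < t" "y t - y \<xi> = (t - \<xi>) * (- c * x \<zeta> + F \<zeta>)"
    using MVT2[of \<xi> t y "\<lambda>s. - c * x s + F s"] y \<xi> t by auto
  have ax: "\<bar>a * x s\<bar> \<le> \<bar>a\<bar> * B" "\<bar>c * x s\<bar> \<le> \<bar>c\<bar> * B" if "s < T" for s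
    using bd(1)[OF that] by (auto simp: abs_mult intro!: mult_left_mono)
  have "\<bar>x1 \<xi>\<bar> \<le> 2 * B" using \<xi>(3) bd(1)[of t] bd(1)[of "t - 1"] t by auto
  then have 1: "\<bar>y \<xi>\<bar> \<le> 2 * B + \<bar>a\<bar> * B"
    using ax(1)[of \<xi>] \<xi> t abs_triangle_ineq[of "x1 \<xi>" "a * x \<xi>"] unfolding y_def by linarith
  have 2: "\<bar>y t - y \<xi>\<bar> \<le> 1 * (\<bar>c\<bar> * B + M)"
    unfolding \<zeta>(3) abs_mult
  proof (intro mult_mono)
    show "\<bar>- c * x \<zeta> + F \<zeta>\<bar> \<le> \<bar>c\<bar> * B + M"
      using ax(2)[of \<zeta>] bd(2)[of \<zeta>] \<zeta> t by auto
  qed (use \<xi> in auto)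
  have "\<bar>x1 t\<bar> \<le> \<bar>y t - y \<xi>\<bar> + \<bar>y \<xi>\<bar> + \<bar>a * x t\<bar>"
    unfolding y_def by arith
  from order_trans[OF this add_mono[OF add_mono[OF 2 1] ax(1)[OF t]]]
  show ?thesis by (simp add: algebra_simps)
qed

locale real_decay = decay +
  fixes a c :: real
  assumes sum_roots: "l1 + l2 = - complex_of_real a" and prod_roots: "l1 * l2 = complex_of_real c"
begin

text \<open>A bound on \<open>x\<close> alone is enough, since
  \<open>damped_derivative_bounded\<close> supplies the bound on \<open>x1\<close>. This matters
  because the prescribed limit at the singularity controls \<open>u\<close> but says nothing about
  \<open>u'\<close>.\<close>

lemma real_response_unique:
  assumes F: "bounded_cont T F"
    and x: "\<And>t. t < T \<Longrightarrow> (x has_real_derivative x1 t) (at t)"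
    and x1: "\<And>t. t < T \<Longrightarrow> (x1 has_real_derivative - a * x1 t - c * x t + F t) (at t)"
    and bd: "\<And>t. t < T \<Longrightarrow> \<bar>x t\<bar> \<le> B" and t: "t < T"
  shows "response (\<lambda>s. of_real (F s)) t = of_real (x t)"
    "l2 * response (\<lambda>s. of_real (F s)) t + duhamel l1 (\<lambda>s. of_real (F s)) t = of_real (x1 t)"
proof -
  obtain M where M: "\<And>t. t < T \<Longrightarrow> \<bar>F t\<bar> \<le> M" using bounded_contD[OF F] by auto
  let ?K = "max B (2 * B + 2 * (\<bar>a\<bar> * B) + \<bar>c\<bar> * B + M)"
  have b1: "cmod (complex_of_real (x t)) \<le> ?K" if "t < T" for t using bd[OF that] by auto
  have b2: "cmod (complex_of_real (x1 t)) \<le> ?K" if "t < T" for t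
    using damped_derivative_bounded[OF x x1 bd M that] by auto
  have d: "((\<lambda>t. complex_of_real (x1 t)) has_vector_derivative
     (l1 + l2) * of_real (x1 t) - l1 * l2 * of_real (x t) + of_real (F t)) (at t)" if "t < T" for t
    using has_real_derivative_of_real[OF x1[OF that]] by (simp add: sum_roots prod_roots)
  note u = response_unique[OF bounded_cont_of_real[OF F] has_real_derivative_of_real[OF x] d b1 b2 t]
  show "response (\<lambda>s. of_real (F s)) t = of_real (x t)"
    "l2 * response (\<lambda>s. of_real (F s)) t + duhamel l1 (\<lambda>s. of_real (F s)) t = of_real (x1 t)"
    using u by auto
qed

text \<open>The real part of the response is a bounded solution of the same real equation, so by
  uniqueness it is the whole response: real forcing produces real responses even for a conjugate
  pair of roots.\<close>

lemma real_response:
  assumes F: "bounded_cont T F"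
  defines "x \<equiv> \<lambda>t. Re (response (\<lambda>s. of_real (F s)) t)"
    and "x1 \<equiv> \<lambda>t. Re (l2 * response (\<lambda>s. of_real (F s)) t + duhamel l1 (\<lambda>s. of_real (F s)) t)"
  assumes t: "t < T"
  shows "(x has_real_derivative x1 t) (at t)"
    "(x1 has_real_derivative - a * x1 t - c * x t + F t) (at t)"
    "response (\<lambda>s. of_real (F s)) t = of_real (x t)"
    "l2 * response (\<lambda>s. of_real (F s)) t + duhamel l1 (\<lambda>s. of_real (F s)) t = of_real (x1 t)"
proof -
  let ?F = "\<lambda>s. complex_of_real (F s)"
  let ?z = "response ?F" and ?y = "duhamel l1 ?F"
  have Fb: "bounded_cont T ?F" by (rule bounded_cont_of_real[OF F])
  have z: "(?z has_vector_derivative l2 * ?z t + ?y t) (at t)" if "t < T" for t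
    unfolding response_def by (rule duhamel_deriv[OF re_neg(2) bounded_cont_duhamel1[OF Fb] that])
  have y: "(?y has_vector_derivative l1 * ?y t + ?F t) (at t)" if "t < T" for t
    by (rule duhamel_deriv[OF re_neg(1) Fb that])
  have x: "(x has_real_derivative x1 t) (at t)" if "t < T" for t
    unfolding x_def x1_def by (rule has_vector_derivative_Re[OF z[OF that]])
  have x1: "(x1 has_real_derivative - a * x1 t - c * x t + F t) (at t)" if "t < T" for t
  proof -
    have "((\<lambda>t. l2 * ?z t + ?y t) has_vector_derivative l2 * (l2 * ?z t + ?y t) + (l1 * ?y t + ?F t)) (at t)"
      by (intro has_vector_derivative_add has_vector_derivative_mult_right z y that)
    also have "l2 * (l2 * ?z t + ?y t) + (l1 * ?y t + ?F t)
       = (l1 + l2) * (l2 * ?z t + ?y t) - l1 * l2 * ?z t + ?F t" by (simp add: algebra_simps)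
    also have "\<dots> = - of_real a * (l2 * ?z t + ?y t) - of_real c * ?z t + ?F t"
      by (simp only: sum_roots prod_roots)
    finally show ?thesis unfolding x1_def x_def using has_vector_derivative_Re by fastforce
  qed
  obtain M where "\<And>t. t < T \<Longrightarrow> cmod (?z t) \<le> M"
    using bounded_contD[OF bounded_cont_response[OF Fb]] by blast
  then have bd: "\<bar>x t\<bar> \<le> M" if "t < T" for t
    using that abs_Re_le_cmod[of "?z t"] by (auto simp: x_def intro: order_trans)
  note u = real_response_unique[OF F x x1 bd t]
  show "(x has_real_derivative x1 t) (at t)"
    "(x1 has_real_derivative - a * x1 t - c * x t + F t) (at t)"
    "response (\<lambda>s. of_real (F s)) t = of_real (x t)"
    "l2 * response (\<lambda>s. of_real (F s)) t + duhamel l1 (\<lambda>s. of_real (F s)) t = of_real (x1 t)"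
    using x[OF t] x1[OF t] u by auto
qed

end

subsection \<open>The Emden--Fowler equation near the singularity\<close>

text \<open>Only the kink at \<open>0\<close> needs an argument: there the difference quotient is at
  most \<open>\<bar>h\<bar> powr (q - 1)\<close>, which tends to \<open>0\<close> because
  \<open>q > 1\<close>.\<close>

lemma pos_part_powr_deriv:
  fixes w q :: real
  assumes q: "q > 1"
  shows "((\<lambda>w. max w 0 powr q) has_real_derivative q * max w 0 powr (q - 1)) (at w)"
proof (cases w "0 :: real" rule: linorder_cases)
  case greater
  have "((\<lambda>w. w powr q) has_real_derivative q * w powr (q - 1)) (at w)"
    using greater by (auto intro!: derivative_eq_intros)
  then have "((\<lambda>w. max w 0 powr q) has_real_derivative q * w powr (q - 1)) (at w)"
    by (rule has_field_derivative_transform_within_open[where S = "{0<..}"]) (use greater in auto)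
  with greater show ?thesis by simp
next
  case less
  have "((\<lambda>w. max w 0 powr q) has_real_derivative 0) (at w)"
    by (rule has_field_derivative_transform_within_open[where S = "{..<0}" and f = "\<lambda>_. 0"]) (use less in auto)
  with less q show ?thesis by simp
next
  case equal
  have "((\<lambda>h. (max h 0 powr q) / h) \<longlongrightarrow> 0) (at 0)"
  proof (rule Lim_null_comparison)
    show "\<forall>\<^sub>F h in at 0. norm (max h 0 powr q / h) \<le> \<bar>h\<bar> powr (q - 1)"
    proof (rule always_eventually, rule allI)
      fix h :: real
      show "norm (max h 0 powr q / h) \<le> \<bar>h\<bar> powr (q - 1)"
        using q by (cases h "0 :: real" rule: linorder_cases) (auto simp: powr_diff divide_nonneg_neg)
    qed
    have "continuous_on UNIV (\<lambda>h::real. \<bar>h\<bar> powr (q - 1))"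
      using q by (intro continuous_on_powr' continuous_intros) auto
    then have "isCont (\<lambda>h::real. \<bar>h\<bar> powr (q - 1)) 0"
      by (simp add: continuous_on_eq_continuous_at)
    then show "((\<lambda>h::real. \<bar>h\<bar> powr (q - 1)) \<longlongrightarrow> 0) (at 0)"
      using q by (simp add: isCont_def)
  qed
  with equal q show ?thesis by (simp add: has_field_derivative_iff)
qed

lemma continuous_on_pos_part_powr:
  fixes f :: "'a::topological_space \<Rightarrow> real"
  assumes "continuous_on S f" "q > 0"
  shows "continuous_on S (\<lambda>x. max (f x) 0 powr q)"
  using assms by (intro continuous_on_powr' continuous_intros) auto

text \<open>The derivative vanishes on the negative axis, so an upper bound \<open>B\<close> alone
  controls the Lipschitz constant. This is why only growth towards plus infinity has to be excluded
  later.\<close>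

lemma pos_part_powr_lipschitz:
  fixes w w' B q :: real
  assumes "q > 1" "w \<le> B" "w' \<le> B" "B \<ge> 0"
  shows "\<bar>max w 0 powr q - max w' 0 powr q\<bar> \<le> q * B powr (q - 1) * \<bar>w - w'\<bar>"
proof -
  have "norm (max w 0 powr q - max w' 0 powr q) \<le> q * B powr (q - 1) * norm (w - w')"
  proof (rule field_differentiable_bound[where S = "{..B}"])
    show "((\<lambda>w. max w 0 powr q) has_real_derivative q * max w 0 powr (q - 1)) (at w within {..B})" for w
      by (rule has_field_derivative_at_within[OF pos_part_powr_deriv[OF assms(1)]])
    show "norm (q * max w 0 powr (q - 1)) \<le> q * B powr (q - 1)" if "w \<in> {..B}" for w
      using that assms by (auto simp: abs_mult intro!: mult_left_mono powr_mono2)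
  qed (use assms in auto)
  then show ?thesis by simp
qed

text \<open>Integrating factor: \<open>(y + n / m) * exp (- m * (s - t0))\<close> is nonincreasing.
  Both signs of \<open>m\<close> occur below, \<open>- \<sigma>\<close> to bound \<open>V\<close> by
  the forcing and \<open>\<theta>\<close> to bound the growth of \<open>w\<close>.\<close>

lemma linear_comparison:
  fixes y y' :: "real \<Rightarrow> real"
  assumes y: "\<And>s. s \<in> {t0..t} \<Longrightarrow> (y has_real_derivative y' s) (at s)"
    and le: "\<And>s. s \<in> {t0..t} \<Longrightarrow> y' s \<le> m * y s + n" and m: "m \<noteq> 0" and t: "t0 \<le> t"
  shows "y t + n / m \<le> (y t0 + n / m) * exp (m * (t - t0))"
proof -
  define e where "e s = (y s + n / m) * exp (- m * (s - t0))" for s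
  have "e t \<le> e t0"
  proof (rule DERIV_nonpos_imp_nonincreasing[OF t])
    fix s assume s: "t0 \<le> s" "s \<le> t"
    have "(e has_real_derivative (y' s - m * y s - n) * exp (- m * (s - t0))) (at s)"
      unfolding e_def[abs_def] using m
      by (auto intro!: derivative_eq_intros y s simp: field_simps)
    moreover have "(y' s - m * y s - n) * exp (- m * (s - t0)) \<le> 0"
      using le[of s] s by (intro mult_nonpos_nonneg) auto
    ultimately show "\<exists>d. (e has_real_derivative d) (at s) \<and> d \<le> 0" by blast
  qed
  then have "(y t + n / m) * exp (- m * (t - t0)) * exp (m * (t - t0)) \<le> (y t0 + n / m) * exp (m * (t - t0))"
    unfolding e_def by (intro mult_right_mono) auto
  then show ?thesis by (simp add: mult.assoc flip: exp_add)
qed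

text \<open>The limit bounds the left tail and compactness bounds the rest.\<close>

lemma bounded_cont_of_tendsto:
  fixes k :: "real \<Rightarrow> 'a::real_normed_vector"
  assumes k: "continuous_on UNIV k" and lim: "(k \<longlongrightarrow> k0) at_bot"
  shows "bounded_cont T k"
proof -
  have "eventually (\<lambda>s. dist (k s) k0 < 1) at_bot" using tendstoD[OF lim, of 1] by simp
  then obtain S where S: "\<And>s. s \<le> S \<Longrightarrow> dist (k s) k0 < 1" unfolding eventually_at_bot_linorder by blast
  have "bounded (k ` {S..T})"
    by (intro compact_imp_bounded compact_continuous_image continuous_on_subset[OF k]) auto
  then obtain M where M: "\<And>s. s \<in> {S..T} \<Longrightarrow> norm (k s) \<le> M"
    unfolding bounded_iff by blast
  show ?thesis
  proof (rule bounded_contI[OF continuous_on_subset[OF k]])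
    fix s assume "s < T"
    show "norm (k s) \<le> max M (norm k0 + 1)"
    proof (cases "s \<le> S")
      case True
      have "norm (k s) \<le> norm k0 + dist (k s) k0" by (metis dist_norm norm_triangle_sub)
      with S[OF True] show ?thesis by linarith
    qed (use M[of s] \<open>s < T\<close> in auto)
  qed auto
qed

lemma bounded_cont_Re: "bounded_cont T F \<Longrightarrow> bounded_cont T (\<lambda>s. Re (F s))"
  unfolding bounded_cont_def by (auto simp: bounded_iff intro!: continuous_intros intro: abs_Re_le_cmod[THEN order_trans])

text \<open>With \<open>r = exp t\<close>, \<open>w = r powr \<theta> * u\<close> and
  \<open>\<sigma> = N - 2 - \<theta>\<close>, the linear part of the radial equation becomes
  \<open>w'' + a w' - b w\<close>, which factors as \<open>(D - \<theta>) (D + \<sigma>)\<close>.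
  The relation \<open>b = k0 * \<gamma> powr (p - 1)\<close> makes \<open>\<gamma>\<close> an
  equilibrium of the limit equation at minus infinity, and linearising there gives
  \<open>c = p * b - b\<close>.\<close>

locale emden = real_decay l1 l2 kap a c for l1 l2 :: complex and kap a c :: real +
  fixes k g :: "real \<Rightarrow> real" and k0 p \<gamma> \<theta> \<sigma> b :: real
  assumes \<theta>: "\<theta> > 0" and \<sigma>: "\<sigma> > 0" and a_eq: "a = \<sigma> - \<theta>" and b_eq: "b = \<theta> * \<sigma>"
    and c_eq: "c = (p - 1) * b" and p1: "p > 1" and \<gamma>: "\<gamma> > 0" and b_k0: "b = k0 * \<gamma> powr (p - 1)"
    and k_cont: "continuous_on UNIV k" and k_lim: "(k \<longlongrightarrow> k0) at_bot" and k_nonneg: "\<And>s. k s \<ge> 0"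
    and g_cont: "continuous_on UNIV g" and g_lim: "(g \<longlongrightarrow> 0) at_bot"
begin

lemma b_pos: "b > 0" using \<theta> \<sigma> b_eq by simp

text \<open>With \<open>w = \<gamma> + x\<close> the equation \<open>w'' + a w' - b w + k w\<^sub>+ powr p + \<mu> g = 0\<close> reads
  \<open>x'' + a x' + c x = drive s x - \<mu> g\<close>; the linear part of \<open>drive\<close> at \<open>x = 0\<close> vanishes as \<open>s\<close>
  tends to minus infinity.\<close>

definition drive :: "real \<Rightarrow> real \<Rightarrow> real" where
  "drive s x = b * \<gamma> + p * b * x - k s * max (\<gamma> + x) 0 powr p"

definition drive' :: "real \<Rightarrow> real \<Rightarrow> real" where
  "drive' s x = p * b - p * k s * max (\<gamma> + x) 0 powr (p - 1)"

definition cdrive' :: "real \<Rightarrow> complex \<Rightarrow> complex" where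
  "cdrive' s x = of_real (p * b) - of_real (p * k s) * (of_real \<gamma> + x) powr of_real (p - 1)"

lemma drive_deriv: "(drive s has_real_derivative drive' s x) (at x)"
proof -
  have "((\<lambda>x. max (\<gamma> + x) 0 powr p) has_real_derivative p * max (\<gamma> + x) 0 powr (p - 1) * 1) (at x)"
    by (rule DERIV_chain2[OF pos_part_powr_deriv[OF p1]]) (auto intro!: derivative_eq_intros)
  note 1 = this
  have "((\<lambda>x. b * \<gamma> + p * b * x) has_real_derivative p * b) (at x)"
    by (auto intro!: derivative_eq_intros)
  from DERIV_diff[OF this DERIV_cmult[OF 1, of "k s"]]
  show ?thesis unfolding drive_def[abs_def] drive'_def by (simp add: mult_ac)
qed

lemma cdrive'_of_real: "\<gamma> + x \<ge> 0 \<Longrightarrow> cdrive' s (of_real x) = of_real (drive' s x)"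
  using powr_of_real[of "\<gamma> + x" "p - 1"] by (simp add: cdrive'_def drive'_def)

lemma bounded_cont_k: "bounded_cont T k" by (rule bounded_cont_of_tendsto[OF k_cont k_lim])
lemma bounded_cont_g: "bounded_cont T g" by (rule bounded_cont_of_tendsto[OF g_cont g_lim])

lemma bounded_cont_pos_part_powr:
  fixes x :: "real \<Rightarrow> real"
  assumes "bounded_cont T x" "q > 0"
  shows "bounded_cont T (\<lambda>s. max (x s) 0 powr q)"
proof -
  obtain M where M: "M > 0" "\<And>t. t < T \<Longrightarrow> \<bar>x t\<bar> \<le> M" using bounded_contD[OF assms(1)] by auto
  show ?thesis
  proof (rule bounded_contI)
    show "continuous_on {..<T} (\<lambda>s. max (x s) 0 powr q)"
      using assms by (intro continuous_on_pos_part_powr) (auto simp: bounded_cont_def)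
    show "norm (max (x s) 0 powr q) \<le> M powr q" if "s < T" for s
      using M(2)[OF that] M(1) assms(2) by (auto intro!: powr_mono2)
  qed
qed

lemma bounded_cont_drive: "bounded_cont T x \<Longrightarrow> bounded_cont T (\<lambda>s. drive s (x s))"
  unfolding drive_def using p1
  by (intro bounded_cont_diff bounded_cont_add bounded_cont_mult bounded_cont_const bounded_cont_k
      bounded_cont_pos_part_powr) auto

lemma bounded_cont_drive': "bounded_cont T x \<Longrightarrow> bounded_cont T (\<lambda>s. drive' s (x s))"
  unfolding drive'_def using p1
  by (intro bounded_cont_diff bounded_cont_add bounded_cont_mult bounded_cont_const bounded_cont_k
      bounded_cont_pos_part_powr) auto

lemma bounded_cont_force:
  "bounded_cont T x \<Longrightarrow> bounded_cont T (\<lambda>s. drive s (x s) - \<mu> * g s)"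
  by (intro bounded_cont_diff bounded_cont_drive bounded_cont_mult bounded_cont_const bounded_cont_g)

text \<open>The bound is taken on a complex disc, so that the same \<open>\<delta>\<close> and
  \<open>T0\<close> work for the real equation, through \<open>cdrive'_of_real\<close>, and for the
  complexified one. \<open>\<delta> < \<gamma>\<close> keeps \<open>\<gamma> + x\<close> in the
  right half-plane, off the branch cut, and \<open>kap\<^sup>2 / 4\<close> is the value of
  \<open>ell\<close> up to \<open>T0\<close>.\<close>

definition narrow :: "real \<Rightarrow> real \<Rightarrow> bool" where
  "narrow \<delta> T0 \<longleftrightarrow> 0 < \<delta> \<and> \<delta> < \<gamma> \<and> (\<forall>s\<le>T0. \<forall>x. norm x \<le> \<delta> \<longrightarrow> norm (cdrive' s x) \<le> kap\<^sup>2 / 4)"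

lemma narrow_mono: "narrow \<delta> T0 \<Longrightarrow> T1 \<le> T0 \<Longrightarrow> narrow \<delta> T1" by (auto simp: narrow_def)

text \<open>As \<open>s\<close> tends to minus infinity and \<open>x\<close> to \<open>0\<close>
  jointly, \<open>cdrive'\<close> tends to \<open>p * b - p * k0 * \<gamma> powr (p - 1)\<close>,
  which vanishes by the choice of \<open>\<gamma>\<close>.\<close>

lemma ex_narrow: "\<exists>\<delta> T0. narrow \<delta> T0"
proof -
  have "isCont (\<lambda>x. (of_real \<gamma> + x) powr of_real (p - 1)) (0 :: complex)"
    using \<gamma> by (intro continuous_intros) (auto simp: complex_nonpos_Reals_iff)
  then have "((\<lambda>x. (of_real \<gamma> + x) powr of_real (p - 1)) \<longlongrightarrow> of_real (\<gamma> powr (p - 1))) (nhds (0 :: complex))"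
    using \<gamma> powr_of_real[of \<gamma> "p - 1"] by (simp add: isCont_def tendsto_nhds_iff)
  from filterlim_compose[OF this filterlim_snd[where F = at_bot]]
  have 1: "((\<lambda>z. (of_real \<gamma> + snd z) powr of_real (p - 1)) \<longlongrightarrow> of_real (\<gamma> powr (p - 1))) (at_bot \<times>\<^sub>F nhds (0::complex))" .
  have 2: "((\<lambda>z. complex_of_real (p * k (fst z))) \<longlongrightarrow> of_real (p * k0)) (at_bot \<times>\<^sub>F nhds (0::complex))"
    by (intro tendsto_intros filterlim_compose[OF k_lim filterlim_fst])
  have "((\<lambda>z. of_real (p * b) - of_real (p * k (fst z)) * (of_real \<gamma> + snd z) powr of_real (p - 1))
      \<longlongrightarrow> of_real (p * b) - of_real (p * k0) * of_real (\<gamma> powr (p - 1))) (at_bot \<times>\<^sub>F nhds (0::complex))"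
    by (intro tendsto_diff tendsto_mult 1 2 tendsto_const)
  also have "complex_of_real (p * b) - of_real (p * k0) * of_real (\<gamma> powr (p - 1)) = 0"
    by (simp add: b_k0)
  finally have "((\<lambda>z. cdrive' (fst z) (snd z)) \<longlongrightarrow> 0) (at_bot \<times>\<^sub>F nhds 0)"
    by (simp only: cdrive'_def)
  then have "eventually (\<lambda>z. dist (cdrive' (fst z) (snd z)) 0 < kap\<^sup>2 / 4) (at_bot \<times>\<^sub>F nhds 0)"
    using kap by (intro tendstoD) auto
  then obtain P Q where PQ: "eventually P at_bot" "eventually Q (nhds 0)"
    "\<And>s x. P s \<Longrightarrow> Q x \<Longrightarrow> norm (cdrive' s x) < kap\<^sup>2 / 4"
    unfolding eventually_prod_filter by auto
  obtain T0 where T0: "\<And>s. s \<le> T0 \<Longrightarrow> P s" using PQ(1) unfolding eventually_at_bot_linorder by blast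
  obtain e where e: "e > 0" "\<And>x. dist x 0 < e \<Longrightarrow> Q x" using PQ(2) unfolding eventually_nhds_metric by blast
  have "narrow (min e \<gamma> / 2) T0"
    unfolding narrow_def
  proof (intro conjI allI impI)
    fix s :: real and x :: complex assume "s \<le> T0" "norm x \<le> min e \<gamma> / 2"
    then show "norm (cdrive' s x) \<le> kap\<^sup>2 / 4"
      using e \<gamma> by (intro less_imp_le[OF PQ(3)] T0 e(2)) (auto simp: dist_norm)
  qed (use e \<gamma> in auto)
  then show ?thesis by blast
qed

lemma narrow_drive_lipschitz:
  assumes "narrow \<delta> T0" "s \<le> T0" "\<bar>x\<bar> \<le> \<delta>" "\<bar>y\<bar> \<le> \<delta>"
  shows "\<bar>drive s x - drive s y\<bar> \<le> kap\<^sup>2 / 4 * \<bar>x - y\<bar>"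
proof -
  have "norm (drive s x - drive s y) \<le> kap\<^sup>2 / 4 * norm (x - y)"
  proof (rule field_differentiable_bound[where S = "{-\<delta>..\<delta>}"])
    show "(drive s has_real_derivative drive' s x) (at x within {-\<delta>..\<delta>})" for x
      by (rule has_field_derivative_at_within[OF drive_deriv])
    show "norm (drive' s x) \<le> kap\<^sup>2 / 4" if "x \<in> {-\<delta>..\<delta>}" for x
    proof -
      have "norm (cdrive' s (of_real x)) \<le> kap\<^sup>2 / 4"
        using assms that by (auto simp: narrow_def)
      then show ?thesis using that assms(1) by (subst (asm) cdrive'_of_real) (auto simp: narrow_def)
    qed
  qed (use assms in auto)
  then show ?thesis by simp
qed

lemma drive_lipschitz:
  assumes "\<gamma> + x \<le> B" "\<gamma> + y \<le> B" "B \<ge> 0" "k s \<le> M"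
  shows "\<bar>drive s x - drive s y\<bar> \<le> (p * b + M * (p * B powr (p - 1))) * \<bar>x - y\<bar>"
proof -
  let ?w = "max (\<gamma> + x) 0 powr p - max (\<gamma> + y) 0 powr p"
  have "\<bar>drive s x - drive s y\<bar> = \<bar>p * b * (x - y) - k s * ?w\<bar>"
    by (simp add: drive_def algebra_simps)
  also have "\<dots> \<le> \<bar>p * b * (x - y)\<bar> + \<bar>k s * ?w\<bar>" by (rule abs_triangle_ineq4)
  also have "\<dots> = p * b * \<bar>x - y\<bar> + k s * \<bar>?w\<bar>" using p1 b_pos k_nonneg by (simp add: abs_mult)
  also have "\<dots> \<le> p * b * \<bar>x - y\<bar> + M * (p * B powr (p - 1) * \<bar>x - y\<bar>)"
    using assms k_nonneg[of s] pos_part_powr_lipschitz[OF p1 assms(1,2,3)]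
    by (intro add_left_mono mult_mono) auto
  finally show ?thesis by (simp add: algebra_simps)
qed

lemma drive_ell_bounds:
  assumes nar: "narrow \<delta> T0" and B: "B \<ge> 0"
  obtains L where "L \<ge> 0"
    "\<And>s x y. \<lbrakk>s < T; s \<le> T0 \<Longrightarrow> \<bar>x\<bar> \<le> \<delta> \<and> \<bar>y\<bar> \<le> \<delta>; \<gamma> + x \<le> B; \<gamma> + y \<le> B\<rbrakk> \<Longrightarrow>
      \<bar>drive s x - drive s y\<bar> \<le> ell kap L T0 s * \<bar>x - y\<bar>"
    "\<And>s x. \<lbrakk>s < T; s \<le> T0 \<Longrightarrow> \<bar>x\<bar> \<le> \<delta>; \<gamma> + x \<le> B\<rbrakk> \<Longrightarrow> \<bar>drive' s x\<bar> \<le> ell kap L T0 s"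
proof -
  obtain M where M: "M > 0" "\<And>s. s < T \<Longrightarrow> \<bar>k s\<bar> \<le> M" using bounded_contD[OF bounded_cont_k] by auto
  define X where "X = p * b + M * (p * B powr (p - 1))"
  have X0: "X \<ge> 0" using p1 b_pos M by (simp add: X_def)
  \<comment> \<open>Then \<open>L\<^sup>2 / 4 = (1 + X)\<^sup>2\<close>, which dominates
    \<open>X\<close>.\<close>
  define L where "L = 2 * (1 + X)"
  have L: "L \<ge> 0" "X \<le> L\<^sup>2 / 4" using X0 by (auto simp: L_def power2_eq_square algebra_simps)
  show ?thesis
  proof (rule that[OF L(1)])
    fix s x y assume s: "s < T" and \<delta>: "s \<le> T0 \<Longrightarrow> \<bar>x\<bar> \<le> \<delta> \<and> \<bar>y\<bar> \<le> \<delta>" and xy: "\<gamma> + x \<le> B" "\<gamma> + y \<le> B"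
    have "\<bar>drive s x - drive s y\<bar> \<le> X * \<bar>x - y\<bar>"
      unfolding X_def using M(2)[OF s] by (intro drive_lipschitz xy B) auto
    also have "\<dots> \<le> L\<^sup>2 / 4 * \<bar>x - y\<bar>" using L by (intro mult_right_mono) auto
    finally show "\<bar>drive s x - drive s y\<bar> \<le> ell kap L T0 s * \<bar>x - y\<bar>"
      using narrow_drive_lipschitz[OF nar, of s x y] \<delta> by (simp add: ell_def)
  next
    fix s x assume s: "s < T" and \<delta>: "s \<le> T0 \<Longrightarrow> \<bar>x\<bar> \<le> \<delta>" and x: "\<gamma> + x \<le> B"
    show "\<bar>drive' s x\<bar> \<le> ell kap L T0 s"
    proof (cases "s \<le> T0")
      case True
      have "norm (cdrive' s (of_real x)) \<le> kap\<^sup>2 / 4" using nar True \<delta>[OF True] by (auto simp: narrow_def)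
      moreover have "\<gamma> + x \<ge> 0" using \<delta>[OF True] nar by (auto simp: narrow_def)
      ultimately show ?thesis using True by (simp add: cdrive'_of_real ell_def)
    next
      case False
      have "\<bar>drive' s x\<bar> \<le> \<bar>p * b\<bar> + \<bar>p * k s * max (\<gamma> + x) 0 powr (p - 1)\<bar>"
        unfolding drive'_def by (rule abs_triangle_ineq4)
      also have "\<dots> = p * b + k s * (p * max (\<gamma> + x) 0 powr (p - 1))"
        using p1 b_pos k_nonneg by (simp add: abs_mult)
      also have "\<dots> \<le> X"
        unfolding X_def using x B M(2)[OF s] k_nonneg[of s] p1
        by (intro add_left_mono mult_mono powr_mono2) auto
      finally show ?thesis using False L by (simp add: ell_def)
    qed
  qed
qed

section \<open>Existence, decay and uniqueness on half-lines\<close>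

lemma drive_0_tendsto: "((\<lambda>s. drive s 0) \<longlongrightarrow> 0) at_bot"
proof -
  have "((\<lambda>s. b * \<gamma> - k s * \<gamma> powr p) \<longlongrightarrow> b * \<gamma> - k0 * \<gamma> powr p) at_bot"
    by (intro tendsto_intros k_lim)
  moreover have "b * \<gamma> = k0 * \<gamma> powr p"
    using \<gamma> powr_add[of \<gamma> "p - 1" 1] by (simp add: b_k0)
  ultimately show ?thesis using \<gamma> by (simp add: drive_def)
qed

text \<open>The integral equation encodes the differential equation together with boundedness to the
  left. Decay at minus infinity is a separate condition: for \<open>\<mu> = 0\<close> the constant
  \<open>x = - \<gamma>\<close>, that is \<open>w = 0\<close>, satisfies the integral equation
  too.\<close>

definition solution :: "real \<Rightarrow> real \<Rightarrow> (real \<Rightarrow> real) \<Rightarrow> bool" where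
  "solution T \<mu> x \<longleftrightarrow> bounded_cont T x \<and>
    (\<forall>t<T. response (\<lambda>s. of_real (drive s (x s) - \<mu> * g s)) t = of_real (x t))"

lemma solution_mono: "solution T \<mu> x \<Longrightarrow> T' \<le> T \<Longrightarrow> solution T' \<mu> x"
  unfolding solution_def using bounded_cont_mono by auto

text \<open>The nonlinearity is clamped at a height \<open>B\<close> which solutions of the clamped equation cannot reach:
  \<open>V = w' - \<theta> w\<close> satisfies \<open>V' + \<sigma> V \<le> - \<mu> g\<close>, whatever the clamp.\<close>

lemma ex_solution:
  assumes R: "R \<ge> 0"
  obtains \<delta> T0 B where "narrow \<delta> T0" "T0 < T" "B > 0"
    "\<And>\<mu>. \<bar>\<mu>\<bar> \<le> R \<Longrightarrow> \<exists>x. solution T \<mu> x \<and> (\<forall>t\<le>T0. \<bar>x t\<bar> \<le> \<delta>) \<and> (\<forall>t<T. \<gamma> + x t \<le> B)"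
proof -
  obtain \<delta> T1 where n1: "narrow \<delta> T1" using ex_narrow by blast
  then have \<delta>: "0 < \<delta>" "\<delta> < \<gamma>" by (auto simp: narrow_def)
  have "((\<lambda>s. \<bar>drive s 0\<bar> + R * \<bar>g s\<bar>) \<longlongrightarrow> \<bar>0\<bar> + R * \<bar>0\<bar>) at_bot"
    by (intro tendsto_intros drive_0_tendsto g_lim)
  then have "eventually (\<lambda>s. \<bar>drive s 0\<bar> + R * \<bar>g s\<bar> < kap\<^sup>2 * \<delta> / 4) at_bot"
    using kap \<delta> by (intro order_tendstoD) auto
  then obtain T2 where T2: "\<And>s. s \<le> T2 \<Longrightarrow> \<bar>drive s 0\<bar> + R * \<bar>g s\<bar> < kap\<^sup>2 * \<delta> / 4"
    unfolding eventually_at_bot_linorder by blast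
  define T0 where "T0 = min T1 (min T2 (T - 1))"
  have T0: "T0 < T" "T0 \<le> T2" and nar: "narrow \<delta> T0" using narrow_mono[OF n1] by (auto simp: T0_def)
  obtain M' where M': "M' > 0" "\<And>s. s < T \<Longrightarrow> \<bar>g s\<bar> \<le> M'" using bounded_contD[OF bounded_cont_g] by auto
  \<comment> \<open>The first two terms bound \<open>x1 T0\<close>, which is \<open>l2\<close> times
    a value of size at most \<open>\<delta>\<close> plus one Duhamel step of a forcing of size
    \<open>kap\<^sup>2 * \<delta> / 2\<close>. The last term is the level that forcing of size
    \<open>R * M'\<close> can sustain against the damping \<open>\<sigma>\<close>.\<close>
  define V0 where "V0 = norm l2 * \<delta> + kap\<^sup>2 * \<delta> / 2 / kap + R * M' / \<sigma>"
  have V0: "V0 \<ge> R * M' / \<sigma>" using \<delta> kap by (simp add: V0_def)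
  have V00: "V0 \<ge> 0" using V0 R M' \<sigma> by (meson divide_nonneg_pos less_imp_le mult_nonneg_nonneg order_trans)
  \<comment> \<open>The largest height \<open>w\<close> can have by time \<open>T\<close> if it
    starts at \<open>T0\<close> below \<open>\<gamma> + \<delta>\<close> and obeys
    \<open>w' \<le> \<theta> w + V0\<close>. It depends on \<open>R\<close> but not on the
    individual \<open>\<mu>\<close>.\<close>
  define B where "B = (\<gamma> + \<delta> + V0 / \<theta>) * exp (\<theta> * (T - T0))"
  have e1: "exp (\<theta> * (t - T0)) \<ge> 1" if "t \<ge> T0" for t using \<theta> that by simp
  have B: "B \<ge> \<gamma> + \<delta>"
  proof -
    have "(\<gamma> + \<delta> + V0 / \<theta>) * 1 \<le> B" unfolding B_def
      using \<gamma> \<delta> V00 \<theta> T0 by (intro mult_left_mono e1) auto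
    then have "\<gamma> + \<delta> + V0 / \<theta> \<le> B" by simp
    moreover have "V0 / \<theta> \<ge> 0" using V00 \<theta> by simp
    ultimately show ?thesis by linarith
  qed
  have B0: "B > 0" using B \<gamma> \<delta> by linarith
  obtain L where L: "L \<ge> 0" "\<And>s x y. \<lbrakk>s < T; s \<le> T0 \<Longrightarrow> \<bar>x\<bar> \<le> \<delta> \<and> \<bar>y\<bar> \<le> \<delta>; \<gamma> + x \<le> B; \<gamma> + y \<le> B\<rbrakk> \<Longrightarrow>
      \<bar>drive s x - drive s y\<bar> \<le> ell kap L T0 s * \<bar>x - y\<bar>"
    using drive_ell_bounds[OF nar, of B T] B0 by (metis less_imp_le)
  have "\<exists>x. solution T \<mu> x \<and> (\<forall>t\<le>T0. \<bar>x t\<bar> \<le> \<delta>) \<and> (\<forall>t<T. \<gamma> + x t \<le> B)" if \<mu>: "\<bar>\<mu>\<bar> \<le> R" for \<mu>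
  proof -
    define h where "h s x = drive s (min x (B - \<gamma>)) - \<mu> * g s" for s x
    \<comment> \<open>Reality of the values is part of the constraint, so the complex fixed point is
      a real solution.\<close>
    define S where "S s = {z :: complex. Im z = 0 \<and> (s \<le> T0 \<longrightarrow> norm z \<le> \<delta>)}" for s
    have h_eq: "h s x = drive s x - \<mu> * g s" if "\<gamma> + x \<le> B" for s x
      using that by (simp add: h_def min_def)
    \<comment> \<open>Half of this bound comes from the Lipschitz estimate and half from the choice
      of \<open>T2\<close>. After \<open>response\<close> it becomes \<open>\<delta> / 2\<close>, so
      the smallness constraint in \<open>S\<close> is preserved.\<close>
    have small: "\<bar>h s x\<bar> \<le> kap\<^sup>2 * \<delta> / 2" if s: "s \<le> T0" and x: "\<bar>x\<bar> \<le> \<delta>" for s x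
    proof -
      have "h s x = drive s x - \<mu> * g s" using x B by (intro h_eq) auto
      then have "\<bar>h s x\<bar> \<le> \<bar>drive s x - drive s 0\<bar> + \<bar>drive s 0\<bar> + \<bar>\<mu> * g s\<bar>" by linarith
      also have "\<bar>drive s x - drive s 0\<bar> \<le> kap\<^sup>2 / 4 * \<delta>"
        using narrow_drive_lipschitz[OF nar s x, of 0] \<delta> mult_left_mono[OF x, of "kap\<^sup>2 / 4"] by auto
      also have "\<bar>\<mu> * g s\<bar> \<le> R * \<bar>g s\<bar>" using \<mu> by (auto simp: abs_mult intro: mult_right_mono)
      finally show ?thesis using T2[of s] s T0 by auto
    qed
    have hb: "bounded_cont T (\<lambda>s. h s (x s))" if xb: "bounded_cont T x" for x
    proof -
      obtain K where K: "\<And>s. s < T \<Longrightarrow> \<bar>x s\<bar> \<le> K" using bounded_contD[OF xb] by auto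
      have "bounded_cont T (\<lambda>s. min (x s) (B - \<gamma>))"
      proof (rule bounded_contI)
        show "continuous_on {..<T} (\<lambda>s. min (x s) (B - \<gamma>))"
          using xb by (intro continuous_intros bounded_cont_continuous)
        show "norm (min (x s) (B - \<gamma>)) \<le> K + \<bar>B - \<gamma>\<bar>" if "s < T" for s
          using K[OF that] by (simp add: min_def) linarith
      qed
      then show ?thesis unfolding h_def by (rule bounded_cont_force)
    qed
    have Hb: "bounded_cont T (\<lambda>s. complex_of_real (h s (Re (z s))))" if "bounded_cont T z" for z
      by (intro bounded_cont_of_real hb bounded_cont_Re that)
    have lip: "norm (complex_of_real (h s (Re x)) - of_real (h s (Re y))) \<le> ell kap L T0 s * norm (x - y)"
      if s: "s < T" and xy: "x \<in> S s" "y \<in> S s" for s x y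
    proof -
      have S: "\<bar>Re z\<bar> \<le> \<delta>" if "z \<in> S s" "s \<le> T0" for z
        using that by (auto simp: S_def intro: abs_Re_le_cmod[THEN order_trans])
      have "\<bar>h s (Re x) - h s (Re y)\<bar> \<le> ell kap L T0 s * \<bar>min (Re x) (B - \<gamma>) - min (Re y) (B - \<gamma>)\<bar>"
      proof -
        have "\<bar>drive s (min (Re x) (B - \<gamma>)) - drive s (min (Re y) (B - \<gamma>))\<bar> \<le>
            ell kap L T0 s * \<bar>min (Re x) (B - \<gamma>) - min (Re y) (B - \<gamma>)\<bar>"
          using S[OF xy(1)] S[OF xy(2)] B \<delta> by (intro L(2) s) (auto simp: min_def)
        then show ?thesis by (simp add: h_def)
      qed
      also have "\<dots> \<le> ell kap L T0 s * \<bar>Re x - Re y\<bar>"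
        by (intro mult_left_mono ell_nonneg) (auto simp: min_def)
      also have "\<dots> \<le> ell kap L T0 s * norm (x - y)"
        using abs_Re_le_cmod[of "x - y"] by (intro mult_left_mono ell_nonneg) auto
      finally show ?thesis by (simp flip: of_real_diff)
    qed
    have Hle: "norm (complex_of_real (h s (Re (z s)))) \<le> kap\<^sup>2 * \<delta> / 2" if "s \<le> T0" "z s \<in> S s" for z s
      using that abs_Re_le_cmod[of "z s"] small[of s "Re (z s)"] by (auto simp: S_def)
    have clo: "closed (S s)" for s
    proof -
      have "S s = {z. Im z = 0} \<inter> (if s \<le> T0 then cball 0 \<delta> else UNIV)" by (auto simp: S_def)
      moreover have "closed {z. Im z = 0}" by (intro closed_Collect_eq continuous_intros)
      ultimately show ?thesis by (auto intro!: closed_Int)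
    qed
    have inv: "response (\<lambda>s. complex_of_real (h s (Re (z s)))) t \<in> S t"
      if z: "bounded_cont T z" "\<And>s. s < T \<Longrightarrow> z s \<in> S s" and t: "t < T" for z t
    proof -
      have "Im (response (\<lambda>s. complex_of_real (h s (Re (z s)))) t) = 0"
        using real_response(3)[OF hb[OF bounded_cont_Re[OF z(1)]] t] by (metis Im_complex_of_real)
      moreover have "norm (response (\<lambda>s. complex_of_real (h s (Re (z s)))) t) \<le> kap\<^sup>2 * \<delta> / 2 / kap\<^sup>2" if "t \<le> T0"
        using that t T0 z by (intro response_bound_const[OF Hb[OF z(1)] t] Hle) auto
      ultimately show ?thesis using kap \<delta> by (auto simp: S_def)
    qed
    have "\<exists>z. bounded_cont T z \<and> (\<forall>s<T. z s \<in> S s) \<and>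
       (\<forall>t<T. z t = response (\<lambda>s. complex_of_real (h s (Re (z s)))) t)"
    proof (rule response_fixed_point[where T = T and S = S and H = "\<lambda>s z. complex_of_real (h s (Re z))"
          and ?z0.0 = "\<lambda>_. 0" and L = L and ?T0.0 = T0])
      show "continuous_on {..<T} (\<lambda>s. complex_of_real (h s (Re (z s))))" if "bounded_cont T z" for z
        by (rule bounded_cont_continuous[OF Hb[OF that]])
      show "bounded_cont T (\<lambda>s. complex_of_real (h s (Re 0)))" by (rule Hb[OF bounded_cont_const])
      show "bounded_cont T (\<lambda>_. 0 :: complex)" by (rule bounded_cont_const)
      show "0 \<in> S s" for s using \<delta> by (simp add: S_def)
      show "0 \<le> L" by (rule L(1))
    qed (use clo lip inv in blast)+
    then obtain z where zb: "bounded_cont T z" and zS: "\<And>s. s < T \<Longrightarrow> z s \<in> S s"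
      and zeq: "\<And>t. t < T \<Longrightarrow> z t = response (\<lambda>s. complex_of_real (h s (Re (z s)))) t"
      by blast
    define x where "x s = Re (z s)" for s
    define F where "F s = h s (x s)" for s
    define x1 where "x1 t = Re (l2 * response (\<lambda>s. of_real (F s)) t + duhamel l1 (\<lambda>s. of_real (F s)) t)" for t
    have xb: "bounded_cont T x" unfolding x_def by (rule bounded_cont_Re[OF zb])
    have Fb: "bounded_cont T F" unfolding F_def by (rule hb[OF xb])
    have zF: "z t = response (\<lambda>s. of_real (F s)) t" if "t < T" for t
      using zeq[OF that] by (simp add: F_def x_def)
    have zx: "z t = of_real (x t)" if "t < T" for t
      using zS[OF that] by (auto simp: S_def x_def complex_eq_iff)
    have xder: "(x has_real_derivative x1 t) (at t)" if "t < T" for t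
    proof (rule has_field_derivative_transform_within_open[where S = "{..<T}"])
      show "((\<lambda>t. Re (response (\<lambda>s. of_real (F s)) t)) has_real_derivative x1 t) (at t)"
        unfolding x1_def by (rule real_response(1)[OF Fb that])
    qed (use that zF in \<open>auto simp: x_def\<close>)
    have x1der: "(x1 has_real_derivative - a * x1 t - c * x t + F t) (at t)" if "t < T" for t
    proof -
      have "x t = Re (response (\<lambda>s. of_real (F s)) t)" using zF[OF that] by (simp add: x_def)
      then show ?thesis using real_response(2)[OF Fb that] by (simp only: x1_def[abs_def])
    qed
    have xsmall: "\<bar>x t\<bar> \<le> \<delta>" if "t \<le> T0" for t
      using zS[of t] that T0 abs_Re_le_cmod[of "z t"] by (auto simp: S_def x_def)
    define V where "V t = x1 t - \<theta> * (\<gamma> + x t)" for t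
    have "\<bar>x1 T0\<bar> \<le> norm l2 * \<delta> + kap\<^sup>2 * \<delta> / 2 / kap"
    proof -
      have "\<bar>x1 T0\<bar> \<le> norm (l2 * response (\<lambda>s. of_real (F s)) T0 + duhamel l1 (\<lambda>s. of_real (F s)) T0)"
        unfolding x1_def by (rule abs_Re_le_cmod)
      also have "\<dots> \<le> norm l2 * norm (z T0) + norm (duhamel l1 (\<lambda>s. of_real (F s)) T0)"
        using zF[OF T0(1)] norm_triangle_ineq by (metis norm_mult)
      also have "\<dots> \<le> norm l2 * \<delta> + kap\<^sup>2 * \<delta> / 2 / kap"
      proof (intro add_mono mult_left_mono duhamel_bound_const[OF l1 kap bounded_cont_of_real[OF Fb] T0(1)])
        show "norm (z T0) \<le> \<delta>" using zS[OF T0(1)] by (simp add: S_def)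
        show "norm (complex_of_real (F s)) \<le> kap\<^sup>2 * \<delta> / 2" if "s \<le> T0" for s
          using small[OF that xsmall[OF that]] by (simp add: F_def)
      qed auto
      finally show ?thesis .
    qed
    \<comment> \<open>At \<open>T0\<close> the solution is still positive because
      \<open>\<delta> < \<gamma>\<close>, so the term \<open>- \<theta> * w\<close> in
      \<open>V\<close> can only help.\<close>
    moreover have "\<theta> * (\<gamma> + x T0) \<ge> 0" using \<theta> \<delta> xsmall[of T0] by (intro mult_nonneg_nonneg) auto
    ultimately have VT0: "V T0 \<le> V0 - R * M' / \<sigma>" by (auto simp: V_def V0_def)
    \<comment> \<open>The factor \<open>D + \<sigma>\<close> acting on \<open>V\<close>. Clamping
      adds \<open>- p * b * (x - min ...)\<close>, which is nonpositive like the power term, so the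
      upper bound for \<open>V\<close> does not see the clamp.\<close>
    have V': "(V has_real_derivative - \<sigma> * V t - p * b * (x t - min (x t) (B - \<gamma>))
        - k t * max (\<gamma> + min (x t) (B - \<gamma>)) 0 powr p - \<mu> * g t) (at t)"
      if "t < T" for t
    proof -
      have "(V has_real_derivative (- a * x1 t - c * x t + F t) - \<theta> * x1 t) (at t)"
        unfolding V_def[abs_def] by (auto intro!: derivative_eq_intros xder x1der that)
      moreover have "(- a * x1 t - c * x t + F t) - \<theta> * x1 t = - \<sigma> * V t - p * b * (x t - min (x t) (B - \<gamma>))
         - k t * max (\<gamma> + min (x t) (B - \<gamma>)) 0 powr p - \<mu> * g t"
        unfolding F_def h_def drive_def by (simp add: V_def a_eq c_eq b_eq algebra_simps)
      ultimately show ?thesis by simp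
    qed
    have VV0: "V t \<le> V0" if t: "T0 \<le> t" "t < T" for t
    proof -
      have "V t + (R * M') / (- \<sigma>) \<le> (V T0 + (R * M') / (- \<sigma>)) * exp (- \<sigma> * (t - T0))"
      proof (rule linear_comparison[OF V'])
        fix s assume s: "s \<in> {T0..t}"
        have "\<bar>\<mu> * g s\<bar> \<le> R * M'" using \<mu> M'(2)[of s] s t R by (auto simp: abs_mult intro!: mult_mono)
        moreover have "k s * max (\<gamma> + min (x s) (B - \<gamma>)) 0 powr p \<ge> 0" using k_nonneg by simp
        moreover have "p * b * (x s - min (x s) (B - \<gamma>)) \<ge> 0" using p1 b_pos by (intro mult_nonneg_nonneg) auto
        ultimately show "- \<sigma> * V s - p * b * (x s - min (x s) (B - \<gamma>))
            - k s * max (\<gamma> + min (x s) (B - \<gamma>)) 0 powr p - \<mu> * g s \<le> - \<sigma> * V s + R * M'"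
          by linarith
      qed (use t \<sigma> in auto)
      also have "\<dots> \<le> (V0 - R * M' / \<sigma>) * exp (- \<sigma> * (t - T0))"
      proof (intro mult_right_mono)
        have "R * M' / \<sigma> \<ge> 0" using R M' \<sigma> by simp
        then show "V T0 + R * M' / - \<sigma> \<le> V0 - R * M' / \<sigma>" using VT0 by simp
      qed simp
      also have "\<dots> \<le> (V0 - R * M' / \<sigma>) * 1"
        using V0 \<sigma> t by (intro mult_left_mono) auto
      finally show ?thesis by simp
    qed
    have wB: "\<gamma> + x t \<le> B" if t: "t < T" for t
    proof (cases "t \<le> T0")
      case True then show ?thesis using xsmall[OF True] B by auto
    next
      case False
      have "\<gamma> + x t + V0 / \<theta> \<le> (\<gamma> + x T0 + V0 / \<theta>) * exp (\<theta> * (t - T0))"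
      proof (rule linear_comparison)
        show "((\<lambda>t. \<gamma> + x t) has_real_derivative x1 s) (at s)" if "s \<in> {T0..t}" for s
          using that t by (auto intro!: derivative_eq_intros xder)
        show "x1 s \<le> \<theta> * (\<gamma> + x s) + V0" if "s \<in> {T0..t}" for s
          using VV0[of s] that t by (simp add: V_def)
      qed (use False \<theta> in auto)
      also have "\<dots> \<le> (\<gamma> + \<delta> + V0 / \<theta>) * exp (\<theta> * (T - T0))"
        using xsmall[of T0] V00 \<theta> \<gamma> \<delta> t by (intro mult_mono) auto
      finally show ?thesis using V00 \<theta> unfolding B_def[symmetric]
        by (meson add_increasing2 divide_nonneg_pos le_add_same_cancel1 order_trans)
    qed
    \<comment> \<open>Below \<open>B\<close> the clamp is inactive, so the clamped solution solves
      the original equation.\<close>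
    have "solution T \<mu> x"
      unfolding solution_def
    proof (intro conjI allI impI xb)
      fix t assume t: "t < T"
      have "response (\<lambda>s. of_real (drive s (x s) - \<mu> * g s)) t = response (\<lambda>s. of_real (F s)) t"
        using wB t by (intro response_cong) (simp add: F_def h_eq)
      then show "response (\<lambda>s. of_real (drive s (x s) - \<mu> * g s)) t = of_real (x t)"
        using zF[OF t] zx[OF t] by simp
    qed
    with xsmall wB show ?thesis by blast
  qed
  with nar T0 B0 show ?thesis using that by blast
qed

text \<open>The a priori estimate is applied again on half-lines further to the left, where the
  forcing at \<open>x = 0\<close> is below \<open>\<beta>\<close>. With \<open>L = 0\<close> the
  weight is the constant \<open>2\<close>, so the bound is
  \<open>4 * \<beta> / kap\<^sup>2 = e / 2\<close>.\<close>

lemma solution_tendsto_0: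
  assumes sol: "solution T \<mu> x" and nar: "narrow \<delta> T0" and le: "\<And>t. t \<le> T0 \<Longrightarrow> \<bar>x t\<bar> \<le> \<delta>"
  shows "(x \<longlongrightarrow> 0) at_bot"
proof (rule tendstoI)
  fix e :: real assume e: "e > 0"
  define \<beta> where "\<beta> = e * kap\<^sup>2 / 8"
  have \<beta>: "\<beta> > 0" using e kap by (simp add: \<beta>_def)
  have "((\<lambda>s. drive s 0 - \<mu> * g s) \<longlongrightarrow> 0 - \<mu> * 0) at_bot"
    by (intro tendsto_intros drive_0_tendsto g_lim)
  then have "eventually (\<lambda>s. dist (drive s 0 - \<mu> * g s) 0 < \<beta>) at_bot"
    using \<beta> by (intro tendstoD) auto
  then obtain T2 where T2: "\<And>s. s \<le> T2 \<Longrightarrow> \<bar>drive s 0 - \<mu> * g s\<bar> < \<beta>"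
    unfolding eventually_at_bot_linorder by auto
  define T1 where "T1 = min T (min T0 T2)"
  have T1: "T1 \<le> T" "T1 \<le> T0" "T1 \<le> T2" by (auto simp: T1_def)
  have xb: "bounded_cont T1 x" using sol T1 bounded_cont_mono by (auto simp: solution_def)
  have \<delta>: "\<delta> > 0" using nar by (auto simp: narrow_def)
  have "\<bar>x t\<bar> < e" if t: "t < T1" for t
  proof -
    have "norm (complex_of_real (x t)) \<le> 2 * \<beta> / kap\<^sup>2 * wt 0 T1 t"
    proof (rule response_gronwall[OF bounded_cont_of_real[OF xb] bounded_cont_of_real[OF bounded_cont_force[OF xb]] _ _ _ _ t])
      show "of_real (x t) = response (\<lambda>s. of_real (drive s (x s) - \<mu> * g s)) t" if "t < T1" for t
        using sol that T1 by (auto simp: solution_def)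
      fix s assume s: "s < T1"
      have "\<bar>drive s (x s) - drive s 0\<bar> \<le> kap\<^sup>2 / 4 * \<bar>x s - 0\<bar>"
        using s T1 \<delta> by (intro narrow_drive_lipschitz[OF nar] le) auto
      moreover have "\<bar>drive s 0 - \<mu> * g s\<bar> \<le> \<beta>" using T2[of s] s T1 by auto
      ultimately have "\<bar>(drive s (x s) - drive s 0) + (drive s 0 - \<mu> * g s)\<bar> \<le> kap\<^sup>2 / 4 * \<bar>x s - 0\<bar> + \<beta>"
        by (intro order_trans[OF abs_triangle_ineq] add_mono)
      then have "\<bar>drive s (x s) - \<mu> * g s\<bar> \<le> kap\<^sup>2 / 4 * \<bar>x s\<bar> + \<beta>" by simp
      then show "norm (complex_of_real (drive s (x s) - \<mu> * g s)) \<le> ell kap 0 T1 s * norm (complex_of_real (x s)) + \<beta>"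
        using s by (simp add: ell_def flip: of_real_mult of_real_diff)
    qed (use \<beta> in auto)
    also have "\<dots> = e / 2" using kap by (simp add: \<beta>_def wt_def)
    finally show ?thesis using e by simp
  qed
  then show "eventually (\<lambda>t. dist (x t) 0 < e) at_bot"
    unfolding eventually_at_bot_dense by (intro exI[of _ T1]) auto
qed

text \<open>Decay brings both solutions into the small disc for all sufficiently negative times,
  where the Lipschitz constant is \<open>kap\<^sup>2 / 4\<close>; the weighted estimate with zero
  forcing does the rest.\<close>

lemma solution_unique:
  assumes x: "solution T \<mu> x" "(x \<longlongrightarrow> 0) at_bot" and y: "solution T \<mu> y" "(y \<longlongrightarrow> 0) at_bot" and t: "t < T"
  shows "x t = y t"
proof -
  obtain \<delta> T1 where n1: "narrow \<delta> T1" using ex_narrow by blast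
  then have \<delta>: "\<delta> > 0" by (simp add: narrow_def)
  have "eventually (\<lambda>s. dist (x s) 0 < \<delta> \<and> dist (y s) 0 < \<delta>) at_bot"
    by (intro eventually_conj tendstoD x y \<delta>)
  then obtain T2 where T2: "\<And>s. s \<le> T2 \<Longrightarrow> \<bar>x s\<bar> < \<delta> \<and> \<bar>y s\<bar> < \<delta>"
    unfolding eventually_at_bot_linorder by auto
  define T0 where "T0 = min T1 T2"
  have nar: "narrow \<delta> T0" using narrow_mono[OF n1] by (simp add: T0_def)
  have b: "bounded_cont T x" "bounded_cont T y" using x y by (auto simp: solution_def)
  obtain M1 where M1: "M1 > 0" "\<And>s. s < T \<Longrightarrow> \<bar>x s\<bar> \<le> M1" using bounded_contD[OF b(1)] by auto
  obtain M2 where M2: "M2 > 0" "\<And>s. s < T \<Longrightarrow> \<bar>y s\<bar> \<le> M2" using bounded_contD[OF b(2)] by auto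
  obtain L where L: "L \<ge> 0" "\<And>s x y. \<lbrakk>s < T; s \<le> T0 \<Longrightarrow> \<bar>x\<bar> \<le> \<delta> \<and> \<bar>y\<bar> \<le> \<delta>; \<gamma> + x \<le> \<gamma> + M1 + M2; \<gamma> + y \<le> \<gamma> + M1 + M2\<rbrakk> \<Longrightarrow>
      \<bar>drive s x - drive s y\<bar> \<le> ell kap L T0 s * \<bar>x - y\<bar>"
    using drive_ell_bounds[OF nar, of "\<gamma> + M1 + M2" T] \<gamma> M1(1) M2(1) by (metis add_nonneg_nonneg less_imp_le)
  have "norm (complex_of_real (x t) - of_real (y t)) \<le> 2 * 0 / kap\<^sup>2 * wt L T0 t"
  proof (rule response_diff_le[OF bounded_cont_of_real[OF b(1)] bounded_cont_of_real[OF b(2)]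
        bounded_cont_of_real[OF bounded_cont_force[OF b(1)]] bounded_cont_of_real[OF bounded_cont_force[OF b(2)]] L(1) _ _ _ _ t])
    fix s assume s: "s < T"
    have "\<bar>drive s (x s) - drive s (y s)\<bar> \<le> ell kap L T0 s * \<bar>x s - y s\<bar>"
      using T2[of s] M1(1) M2(1) M1(2)[OF s] M2(2)[OF s] by (intro L(2) s) (auto simp: T0_def)
    then show "norm (complex_of_real (drive s (x s) - \<mu> * g s) - of_real (drive s (y s) - \<mu> * g s))
        \<le> ell kap L T0 s * norm (complex_of_real (x s) - of_real (y s)) + 0"
      by (simp flip: of_real_diff)
  qed (use x(1) y(1) in \<open>auto simp: solution_def\<close>)
  then show ?thesis by (simp flip: of_real_diff)
qed

lemma ode_imp_solution:
  assumes x: "\<And>t. (x has_real_derivative x1 t) (at t)"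
    and x1: "\<And>t. (x1 has_real_derivative - a * x1 t - c * x t + (drive t (x t) - \<mu> * g t)) (at t)"
    and lim: "(x \<longlongrightarrow> 0) at_bot"
  shows "solution T \<mu> x"
proof -
  have "continuous_on UNIV x" by (meson x DERIV_isCont continuous_at_imp_continuous_on)
  then have xb: "bounded_cont T x" using lim by (rule bounded_cont_of_tendsto)
  obtain M where M: "\<And>s. s < T \<Longrightarrow> \<bar>x s\<bar> \<le> M" using bounded_contD[OF xb] by auto
  show ?thesis
    unfolding solution_def
    using real_response_unique(1)[OF bounded_cont_force[OF xb] x x1 M] xb by auto
qed

text \<open>Each value is read off from a solution on \<open>{..<t + 1}\<close>, any horizon beyond
  \<open>t\<close> being good enough. By uniqueness the value does not depend on the horizon, which
  replaces gluing.\<close>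

definition Z :: "real \<Rightarrow> real \<Rightarrow> real" where
  "Z \<mu> t = (SOME x. solution (t + 1) \<mu> x \<and> (x \<longlongrightarrow> 0) at_bot) t"

lemma Z_eq:
  assumes "solution T \<mu> x" "(x \<longlongrightarrow> 0) at_bot" "t < T"
  shows "Z \<mu> t = x t"
proof -
  have "\<exists>y. solution (t + 1) \<mu> y \<and> (y \<longlongrightarrow> 0) at_bot"
    using ex_solution[of "\<bar>\<mu>\<bar>" "t + 1"] solution_tendsto_0 by (metis abs_ge_zero order_refl)
  from someI_ex[OF this] have y: "solution (t + 1) \<mu> (SOME y. solution (t + 1) \<mu> y \<and> (y \<longlongrightarrow> 0) at_bot)"
    "((SOME y. solution (t + 1) \<mu> y \<and> (y \<longlongrightarrow> 0) at_bot) \<longlongrightarrow> 0) at_bot" by auto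
  show ?thesis
    unfolding Z_def
    using solution_unique[OF solution_mono[OF y(1)] y(2) solution_mono[OF assms(1)] assms(2), of "min T (t + 1)" t] assms(3)
    by auto
qed

lemma solution_cong:
  assumes "\<And>t. t < T \<Longrightarrow> x t = y t" "solution T \<mu> x"
  shows "solution T \<mu> y"
proof -
  have "response (\<lambda>s. of_real (drive s (x s) - \<mu> * g s)) t = response (\<lambda>s. of_real (drive s (y s) - \<mu> * g s)) t"
    if "t < T" for t using that assms(1) by (intro response_cong) auto
  moreover have "bounded_cont T x = bounded_cont T y" by (rule bounded_cont_cong[OF assms(1)])
  ultimately show ?thesis using assms by (auto simp: solution_def)
qed

text \<open>Differentiation in the parameter needs one triple \<open>\<delta>\<close>,
  \<open>T0\<close>, \<open>B\<close> for all \<open>\<mu>\<close> in a bounded range, not one for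
  each \<open>\<mu>\<close>.\<close>

lemma Z_locally_uniform:
  assumes R: "R \<ge> 0"
  obtains \<delta> T0 B where "narrow \<delta> T0" "T0 < T" "B > 0"
    "\<And>\<mu> t. \<bar>\<mu>\<bar> \<le> R \<Longrightarrow> t \<le> T0 \<Longrightarrow> \<bar>Z \<mu> t\<bar> \<le> \<delta>"
    "\<And>\<mu> t. \<bar>\<mu>\<bar> \<le> R \<Longrightarrow> t < T \<Longrightarrow> \<gamma> + Z \<mu> t \<le> B"
    "\<And>\<mu>. \<bar>\<mu>\<bar> \<le> R \<Longrightarrow> solution T \<mu> (Z \<mu>)"
proof -
  obtain \<delta> T0 B where *: "narrow \<delta> T0" "T0 < T" "B > 0"
    "\<And>\<mu>. \<bar>\<mu>\<bar> \<le> R \<Longrightarrow> \<exists>x. solution T \<mu> x \<and> (\<forall>t\<le>T0. \<bar>x t\<bar> \<le> \<delta>) \<and> (\<forall>t<T. \<gamma> + x t \<le> B)"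
    using ex_solution[OF R, of T] by blast
  have "\<exists>x. solution T \<mu> x \<and> (\<forall>t\<le>T0. \<bar>x t\<bar> \<le> \<delta>) \<and> (\<forall>t<T. \<gamma> + x t \<le> B) \<and> (\<forall>t<T. x t = Z \<mu> t)"
    if \<mu>: "\<bar>\<mu>\<bar> \<le> R" for \<mu>
  proof -
    obtain x where x: "solution T \<mu> x" "\<forall>t\<le>T0. \<bar>x t\<bar> \<le> \<delta>" "\<forall>t<T. \<gamma> + x t \<le> B" using *(4)[OF \<mu>] by blast
    have "(x \<longlongrightarrow> 0) at_bot" using solution_tendsto_0[OF x(1) *(1)] x(2) by auto
    with Z_eq[OF x(1)] x show ?thesis by (intro exI[of _ x]) auto
  qed
  note ** = this
  show ?thesis
  proof (rule that[OF *(1,2,3)])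
    show "\<bar>Z \<mu> t\<bar> \<le> \<delta>" if "\<bar>\<mu>\<bar> \<le> R" "t \<le> T0" for \<mu> t
      using **[OF that(1)] that(2) *(2) by (metis order_le_less_trans)
    show "\<gamma> + Z \<mu> t \<le> B" if "\<bar>\<mu>\<bar> \<le> R" "t < T" for \<mu> t
      using **[OF that(1)] that(2) by metis
    show "solution T \<mu> (Z \<mu>)" if "\<bar>\<mu>\<bar> \<le> R" for \<mu>
      using **[OF that] solution_cong by blast
  qed
qed

lemma Z_solution: "solution T \<mu> (Z \<mu>)"
  by (rule Z_locally_uniform[of "\<bar>\<mu>\<bar>" T]) auto

lemma Z_tendsto: "(Z \<mu> \<longlongrightarrow> 0) at_bot"
proof -
  obtain \<delta> T0 B where "narrow \<delta> T0" "\<And>t. t \<le> T0 \<Longrightarrow> \<bar>Z \<mu> t\<bar> \<le> \<delta>"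
    using Z_locally_uniform[of "\<bar>\<mu>\<bar>" 0] by (metis abs_ge_zero order_refl)
  then show ?thesis using solution_tendsto_0[OF Z_solution] by blast
qed

end

subsection \<open>Differentiability in the parameter\<close>

text \<open>Mean value inequality for \<open>\<lambda>u. f u - f' x * u\<close>.\<close>

lemma taylor1_bound:
  fixes f :: "'a::real_normed_field \<Rightarrow> 'a"
  assumes "convex S" and df: "\<And>u. u \<in> S \<Longrightarrow> (f has_field_derivative f' u) (at u)"
    and le: "\<And>u. u \<in> S \<Longrightarrow> norm (f' u - f' x) \<le> e" and "x \<in> S" "y \<in> S"
  shows "norm (f y - f x - f' x * (y - x)) \<le> e * norm (y - x)"
proof -
  have "norm ((f y - f' x * y) - (f x - f' x * x)) \<le> e * norm (y - x)"
  proof (rule field_differentiable_bound[OF assms(1) _ le])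
    fix u assume u: "u \<in> S"
    have "((\<lambda>u. f u - f' x * u) has_field_derivative f' u - f' x * 1) (at u)"
      by (intro DERIV_diff df u DERIV_cmult DERIV_ident)
    then show "((\<lambda>u. f u - f' x * u) has_field_derivative f' u - f' x) (at u within S)"
      by (simp add: has_field_derivative_at_within)
  qed (use assms in auto)
  then show ?thesis by (simp add: algebra_simps)
qed

text \<open>The positive part is 1-Lipschitz and maps the unbounded set of \<open>w \<le> B\<close>
  into a compact interval, where continuity is uniform.\<close>

lemma pos_part_powr_uniformly_continuous:
  fixes q B :: real
  assumes q: "q > 0" and e: "e > 0"
  shows "\<exists>d>0. \<forall>w w'. w \<le> B \<longrightarrow> w' \<le> B \<longrightarrow> \<bar>w' - w\<bar> < d \<longrightarrow> \<bar>max w' 0 powr q - max w 0 powr q\<bar> < e"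
proof -
  have "continuous_on {0..max B 0} (\<lambda>w. w powr q)"
    using q by (intro continuous_on_powr' continuous_intros) auto
  then have "uniformly_continuous_on {0..max B 0} (\<lambda>w. w powr q)"
    by (intro compact_uniformly_continuous) auto
  then obtain d where d: "d > 0"
    "\<And>w w'. w \<in> {0..max B 0} \<Longrightarrow> w' \<in> {0..max B 0} \<Longrightarrow> dist w' w < d \<Longrightarrow> dist (w' powr q) (w powr q) < e"
    unfolding uniformly_continuous_on_def using e by blast
  have "\<bar>max w' 0 powr q - max w 0 powr q\<bar> < e" if "w \<le> B" "w' \<le> B" "\<bar>w' - w\<bar> < d" for w w'
    using d(2)[of "max w 0" "max w' 0"] that by (auto simp: dist_real_def max_def split: if_splits)
  with d show ?thesis by blast
qed

lemma continuous_on_pair_of_uniform: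
  fixes F :: "real \<Rightarrow> real \<Rightarrow> real"
  assumes c: "\<And>\<mu>. continuous_on UNIV (F \<mu>)"
    and u: "\<And>\<mu> T e. e > 0 \<Longrightarrow> \<exists>d>0. \<forall>\<nu>. \<bar>\<nu> - \<mu>\<bar> < d \<longrightarrow> (\<forall>t<T. \<bar>F \<nu> t - F \<mu> t\<bar> \<le> e)"
  shows "continuous_on UNIV (\<lambda>(t, \<mu>). F \<mu> t)"
proof -
  have "\<exists>d>0. \<forall>s \<nu>. dist (s, \<nu>) (t, \<mu>) < d \<longrightarrow> dist (F \<nu> s) (F \<mu> t) < e" if e: "e > 0" for t \<mu> e
  proof -
    obtain d1 where d1: "d1 > 0" "\<And>\<nu> s. \<bar>\<nu> - \<mu>\<bar> < d1 \<Longrightarrow> s < t + 1 \<Longrightarrow> \<bar>F \<nu> s - F \<mu> s\<bar> \<le> e / 2"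
      using u[of "e / 2" \<mu> "t + 1"] e by (auto simp del: abs_le_iff)
    obtain d2 where d2: "d2 > 0" "\<And>s. dist s t < d2 \<Longrightarrow> dist (F \<mu> s) (F \<mu> t) < e / 2"
      using c[of \<mu>] e unfolding continuous_on_iff by (metis UNIV_I half_gt_zero)
    have "dist (F \<nu> s) (F \<mu> t) < e" if near: "dist (s, \<nu>) (t, \<mu>) < min 1 (min d1 d2)" for s \<nu>
    proof -
      have "dist s t \<le> dist (s, \<nu>) (t, \<mu>)" "dist \<nu> \<mu> \<le> dist (s, \<nu>) (t, \<mu>)"
        using dist_fst_le[of "(s, \<nu>)" "(t, \<mu>)"] dist_snd_le[of "(s, \<nu>)" "(t, \<mu>)"] by auto
      with near have "dist s t < d2" "\<bar>\<nu> - \<mu>\<bar> < d1" "s < t + 1" by (auto simp: dist_real_def)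
      with d1(2)[of \<nu> s] d2(2)[of s] dist_triangle[of "F \<nu> s" "F \<mu> t" "F \<mu> s"]
      show ?thesis unfolding dist_real_def by linarith
    qed
    with d1 d2 show ?thesis by (intro exI[of _ "min 1 (min d1 d2)"]) auto
  qed
  then show ?thesis unfolding continuous_on_iff by (auto simp: split_beta)
qed

context emden
begin

text \<open>The time derivative in the form given by \<open>(D - l2) z = duhamel l1 F\<close>.
  Written without a derivative, its dependence on \<open>\<mu>\<close> follows from that of
  \<open>Z\<close> and of the first Duhamel step.\<close>

definition Zd :: "real \<Rightarrow> real \<Rightarrow> real" where
  "Zd \<mu> t = Re (l2 * of_real (Z \<mu> t) + duhamel l1 (\<lambda>s. of_real (drive s (Z \<mu> s) - \<mu> * g s)) t)"

lemma Z_bounded_cont: "bounded_cont T (Z \<mu>)"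
  using Z_solution[of T \<mu>] by (simp add: solution_def)

lemma Z_response: "response (\<lambda>s. of_real (drive s (Z \<mu> s) - \<mu> * g s)) t = of_real (Z \<mu> t)"
  using Z_solution[of "t + 1" \<mu>] by (simp add: solution_def)

lemma Z_deriv:
  shows "(Z \<mu> has_real_derivative Zd \<mu> t) (at t)"
    and "(Zd \<mu> has_real_derivative - a * Zd \<mu> t - c * Z \<mu> t + (drive t (Z \<mu> t) - \<mu> * g t)) (at t)"
    and "l2 * of_real (Z \<mu> t) + duhamel l1 (\<lambda>s. of_real (drive s (Z \<mu> s) - \<mu> * g s)) t = of_real (Zd \<mu> t)"
  using real_response(1,2,4)[OF bounded_cont_force[of "t + 1" "Z \<mu>" \<mu>, OF Z_bounded_cont], of t]
  by (simp_all only: Z_response Re_complex_of_real less_add_one Zd_def[abs_def])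

lemma Z_uniform_deriv:
  assumes R: "R \<ge> 0"
  shows "\<exists>Y H. (\<forall>\<mu>. \<bar>\<mu>\<bar> \<le> R \<longrightarrow> bounded_cont T (Y \<mu>) \<and> bounded_cont T (H \<mu>)) \<and>
    uniform_deriv {-R..R} T Z Y \<and> uniform_deriv {-R..R} T Zd H"
proof -
  obtain \<delta> T0 B where nar: "narrow \<delta> T0" and T0: "T0 < T" and B: "B > 0"
    and small: "\<And>\<mu> t. \<bar>\<mu>\<bar> \<le> R \<Longrightarrow> t \<le> T0 \<Longrightarrow> \<bar>Z \<mu> t\<bar> \<le> \<delta>"
    and ZB: "\<And>\<mu> t. \<bar>\<mu>\<bar> \<le> R \<Longrightarrow> t < T \<Longrightarrow> \<gamma> + Z \<mu> t \<le> B"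
    and "\<And>\<mu>. \<bar>\<mu>\<bar> \<le> R \<Longrightarrow> solution T \<mu> (Z \<mu>)"
    by (rule Z_locally_uniform[where T = T, OF R], rule that)
  obtain M where M: "M > 0" "\<And>s. s < T \<Longrightarrow> \<bar>k s\<bar> \<le> M" using bounded_contD[OF bounded_cont_k] by auto
  obtain L where L: "L \<ge> 0" "\<And>s x y. \<lbrakk>s < T; s \<le> T0 \<Longrightarrow> \<bar>x\<bar> \<le> \<delta> \<and> \<bar>y\<bar> \<le> \<delta>; \<gamma> + x \<le> B; \<gamma> + y \<le> B\<rbrakk> \<Longrightarrow>
      \<bar>drive s x - drive s y\<bar> \<le> ell kap L T0 s * \<bar>x - y\<bar>"
    "\<And>s x. \<lbrakk>s < T; s \<le> T0 \<Longrightarrow> \<bar>x\<bar> \<le> \<delta>; \<gamma> + x \<le> B\<rbrakk> \<Longrightarrow> \<bar>drive' s x\<bar> \<le> ell kap L T0 s"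
    using drive_ell_bounds[OF nar, of B T] B by (metis less_imp_le)
  define I where "I = {complex_of_real r | r. \<bar>r\<bar> \<le> R}"
  have I: "\<bar>r\<bar> \<le> R \<Longrightarrow> of_real r \<in> I" for r unfolding I_def by blast
  have II: "\<exists>r. \<mu> = of_real r \<and> \<bar>r\<bar> \<le> R" if "\<mu> \<in> I" for \<mu> using that unfolding I_def by blast
  \<comment> \<open>The real problem is put into the complex setting through \<open>Re\<close>.
    \<open>Q\<close> is not complex differentiable, but the parameters in \<open>I\<close> and all
    values of \<open>z\<close> are real, so the expansion is needed only along the real
    axis.\<close>
  define z where "z \<mu> s = complex_of_real (Z (Re \<mu>) s)" for \<mu> s
  define Q where "Q s x = complex_of_real (drive s (Re x))" for s x
  define Q' where "Q' s x = complex_of_real (drive' s (Re x))" for s x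
  note defs = z_def Q_def Q'_def
  obtain y \<eta> where y: "\<And>\<mu>. \<mu> \<in> I \<Longrightarrow> bounded_cont T (y \<mu>)" "\<And>\<mu>. \<mu> \<in> I \<Longrightarrow> bounded_cont T (\<eta> \<mu>)"
    and yd: "uniform_deriv I T z y"
    and \<eta>d: "uniform_deriv I T (\<lambda>\<mu>. duhamel l1 (\<lambda>s. Q s (z \<mu> s) - \<mu> * of_real (g s))) \<eta>"
  proof (rule response_parameter_diff[where I = I and z = z and Q = Q and Q' = Q' and T = T and L = L and ?T0.0 = T0
        and g = "\<lambda>s. of_real (g s)"])
    show "L \<ge> 0" by (rule L)
    show "bounded_cont T (\<lambda>s. complex_of_real (g s))" by (intro bounded_cont_of_real bounded_cont_g)
    show "bounded_cont T (z \<mu>)" for \<mu>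
      unfolding z_def by (intro bounded_cont_of_real Z_bounded_cont)
    show "bounded_cont T (\<lambda>s. Q s (z \<mu> s))" for \<mu>
      unfolding defs Re_complex_of_real by (intro bounded_cont_of_real bounded_cont_drive Z_bounded_cont)
    show "bounded_cont T (\<lambda>s. Q' s (z \<mu> s))" for \<mu>
      unfolding defs Re_complex_of_real by (intro bounded_cont_of_real bounded_cont_drive' Z_bounded_cont)
    show "z \<mu> t = response (\<lambda>s. Q s (z \<mu> s) - \<mu> * of_real (g s)) t" if m: "\<mu> \<in> I" for \<mu> t
    proof -
      obtain r where r: "\<mu> = of_real r" using II[OF m] by blast
      show ?thesis using Z_response[of r t] by (simp add: defs r)
    qed
    fix \<mu> \<nu> s assume m: "\<mu> \<in> I" "\<nu> \<in> I" and s: "s < T"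
    obtain r r' where r: "\<mu> = of_real r" "\<bar>r\<bar> \<le> R" "\<nu> = of_real r'" "\<bar>r'\<bar> \<le> R"
      using II[OF m(1)] II[OF m(2)] by blast
    have "\<bar>drive s (Z r' s) - drive s (Z r s)\<bar> \<le> ell kap L T0 s * \<bar>Z r' s - Z r s\<bar>"
      using small[OF r(2)] small[OF r(4)] by (intro L(2) s ZB r) auto
    then show "norm (Q s (z \<nu> s) - Q s (z \<mu> s)) \<le> ell kap L T0 s * norm (z \<nu> s - z \<mu> s)"
      by (simp add: defs r flip: of_real_diff)
  next
    fix \<mu> s assume m: "\<mu> \<in> I" and s: "s < T"
    obtain r where r: "\<mu> = of_real r" "\<bar>r\<bar> \<le> R" using II[OF m] by blast
    have "\<bar>drive' s (Z r s)\<bar> \<le> ell kap L T0 s" by (intro L(3) s small ZB r)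
    then show "norm (Q' s (z \<mu> s)) \<le> ell kap L T0 s" by (simp add: defs r)
  next
    fix e :: real assume e: "e > 0"
    \<comment> \<open>\<open>drive'\<close> varies by \<open>p * k s\<close> times the variation of
      the power, and \<open>k s \<le> M\<close>.\<close>
    have "e / (p * M) > 0" using e p1 M by simp
    then obtain d where d: "d > 0" "\<And>w w'. w \<le> B \<Longrightarrow> w' \<le> B \<Longrightarrow> \<bar>w' - w\<bar> < d \<Longrightarrow>
        \<bar>max w' 0 powr (p - 1) - max w 0 powr (p - 1)\<bar> < e / (p * M)"
      using pos_part_powr_uniformly_continuous[of "p - 1" "e / (p * M)" B] p1 by auto
    have taylor: "norm (drive s x' - drive s x - drive' s x * (x' - x)) \<le> e * norm (x' - x)"
      if s: "s < T" and x: "\<gamma> + x \<le> B" "\<gamma> + x' \<le> B" "\<bar>x' - x\<bar> < d" for s x x'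
    proof (rule taylor1_bound[where S = "{..B - \<gamma>} \<inter> ball x d" and f = "drive s"])
      show "convex ({..B - \<gamma>} \<inter> ball x d)" by (intro convex_Int convex_real_interval convex_ball)
      fix u assume u: "u \<in> {..B - \<gamma>} \<inter> ball x d"
      have "drive' s u - drive' s x = - (p * k s * (max (\<gamma> + u) 0 powr (p - 1) - max (\<gamma> + x) 0 powr (p - 1)))"
        by (simp add: drive'_def algebra_simps)
      then have "norm (drive' s u - drive' s x) = p * k s * \<bar>max (\<gamma> + u) 0 powr (p - 1) - max (\<gamma> + x) 0 powr (p - 1)\<bar>"
        using p1 k_nonneg[of s] by (simp add: abs_mult)
      also have "\<dots> \<le> p * M * (e / (p * M))"
      proof (rule mult_mono)
        have "\<gamma> + u \<le> B" "\<bar>(\<gamma> + u) - (\<gamma> + x)\<bar> < d"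
          using u by (simp_all add: dist_real_def abs_minus_commute)
        from d(2)[OF x(1) this]
        show "\<bar>max (\<gamma> + u) 0 powr (p - 1) - max (\<gamma> + x) 0 powr (p - 1)\<bar> \<le> e / (p * M)"
          by (rule less_imp_le)
        show "p * k s \<le> p * M" using M(2)[OF s] p1 by simp
        show "0 \<le> p * M" using M(1) p1 by simp
      qed simp
      finally show "norm (drive' s u - drive' s x) \<le> e" using p1 M by simp
    qed (use x in \<open>auto simp: dist_real_def abs_minus_commute intro: drive_deriv\<close>)
    have *: "norm (Q s (z \<nu> s) - Q s (z \<mu> s) - Q' s (z \<mu> s) * (z \<nu> s - z \<mu> s)) \<le> e * norm (z \<nu> s - z \<mu> s)"
      if m: "\<mu> \<in> I" "\<nu> \<in> I" and s: "s < T" and near: "norm (z \<nu> s - z \<mu> s) < d" for \<mu> \<nu> s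
    proof -
      obtain r r' where r: "\<mu> = of_real r" "\<bar>r\<bar> \<le> R" "\<nu> = of_real r'" "\<bar>r'\<bar> \<le> R"
        using II[OF m(1)] II[OF m(2)] by blast
      have "norm (drive s (Z r' s) - drive s (Z r s) - drive' s (Z r s) * (Z r' s - Z r s)) \<le> e * norm (Z r' s - Z r s)"
        using near ZB[OF r(2) s] ZB[OF r(4) s] s by (intro taylor) (simp_all add: z_def r flip: of_real_diff)
      then show ?thesis
        unfolding defs r Re_complex_of_real of_real_diff[symmetric] of_real_mult[symmetric] norm_of_real by simp
    qed
    show "\<exists>d>0. \<forall>\<mu>\<in>I. \<forall>\<nu>\<in>I. \<forall>s<T. norm (z \<nu> s - z \<mu> s) < d \<longrightarrow>
      norm (Q s (z \<nu> s) - Q s (z \<mu> s) - Q' s (z \<mu> s) * (z \<nu> s - z \<mu> s)) \<le> e * norm (z \<nu> s - z \<mu> s)"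
      using d(1) * by blast
  qed blast
  have Qz: "Q s (z (of_real r) s) - of_real r * of_real (g s) = of_real (drive s (Z r s) - r * g s)" for r s
    by (simp add: defs)
  have J: "of_real r \<in> I" if "r \<in> {-R..R}" for r using that by (intro I) auto
  show ?thesis
  proof (rule exI[of _ "\<lambda>r t. Re (y (of_real r) t)"],
      rule exI[of _ "\<lambda>r t. Re (l2 * y (of_real r) t + \<eta> (of_real r) t)"], intro conjI allI impI)
    show "uniform_deriv {-R..R} T Z (\<lambda>r t. Re (y (of_real r) t))"
      using uniform_deriv_Re[where J = "{-R..R}", OF yd] J by (simp add: z_def)
    show "uniform_deriv {-R..R} T Zd (\<lambda>r t. Re (l2 * y (of_real r) t + \<eta> (of_real r) t))"
      using uniform_deriv_Re[where J = "{-R..R}", OF uniform_deriv_cmult_add[OF yd \<eta>d, of l2]] J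
      unfolding Qz by (simp only: z_def Re_complex_of_real Zd_def[abs_def])
  next
    fix r :: real assume "\<bar>r\<bar> \<le> R"
    note b = y[OF I[OF this]]
    show "bounded_cont T (\<lambda>t. Re (y (of_real r) t))" by (rule bounded_cont_Re[OF b(1)])
    show "bounded_cont T (\<lambda>t. Re (l2 * y (of_real r) t + \<eta> (of_real r) t))"
      by (intro bounded_cont_Re bounded_cont_add bounded_cont_mult bounded_cont_const b)
  qed
qed

text \<open>Taking the actual derivative makes the family independent of \<open>R\<close> and of the
  horizon \<open>T\<close>; the locally constructed derivatives are then identified with it.\<close>

definition Zm :: "real \<Rightarrow> real \<Rightarrow> real" where
  "Zm \<mu> t = deriv (\<lambda>\<mu>. Z \<mu> t) \<mu>"

lemma Z_parameter:
  shows "((\<lambda>\<mu>. Z \<mu> t) has_real_derivative Zm \<mu> t) (at \<mu>)"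
    and "bounded_cont T (Zm \<mu>)"
    and "e > 0 \<Longrightarrow> \<exists>d>0. \<forall>\<nu>. \<bar>\<nu> - \<mu>\<bar> < d \<longrightarrow> (\<forall>t<T. \<bar>Z \<nu> t - Z \<mu> t\<bar> \<le> e)"
    and "e > 0 \<Longrightarrow> \<exists>d>0. \<forall>\<nu>. \<bar>\<nu> - \<mu>\<bar> < d \<longrightarrow> (\<forall>t<T. \<bar>Zd \<nu> t - Zd \<mu> t\<bar> \<le> e)"
    and "e > 0 \<Longrightarrow> \<exists>d>0. \<forall>\<nu>. \<bar>\<nu> - \<mu>\<bar> < d \<longrightarrow> (\<forall>t<T. \<bar>Zm \<nu> t - Zm \<mu> t\<bar> \<le> e)"
proof -
  \<comment> \<open>The extra \<open>1\<close> puts \<open>\<mu>\<close> into the interior of the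
    parameter interval, so that derivatives are two-sided.\<close>
  define R where "R = \<bar>\<mu>\<bar> + 1"
  have R: "R \<ge> 0" "\<mu> \<in> {-R<..<R}" "\<mu> \<in> {-R..R}" "\<bar>\<mu>\<bar> \<le> R" by (auto simp: R_def)
  have *: "\<exists>Y H. bounded_cont T (Y \<mu>) \<and> bounded_cont T (H \<mu>) \<and> uniform_deriv {-R..R} T Z Y \<and>
      uniform_deriv {-R..R} T Zd H" for T
    using Z_uniform_deriv[OF R(1), of T] R(4) by meson
  have der: "((\<lambda>\<mu>. Z \<mu> t) has_real_derivative Y \<nu> t) (at \<nu>)"
    if "uniform_deriv {-R..R} T Z Y" "t < T" "\<nu> \<in> {-R<..<R}" for T Y t \<nu>
    by (rule uniform_deriv_has_field_derivative[OF that(1) open_greaterThanLessThan _ that(3,2)]) auto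
  have YZ: "Y \<nu> t = Zm \<nu> t" if "uniform_deriv {-R..R} T Z Y" "t < T" "\<nu> \<in> {-R<..<R}" for T Y t \<nu>
    unfolding Zm_def by (rule DERIV_imp_deriv[OF der[OF that], symmetric])
  show "((\<lambda>\<mu>. Z \<mu> t) has_real_derivative Zm \<mu> t) (at \<mu>)"
    using *[of "t + 1"] der[OF _ less_add_one R(2)] YZ[OF _ less_add_one R(2)] by metis
  obtain Y H where Y: "bounded_cont T (Y \<mu>)" "bounded_cont T (H \<mu>)"
    and Yd: "uniform_deriv {-R..R} T Z Y" and Hd: "uniform_deriv {-R..R} T Zd H" using *[of T] by blast
  show "bounded_cont T (Zm \<mu>)"
    using Y(1) YZ[OF Yd _ R(2)] bounded_cont_cong[of T "Y \<mu>" "Zm \<mu>"] by auto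
  have ex: "\<exists>d>0. \<forall>\<nu>. \<bar>\<nu> - \<mu>\<bar> < d \<longrightarrow> (\<forall>t<T. \<bar>F \<nu> t - F \<mu> t\<bar> \<le> e)"
    if F: "\<exists>d>0. \<forall>\<nu>\<in>{-R..R}. norm (\<nu> - \<mu>) < d \<longrightarrow> (\<forall>t<T. norm (G \<nu> t - G \<mu> t) \<le> e)"
      and G: "\<And>\<nu> t. \<nu> \<in> {-R<..<R} \<Longrightarrow> t < T \<Longrightarrow> G \<nu> t = F \<nu> t" for F G :: "real \<Rightarrow> real \<Rightarrow> real" and e
  proof -
    obtain d where d: "d > 0" "\<And>\<nu> t. \<nu> \<in> {-R..R} \<Longrightarrow> \<bar>\<nu> - \<mu>\<bar> < d \<Longrightarrow> t < T \<Longrightarrow> \<bar>G \<nu> t - G \<mu> t\<bar> \<le> e"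
      using F unfolding real_norm_def by blast
    have "\<bar>F \<nu> t - F \<mu> t\<bar> \<le> e" if \<nu>: "\<bar>\<nu> - \<mu>\<bar> < min 1 d" and t: "t < T" for \<nu> t
    proof -
      have "\<nu> \<in> {-R<..<R}" using \<nu> by (auto simp: R_def)
      then show ?thesis using d(2)[OF _ _ t, of \<nu>] G[OF _ t] R(2) \<nu> by auto
    qed
    then show ?thesis using d(1) by (intro exI[of _ "min 1 d"]) auto
  qed
  show "\<exists>d>0. \<forall>\<nu>. \<bar>\<nu> - \<mu>\<bar> < d \<longrightarrow> (\<forall>t<T. \<bar>Z \<nu> t - Z \<mu> t\<bar> \<le> e)" if "e > 0"
    by (rule ex[OF uniform_deriv_continuous[OF Yd R(3) Y(1) that]]) (rule refl)
  show "\<exists>d>0. \<forall>\<nu>. \<bar>\<nu> - \<mu>\<bar> < d \<longrightarrow> (\<forall>t<T. \<bar>Zd \<nu> t - Zd \<mu> t\<bar> \<le> e)" if "e > 0"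
    by (rule ex[OF uniform_deriv_continuous[OF Hd R(3) Y(2) that]]) (rule refl)
  show "\<exists>d>0. \<forall>\<nu>. \<bar>\<nu> - \<mu>\<bar> < d \<longrightarrow> (\<forall>t<T. \<bar>Zm \<nu> t - Zm \<mu> t\<bar> \<le> e)" if "e > 0"
    by (rule ex[OF uniform_deriv_deriv_continuous[OF Yd R(3) that]]) (rule YZ[OF Yd])
qed

lemma continuous_on_Z:
  "continuous_on UNIV (Z \<mu>)" "continuous_on UNIV (Zd \<mu>)" "continuous_on UNIV (Zm \<mu>)"
proof -
  show "continuous_on UNIV (Z \<mu>)" "continuous_on UNIV (Zd \<mu>)"
    by (meson Z_deriv DERIV_isCont continuous_at_imp_continuous_on)+
  have "isCont (Zm \<mu>) t" for t
    using bounded_cont_continuous[OF Z_parameter(2)[of "t + 1" \<mu>]]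
    by (simp add: continuous_on_eq_continuous_at)
  then show "continuous_on UNIV (Zm \<mu>)" by (simp add: continuous_at_imp_continuous_on)
qed

lemma continuous_on_Z_pair:
  "continuous_on UNIV (\<lambda>(t, \<mu>). Z \<mu> t)"
  "continuous_on UNIV (\<lambda>(t, \<mu>). Zd \<mu> t)"
  "continuous_on UNIV (\<lambda>(t, \<mu>). Zm \<mu> t)"
  by (intro continuous_on_pair_of_uniform continuous_on_Z Z_parameter; assumption)+

text \<open>Total differentiability follows from the two partial derivatives and the joint
  continuity of \<open>Zm\<close>.\<close>

lemma Z_has_derivative:
  "((\<lambda>(t, \<mu>). Z \<mu> t) has_derivative (\<lambda>(h, \<kappa>). Zd \<mu> t * h + Zm \<mu> t * \<kappa>)) (at (t, \<mu>))"
proof -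
  have "((\<lambda>(t, \<mu>). Z \<mu> t) has_derivative (\<lambda>(h, \<kappa>). Zd \<mu> t * h + blinfun_mult_right (Zm \<mu> t) \<kappa>))
     (at (t, \<mu>) within UNIV \<times> UNIV)"
  proof (rule has_derivative_partialsI[where fy = "\<lambda>t \<mu>. blinfun_mult_right (Zm \<mu> t)"])
    show "((\<lambda>t. Z \<mu> t) has_derivative (*) (Zd \<mu> t)) (at t within UNIV)"
      using Z_deriv(1) by (simp add: has_field_derivative_def)
    show "((\<lambda>\<mu>. Z \<mu> x) has_derivative blinfun_apply (blinfun_mult_right (Zm y x))) (at y within UNIV)" for x y
      using Z_parameter(1)[of x y] by (simp add: has_field_derivative_def)
    have "isCont (\<lambda>z. (\<lambda>(t, \<mu>). Zm \<mu> t) z) (t, \<mu>)"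
      using continuous_on_Z_pair(3) by (simp add: continuous_on_eq_continuous_at)
    from bounded_linear.isCont[OF bounded_linear_blinfun_mult_right this]
    show "continuous (at (t, \<mu>) within UNIV \<times> UNIV) (\<lambda>(x, y). blinfun_mult_right (Zm y x))"
      by (simp add: case_prod_unfold)
  qed auto
  then show ?thesis by simp
qed

subsection \<open>Analyticity in the parameter\<close>

definition cdrive :: "real \<Rightarrow> complex \<Rightarrow> complex" where
  "cdrive s x = of_real (b * \<gamma>) + of_real (p * b) * x - of_real (k s) * (of_real \<gamma> + x) powr of_real p"

lemma cdrive_of_real: "\<gamma> + x \<ge> 0 \<Longrightarrow> cdrive s (of_real x) = of_real (drive s x)"
  using powr_of_real[of "\<gamma> + x" p] by (simp add: cdrive_def drive_def)

lemma cdrive_deriv: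
  assumes "\<gamma> + Re x > 0"
  shows "(cdrive s has_field_derivative cdrive' s x) (at x)"
proof -
  have nonpos: "of_real \<gamma> + x \<notin> \<real>\<^sub>\<le>\<^sub>0" using assms by (auto simp: complex_nonpos_Reals_iff)
  have "((\<lambda>x. (of_real \<gamma> + x) powr of_real p) has_field_derivative
     of_real p * (of_real \<gamma> + x) powr (of_real p - 1) * 1) (at x)"
    by (rule DERIV_chain2[where f = "\<lambda>z. z powr of_real p" and g = "\<lambda>x. of_real \<gamma> + x",
          OF has_field_derivative_powr[OF nonpos]]) (auto intro!: derivative_eq_intros)
  then have 1: "((\<lambda>x. (of_real \<gamma> + x) powr of_real p) has_field_derivative
     of_real p * (of_real \<gamma> + x) powr of_real (p - 1)) (at x)" by simp
  have "((\<lambda>x. of_real (b * \<gamma>) + of_real (p * b) * x) has_field_derivative of_real (p * b)) (at x)"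
    by (auto intro!: derivative_eq_intros)
  from DERIV_diff[OF this DERIV_cmult[OF 1, of "of_real (k s)"]]
  show ?thesis unfolding cdrive_def[abs_def] cdrive'_def by (simp add: mult_ac)
qed

lemma norm_cdrive'_le:
  assumes "norm (of_real \<gamma> + x) \<le> W" "\<bar>k s\<bar> \<le> M"
  shows "norm (cdrive' s x) \<le> p * b + p * M * W powr (p - 1)"
proof -
  have "norm (cdrive' s x) \<le> norm (complex_of_real (p * b)) + norm (of_real (p * k s) * (of_real \<gamma> + x) powr of_real (p - 1))"
    unfolding cdrive'_def by (rule norm_triangle_ineq4)
  also have "\<dots> = p * b + p * \<bar>k s\<bar> * norm (of_real \<gamma> + x) powr (p - 1)"
    using p1 b_pos norm_powr_real_powr'[of "of_real (p - 1)" "of_real \<gamma> + x"]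
    by (simp add: norm_mult abs_mult del: of_real_diff)
  also have "\<dots> \<le> p * b + p * M * W powr (p - 1)"
    using assms p1 by (intro add_left_mono mult_mono powr_mono2) auto
  finally show ?thesis .
qed

text \<open>Near minus infinity \<open>\<gamma> + Z\<close> exceeds \<open>\<gamma> / 2\<close>
  because \<open>Z\<close> decays, on the compact remainder it attains a positive minimum, and
  continuity pushes the endpoint beyond \<open>t0\<close>. The strict gain is needed because all
  parameter estimates hold for \<open>t < T\<close>.\<close>

lemma Z_positive_beyond:
  assumes pos: "\<And>s. s \<le> t0 \<Longrightarrow> \<gamma> + Z \<mu> s > 0"
  obtains T m where "T > t0" "m > 0" "\<And>s. s < T \<Longrightarrow> m \<le> \<gamma> + Z \<mu> s"
proof -
  have cont: "continuous_on UNIV (\<lambda>s. \<gamma> + Z \<mu> s)" by (intro continuous_intros continuous_on_Z)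
  then have "isCont (\<lambda>s. \<gamma> + Z \<mu> s) t0" by (simp add: continuous_on_eq_continuous_at)
  then have "eventually (\<lambda>s. \<gamma> + Z \<mu> s > 0) (nhds t0)"
    using pos[of t0] by (intro order_tendstoD(1)[of _ "\<gamma> + Z \<mu> t0"]) (auto simp: isCont_def tendsto_nhds_iff)
  then obtain e where e: "e > 0" "\<And>s. dist s t0 < e \<Longrightarrow> \<gamma> + Z \<mu> s > 0"
    unfolding eventually_nhds_metric by blast
  define T where "T = t0 + e / 2"
  have T: "T > t0" using e by (simp add: T_def)
  have posT: "\<gamma> + Z \<mu> s > 0" if "s \<le> T" for s
  proof (cases "s \<le> t0")
    case False
    then show ?thesis using that e by (intro e(2)) (auto simp: T_def dist_real_def)
  qed (rule pos)
  have "eventually (\<lambda>s. Z \<mu> s > - \<gamma> / 2) at_bot"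
    using \<gamma> by (intro order_tendstoD(1)[OF Z_tendsto]) auto
  then obtain S where S: "\<And>s. s \<le> S \<Longrightarrow> Z \<mu> s > - \<gamma> / 2" unfolding eventually_at_bot_linorder by blast
  define S' where "S' = min S T"
  obtain s0 where s0: "s0 \<in> {S'..T}" "\<And>s. s \<in> {S'..T} \<Longrightarrow> \<gamma> + Z \<mu> s0 \<le> \<gamma> + Z \<mu> s"
    using continuous_attains_inf[of "{S'..T}" "\<lambda>s. \<gamma> + Z \<mu> s"] continuous_on_subset[OF cont]
    by (auto simp: S'_def)
  have "min (\<gamma> / 2) (\<gamma> + Z \<mu> s0) \<le> \<gamma> + Z \<mu> s" if "s < T" for s
  proof (cases "s < S'")
    case True then show ?thesis using S[of s] by (auto simp: S'_def)
  next
    case False then show ?thesis using s0(2)[of s] that by auto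
  qed
  moreover have "min (\<gamma> / 2) (\<gamma> + Z \<mu> s0) > 0" using \<gamma> posT s0(1) by auto
  ultimately show ?thesis using that T by blast
qed

lemma Z_positive_open:
  assumes "m > 0" "\<And>s. s < T \<Longrightarrow> m \<le> \<gamma> + Z \<mu> s"
  shows "\<exists>d>0. \<forall>\<nu>. \<bar>\<nu> - \<mu>\<bar> < d \<longrightarrow> (\<forall>s<T. \<gamma> + Z \<nu> s > 0)"
proof -
  obtain d where d: "d > 0" "\<And>\<nu> s. \<bar>\<nu> - \<mu>\<bar> < d \<Longrightarrow> s < T \<Longrightarrow> \<bar>Z \<nu> s - Z \<mu> s\<bar> \<le> m / 2"
    using Z_parameter(3)[OF half_gt_zero[OF assms(1)]] by blast
  have "\<gamma> + Z \<nu> s > 0" if "\<bar>\<nu> - \<mu>\<bar> < d" "s < T" for \<nu> s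
    using d(2)[OF that] assms(2)[OF that(2)] assms(1) by linarith
  with d(1) show ?thesis by blast
qed

text \<open>Around a positive solution the equation extends holomorphically to complex \<open>\<mu>\<close>. Its solution in a
  tube around \<open>Z \<mu>0\<close> is complex differentiable in \<open>\<mu>\<close> by the same argument as in the real case.\<close>

lemma Z_complexification:
  assumes m: "m > 0" and pos: "\<And>s. s < T \<Longrightarrow> m \<le> \<gamma> + Z \<mu>0 s"
  shows "\<exists>\<rho>>0. \<exists>F G. (\<forall>t<T. F t holomorphic_on ball (of_real \<mu>0) \<rho> \<and> G t holomorphic_on ball (of_real \<mu>0) \<rho>) \<and>
    (\<forall>\<nu>. \<bar>\<nu> - \<mu>0\<bar> < \<rho> \<longrightarrow> (\<forall>t<T. F t (of_real \<nu>) = of_real (Z \<nu> t) \<and> G t (of_real \<nu>) = of_real (Zd \<nu> t)))"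
proof -
  obtain \<delta> T1 where nar1: "narrow \<delta> T1" using ex_narrow by blast
  then have \<delta>: "0 < \<delta>" "\<delta> < \<gamma>" by (auto simp: narrow_def)
  have "eventually (\<lambda>s. dist (Z \<mu>0 s) 0 < \<delta> / 2) at_bot" using \<delta> by (intro tendstoD Z_tendsto) auto
  then obtain T2 where T2: "\<And>s. s \<le> T2 \<Longrightarrow> \<bar>Z \<mu>0 s\<bar> < \<delta> / 2" unfolding eventually_at_bot_linorder by auto
  define T0 where "T0 = min T1 T2"
  have T0: "T0 \<le> T2" and nar: "narrow \<delta> T0" using narrow_mono[OF nar1] by (auto simp: T0_def)
  obtain W where W: "W > 0" "\<And>s. s < T \<Longrightarrow> \<bar>\<gamma> + Z \<mu>0 s\<bar> \<le> W"
    using bounded_contD[OF bounded_cont_add[OF bounded_cont_const Z_bounded_cont], of T \<gamma> \<mu>0] by auto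
  obtain M where M: "M > 0" "\<And>s. s < T \<Longrightarrow> \<bar>k s\<bar> \<le> M" using bounded_contD[OF bounded_cont_k] by auto
  obtain M' where M': "M' > 0" "\<And>s. s < T \<Longrightarrow> \<bar>g s\<bar> \<le> M'" using bounded_contD[OF bounded_cont_g] by auto
  \<comment> \<open>The half of \<open>\<delta>\<close> keeps the tube in the disc of
    \<open>narrow\<close> up to \<open>T0\<close>, since \<open>Z \<mu>0\<close> itself uses the
    other half. The half of \<open>m\<close> keeps \<open>\<gamma> + x\<close> at real part at least
    \<open>m / 2\<close>, away from the branch cut.\<close>
  define \<eta> where "\<eta> = min (\<delta> / 2) (m / 2)"
  have \<eta>: "\<eta> > 0" "\<eta> \<le> \<delta> / 2" "\<eta> \<le> m / 2" using \<delta> m by (auto simp: \<eta>_def)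
  define W1 where "W1 = W + \<eta>"
  define X where "X = p * b + p * M * W1 powr (p - 1)"
  have X0: "X \<ge> 0" using p1 b_pos M by (simp add: X_def)
  define L where "L = 2 * (1 + X)"
  have L: "L \<ge> 0" "X \<le> L\<^sup>2 / 4" using X0 by (auto simp: L_def power2_eq_square algebra_simps)
  have wt0: "wt L T0 s > 0" for s using wt_ge_1[of L T0 s] by linarith
  \<comment> \<open>The tube is a ball of radius \<open>\<epsilon>\<close> in the weighted norm, the
    shape the contraction preserves. Dividing by the weight at \<open>T\<close> keeps its actual
    radius below \<open>\<eta>\<close>.\<close>
  define \<epsilon> where "\<epsilon> = \<eta> / wt L T0 T"
  have \<epsilon>: "\<epsilon> > 0" using \<eta> wt0 by (simp add: \<epsilon>_def)
  have \<epsilon>\<eta>: "\<epsilon> * wt L T0 s \<le> \<eta>" if "s < T" for s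
  proof -
    have "\<epsilon> * wt L T0 s \<le> \<epsilon> * wt L T0 T" using that \<epsilon> L by (intro mult_left_mono wt_mono) auto
    also have "\<dots> = \<eta>" using wt0[of T] by (simp add: \<epsilon>_def)
    finally show ?thesis .
  qed
  define S where "S s = cball (complex_of_real (Z \<mu>0 s)) (\<epsilon> * wt L T0 s)" for s
  have tube: "norm (x - of_real (Z \<mu>0 s)) \<le> \<eta>" "m / 2 \<le> Re (of_real \<gamma> + x)" "norm (of_real \<gamma> + x) \<le> W1"
    if s: "s < T" and x: "x \<in> S s" for s x
  proof -
    show 1: "norm (x - of_real (Z \<mu>0 s)) \<le> \<eta>"
      using x \<epsilon>\<eta>[OF s] by (simp add: S_def dist_norm norm_minus_commute)
    have "\<bar>Re x - Z \<mu>0 s\<bar> \<le> \<eta>"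
      using abs_Re_le_cmod[of "x - of_real (Z \<mu>0 s)"] 1 by simp
    then show "m / 2 \<le> Re (of_real \<gamma> + x)" using pos[OF s] \<eta>(3) by (simp add: abs_le_iff)
    have "norm (of_real \<gamma> + x) \<le> norm (complex_of_real (\<gamma> + Z \<mu>0 s)) + norm (x - of_real (Z \<mu>0 s))"
      using norm_triangle_ineq[of "complex_of_real (\<gamma> + Z \<mu>0 s)" "x - of_real (Z \<mu>0 s)"] by (simp add: algebra_simps)
    also have "norm (complex_of_real (\<gamma> + Z \<mu>0 s)) \<le> W" using W(2)[OF s] by (simp only: norm_of_real)
    finally show "norm (of_real \<gamma> + x) \<le> W1" using 1 by (simp add: W1_def)
  qed
  have deriv: "(cdrive s has_field_derivative cdrive' s x) (at x)" if "s < T" "x \<in> S s" for s x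
    using tube(2)[OF that] m by (intro cdrive_deriv) simp
  have ell: "norm (cdrive' s x) \<le> ell kap L T0 s" if s: "s < T" and x: "x \<in> S s" for s x
  proof (cases "s \<le> T0")
    case True
    have "norm x \<le> norm (x - of_real (Z \<mu>0 s)) + norm (complex_of_real (Z \<mu>0 s))"
      using norm_triangle_ineq[of "x - of_real (Z \<mu>0 s)" "of_real (Z \<mu>0 s)"] by simp
    also have "\<dots> \<le> \<delta>" using tube(1)[OF s x] T2[of s] True T0 \<eta>(2) by simp
    finally show ?thesis using nar True by (simp add: narrow_def ell_def)
  next
    case False
    then show ?thesis
      using norm_cdrive'_le[OF tube(3)[OF s x] M(2)[OF s]] L(2) by (simp add: ell_def X_def)
  qed
  have lip: "norm (cdrive s x - cdrive s y) \<le> ell kap L T0 s * norm (x - y)"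
    if s: "s < T" and x: "x \<in> S s" and y: "y \<in> S s" for s x y
  proof (rule field_differentiable_bound[where S = "S s" and f' = "cdrive' s"])
    show "convex (S s)" by (simp add: S_def)
    show "(cdrive s has_field_derivative cdrive' s u) (at u within S s)" if "u \<in> S s" for u
      by (rule has_field_derivative_at_within[OF deriv[OF s that]])
    show "norm (cdrive' s u) \<le> ell kap L T0 s" if "u \<in> S s" for u by (rule ell[OF s that])
  qed (fact x y)+
  have powb: "bounded_cont T (\<lambda>s. (of_real \<gamma> + z s) powr of_real q)"
    if q: "q > 0" and z: "bounded_cont T z" "\<And>s. s < T \<Longrightarrow> z s \<in> S s" for q :: real and z
  proof (rule bounded_contI)
    show "continuous_on {..<T} (\<lambda>s. (of_real \<gamma> + z s) powr of_real q)"
    proof (intro continuous_on_powr_complex continuous_intros bounded_cont_continuous[OF z(1)])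
      show "{..<T} \<subseteq> {s. 0 \<le> Re (of_real \<gamma> + z s) \<or> Im (of_real \<gamma> + z s) \<noteq> 0}"
      proof
        fix s assume "s \<in> {..<T}"
        then have "m / 2 \<le> Re (of_real \<gamma> + z s)" using tube(2)[OF _ z(2)] by auto
        with m show "s \<in> {s. 0 \<le> Re (of_real \<gamma> + z s) \<or> Im (of_real \<gamma> + z s) \<noteq> 0}" by auto
      qed
    qed (use q in auto)
    show "norm ((of_real \<gamma> + z s) powr of_real q) \<le> W1 powr q" if "s < T" for s
      using tube(3)[OF that z(2)[OF that]] q norm_powr_real_powr'[of "of_real q" "of_real \<gamma> + z s"]
      by (auto intro!: powr_mono2)
  qed
  have cb: "bounded_cont T (\<lambda>s. cdrive s (z s))" if "bounded_cont T z" "\<And>s. s < T \<Longrightarrow> z s \<in> S s" for z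
    unfolding cdrive_def using p1 that
    by (intro bounded_cont_diff bounded_cont_add bounded_cont_mult bounded_cont_const
        bounded_cont_of_real[OF bounded_cont_k] powb) auto
  have cb': "bounded_cont T (\<lambda>s. cdrive' s (z s))" if "bounded_cont T z" "\<And>s. s < T \<Longrightarrow> z s \<in> S s" for z
    unfolding cdrive'_def of_real_mult using p1 that
    by (intro bounded_cont_diff bounded_cont_add bounded_cont_mult bounded_cont_const
        bounded_cont_of_real[OF bounded_cont_k] powb) auto
  have gb: "bounded_cont T (\<lambda>s. complex_of_real (g s))" by (rule bounded_cont_of_real[OF bounded_cont_g])
  have Fb: "bounded_cont T (\<lambda>s. cdrive s (z s) - \<mu> * of_real (g s))"
    if "bounded_cont T z" "\<And>s. s < T \<Longrightarrow> z s \<in> S s" for z \<mu>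
    by (intro bounded_cont_diff bounded_cont_mult bounded_cont_const gb cb that)
  have real_eq: "cdrive s (of_real (Z \<nu> s)) - of_real \<nu> * of_real (g s) = of_real (drive s (Z \<nu> s) - \<nu> * g s)"
    if "s < T" "of_real (Z \<nu> s) \<in> S s" for s \<nu>
  proof -
    have "\<gamma> + Z \<nu> s \<ge> 0" using tube(2)[OF that] m by simp
    then show ?thesis by (simp add: cdrive_of_real)
  qed
  have Z0S: "of_real (Z \<mu>0 s) \<in> S s" for s using \<epsilon> wt0[of s] by (simp add: S_def)
  have Zb: "bounded_cont T (\<lambda>s. complex_of_real (Z \<nu> s))" for \<nu> by (intro bounded_cont_of_real Z_bounded_cont)
  \<comment> \<open>A parameter change of size \<open>\<rho>1\<close> moves the response by at most
    \<open>\<rho>1 * M' / kap\<^sup>2 = \<epsilon> / 2\<close>. The contraction contributes the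
    other half of the radius, so the tube is mapped into itself.\<close>
  define \<rho>1 where "\<rho>1 = \<epsilon> * kap\<^sup>2 / (2 * M')"
  have \<rho>1: "\<rho>1 > 0" using \<epsilon> kap M' by (simp add: \<rho>1_def)
  have "\<exists>z. bounded_cont T z \<and> (\<forall>s<T. z s \<in> S s) \<and>
      (\<forall>t<T. z t = response (\<lambda>s. cdrive s (z s) - \<mu> * of_real (g s)) t)"
    if \<mu>: "\<mu> \<in> ball (of_real \<mu>0) \<rho>1" for \<mu>
  proof (rule response_fixed_point[where T = T and S = S and H = "\<lambda>s x. cdrive s x - \<mu> * of_real (g s)"
        and ?z0.0 = "\<lambda>s. of_real (Z \<mu>0 s)" and L = L and ?T0.0 = T0])
    show "0 \<le> L" by (rule L)
    show "closed (S s)" for s by (simp add: S_def)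
    show "continuous_on {..<T} (\<lambda>s. cdrive s (z s) - \<mu> * of_real (g s))"
      if "bounded_cont T z" "\<And>s. s < T \<Longrightarrow> z s \<in> S s" for z by (rule bounded_cont_continuous[OF Fb[OF that]])
    show "norm (cdrive s x - \<mu> * of_real (g s) - (cdrive s y - \<mu> * of_real (g s))) \<le> ell kap L T0 s * norm (x - y)"
      if "s < T" "x \<in> S s" "y \<in> S s" for s x y using lip[OF that] by simp
    show "bounded_cont T (\<lambda>s. complex_of_real (Z \<mu>0 s))" by (rule Zb)
    show "of_real (Z \<mu>0 s) \<in> S s" for s by (rule Z0S)
    show "bounded_cont T (\<lambda>s. cdrive s (of_real (Z \<mu>0 s)) - \<mu> * of_real (g s))" by (rule Fb[OF Zb Z0S])
    fix z t assume z: "bounded_cont T z" "\<And>s. s < T \<Longrightarrow> z s \<in> S s" and t: "t < T"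
    let ?G = "\<lambda>s. cdrive s (z s) - \<mu> * of_real (g s)"
    let ?H = "\<lambda>s. cdrive s (of_real (Z \<mu>0 s)) - of_real \<mu>0 * of_real (g s)"
    have n\<mu>: "norm (\<mu> - of_real \<mu>0) \<le> \<rho>1" using \<mu> by (simp add: dist_norm norm_minus_commute)
    \<comment> \<open>The centre of the tube is the image of itself at parameter
      \<open>\<mu>0\<close>, so the distance to the centre is a response to a difference.\<close>
    have "response ?H t = of_real (Z \<mu>0 t)"
      using t Z0S by (intro trans[OF response_cong[OF real_eq] Z_response]) auto
    moreover have FbG: "bounded_cont T ?G" by (rule Fb[OF z])
    moreover have FbG0: "bounded_cont T ?H" by (rule Fb[OF Zb Z0S])
    ultimately have "response ?G t - of_real (Z \<mu>0 t) = response (\<lambda>s. ?G s - ?H s) t"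
      using response_diff[OF FbG FbG0 t] by metis
    also have "norm \<dots> \<le> \<epsilon> / 2 * wt L T0 t + (\<rho>1 * M') / kap\<^sup>2"
    proof (rule response_bound_wt[OF bounded_cont_diff[OF FbG FbG0] t L(1)])
      fix s assume "s \<le> t"
      then have s: "s < T" using t by simp
      have "?G s - ?H s = (cdrive s (z s) - cdrive s (of_real (Z \<mu>0 s))) - (\<mu> - of_real \<mu>0) * of_real (g s)"
        by (simp add: algebra_simps)
      then have "norm (?G s - ?H s) \<le> norm (cdrive s (z s) - cdrive s (of_real (Z \<mu>0 s)))
          + norm ((\<mu> - of_real \<mu>0) * complex_of_real (g s))"
        by (simp only: norm_triangle_ineq4)
      also have "\<dots> \<le> ell kap L T0 s * (\<epsilon> * wt L T0 s) + \<rho>1 * M'"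
      proof (rule add_mono)
        have "norm (z s - of_real (Z \<mu>0 s)) \<le> \<epsilon> * wt L T0 s"
          using z(2)[OF s] by (simp add: S_def dist_norm norm_minus_commute)
        then show "norm (cdrive s (z s) - cdrive s (of_real (Z \<mu>0 s))) \<le> ell kap L T0 s * (\<epsilon> * wt L T0 s)"
          by (intro order_trans[OF lip[OF s z(2)[OF s] Z0S]] mult_left_mono ell_nonneg)
        show "norm ((\<mu> - of_real \<mu>0) * complex_of_real (g s)) \<le> \<rho>1 * M'"
          unfolding norm_mult norm_of_real using n\<mu> M'(2)[OF s] \<rho>1 by (intro mult_mono) auto
      qed
      finally show "norm (?G s - ?H s) \<le> ell kap L T0 s * (\<epsilon> * wt L T0 s) + \<rho>1 * M'" .
    qed (use \<epsilon> \<rho>1 M' in auto)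
    also have "(\<rho>1 * M') / kap\<^sup>2 = \<epsilon> / 2 * 1" using kap M' by (simp add: \<rho>1_def)
    also have "\<epsilon> / 2 * wt L T0 t + \<epsilon> / 2 * 1 \<le> \<epsilon> / 2 * wt L T0 t + \<epsilon> / 2 * wt L T0 t"
      using \<epsilon> by (intro add_left_mono mult_left_mono wt_ge_1) auto
    finally show "response ?G t \<in> S t" by (simp add: S_def dist_norm norm_minus_commute)
  qed blast
  then obtain z where z: "\<And>\<mu>. \<mu> \<in> ball (of_real \<mu>0) \<rho>1 \<Longrightarrow> bounded_cont T (z \<mu>)"
    "\<And>\<mu> s. \<mu> \<in> ball (of_real \<mu>0) \<rho>1 \<Longrightarrow> s < T \<Longrightarrow> z \<mu> s \<in> S s"
    "\<And>\<mu> t. \<mu> \<in> ball (of_real \<mu>0) \<rho>1 \<Longrightarrow> t < T \<Longrightarrow> z \<mu> t = response (\<lambda>s. cdrive s (z \<mu> s) - \<mu> * of_real (g s)) t"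
    by metis
  let ?I = "ball (complex_of_real \<mu>0) \<rho>1"
  define \<zeta> where "\<zeta> \<mu> t = duhamel l1 (\<lambda>s. cdrive s (z \<mu> s) - \<mu> * of_real (g s)) t" for \<mu> t
  \<comment> \<open>A compact convex set on which the principal power is continuous, hence uniformly
    continuous, and which contains all values \<open>\<gamma> + x\<close> of the tube.\<close>
  define D where "D = {w. m / 2 \<le> Re w} \<inter> cball (0::complex) W1"
  have Dconv: "convex D" unfolding D_def by (intro convex_Int convex_halfspace_Re_ge convex_cball)
  have Dcomp: "compact D" unfolding D_def by (intro closed_Int_compact closed_halfspace_Re_ge compact_cball)
  have zD: "of_real \<gamma> + x \<in> D" if "s < T" "x \<in> S s" for s x
    using tube(2,3)[OF that] by (simp add: D_def)
  have "continuous_on D (\<lambda>w. w powr of_real (p - 1))"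
    using m by (intro continuous_on_powr_complex continuous_intros) (auto simp: D_def)
  then have uc: "uniformly_continuous_on D (\<lambda>w. w powr of_real (p - 1))"
    by (rule compact_uniformly_continuous[OF _ Dcomp])
  have "\<exists>y \<eta>. uniform_deriv ?I T z y \<and> uniform_deriv ?I T \<zeta> \<eta>"
    unfolding \<zeta>_def[abs_def]
  proof (rule response_parameter_diff[where I = ?I and z = z and Q = cdrive and Q' = cdrive' and T = T and L = L
        and ?T0.0 = T0 and g = "\<lambda>s. of_real (g s)"])
    show "0 \<le> L" by (rule L)
    show "bounded_cont T (\<lambda>s. complex_of_real (g s))" by (rule gb)
    show "bounded_cont T (\<lambda>s. cdrive s (z \<mu> s))" if "\<mu> \<in> ?I" for \<mu> by (rule cb[OF z(1,2)[OF that]])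
    show "bounded_cont T (\<lambda>s. cdrive' s (z \<mu> s))" if "\<mu> \<in> ?I" for \<mu> by (rule cb'[OF z(1,2)[OF that]])
    show "norm (cdrive s (z \<nu> s) - cdrive s (z \<mu> s)) \<le> ell kap L T0 s * norm (z \<nu> s - z \<mu> s)"
      if "\<mu> \<in> ?I" "\<nu> \<in> ?I" "s < T" for \<mu> \<nu> s
      by (rule lip[OF that(3) z(2)[OF that(2,3)] z(2)[OF that(1,3)]])
    show "norm (cdrive' s (z \<mu> s)) \<le> ell kap L T0 s" if "\<mu> \<in> ?I" "s < T" for \<mu> s
      by (rule ell[OF that(2) z(2)[OF that]])
    fix e :: real assume e: "e > 0"
    have "e / (p * M) > 0" using e p1 M by simp
    then obtain d where d: "d > 0" "\<And>w w'. w \<in> D \<Longrightarrow> w' \<in> D \<Longrightarrow> dist w' w < d \<Longrightarrow>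
        dist (w' powr of_real (p - 1)) (w powr of_real (p - 1)) < e / (p * M)"
      using uc unfolding uniformly_continuous_on_def by blast
    have taylor: "norm (cdrive s x' - cdrive s x - cdrive' s x * (x' - x)) \<le> e * norm (x' - x)"
      if s: "s < T" and x: "x \<in> S s" "x' \<in> S s" "norm (x' - x) < d" for s x x'
    proof (rule taylor1_bound[where S = "S s \<inter> ball x d" and f = "cdrive s"])
      show "convex (S s \<inter> ball x d)" unfolding S_def by (intro convex_Int convex_cball convex_ball)
      fix u assume u: "u \<in> S s \<inter> ball x d"
      then show "(cdrive s has_field_derivative cdrive' s u) (at u)" by (intro deriv s) auto
      have "cdrive' s u - cdrive' s x = - (of_real (p * k s) *
          ((of_real \<gamma> + u) powr of_real (p - 1) - (of_real \<gamma> + x) powr of_real (p - 1)))"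
        by (simp add: cdrive'_def algebra_simps)
      then have "norm (cdrive' s u - cdrive' s x) = p * k s *
          norm ((of_real \<gamma> + u) powr of_real (p - 1) - (of_real \<gamma> + x) powr of_real (p - 1))"
        using p1 k_nonneg[of s] by (simp add: norm_mult del: of_real_diff)
      also have "\<dots> \<le> p * M * (e / (p * M))"
      proof (rule mult_mono)
        have "of_real \<gamma> + x \<in> D" "of_real \<gamma> + u \<in> D" using u by (auto intro: zD[OF s] x)
        moreover have "dist (of_real \<gamma> + u) (of_real \<gamma> + x) < d" using u by (simp add: dist_commute)
        ultimately show "norm ((of_real \<gamma> + u) powr of_real (p - 1) - (of_real \<gamma> + x) powr of_real (p - 1)) \<le> e / (p * M)"
          using d(2) unfolding dist_norm by (intro less_imp_le) blast
        show "p * k s \<le> p * M" using M(2)[OF s] p1 by simp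
        show "0 \<le> p * M" using M(1) p1 by simp
      qed simp
      finally show "norm (cdrive' s u - cdrive' s x) \<le> e" using p1 M by simp
    qed (use x d in \<open>auto simp: dist_norm norm_minus_commute\<close>)
    show "\<exists>d>0. \<forall>\<mu>\<in>?I. \<forall>\<nu>\<in>?I. \<forall>s<T. norm (z \<nu> s - z \<mu> s) < d \<longrightarrow>
      norm (cdrive s (z \<nu> s) - cdrive s (z \<mu> s) - cdrive' s (z \<mu> s) * (z \<nu> s - z \<mu> s)) \<le> e * norm (z \<nu> s - z \<mu> s)"
      using d(1) taylor z(2) by blast
  qed (fact z(1) z(3) | blast)+
  then obtain y \<eta>' where y: "uniform_deriv ?I T z y" "uniform_deriv ?I T \<zeta> \<eta>'" by blast
  have zhol: "(\<lambda>\<mu>. z \<mu> t) holomorphic_on ?I" "(\<lambda>\<mu>. \<zeta> \<mu> t) holomorphic_on ?I" if "t < T" for t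
    unfolding holomorphic_on_open[OF open_ball]
    using uniform_deriv_has_field_derivative[OF y(1) open_ball subset_refl _ that]
      uniform_deriv_has_field_derivative[OF y(2) open_ball subset_refl _ that] by blast+
  \<comment> \<open>For real parameters this close to \<open>\<mu>0\<close> the solution
    \<open>Z \<nu>\<close> lies in the tube, and uniqueness there identifies it with
    \<open>z (of_real \<nu>)\<close>.\<close>
  obtain d where d: "d > 0" "\<And>\<nu> s. \<bar>\<nu> - \<mu>0\<bar> < d \<Longrightarrow> s < T \<Longrightarrow> \<bar>Z \<nu> s - Z \<mu>0 s\<bar> \<le> \<epsilon>"
    using Z_parameter(3)[OF \<epsilon>, of \<mu>0 T] by blast
  define \<rho> where "\<rho> = min d \<rho>1"
  have \<rho>: "\<rho> > 0" "\<rho> \<le> d" "\<rho> \<le> \<rho>1" using d \<rho>1 by (auto simp: \<rho>_def)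
  have zZ: "z (of_real \<nu>) t = of_real (Z \<nu> t)" if \<nu>: "\<bar>\<nu> - \<mu>0\<bar> < \<rho>" and t: "t < T" for \<nu> t
  proof -
    have I: "of_real \<nu> \<in> ?I" using \<nu> \<rho>(3) by (simp add: dist_real_def abs_minus_commute)
    have ZS: "of_real (Z \<nu> s) \<in> S s" if s: "s < T" for s
    proof -
      have "dist (Z \<mu>0 s) (Z \<nu> s) \<le> \<epsilon> * 1" using d(2)[OF _ s, of \<nu>] \<nu> \<rho>(2) by (simp add: dist_real_def abs_minus_commute)
      also have "\<dots> \<le> \<epsilon> * wt L T0 s" using \<epsilon> by (intro mult_left_mono wt_ge_1) auto
      finally show ?thesis by (simp add: S_def)
    qed
    have "norm (z (of_real \<nu>) t - of_real (Z \<nu> t)) \<le> 2 * 0 / kap\<^sup>2 * wt L T0 t"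
    proof (rule response_diff_le[OF z(1)[OF I] Zb Fb[OF z(1,2)[OF I]] Fb[OF Zb ZS] L(1) _ z(3)[OF I]])
      show "of_real (Z \<nu> t) = response (\<lambda>s. cdrive s (of_real (Z \<nu> s)) - of_real \<nu> * of_real (g s)) t" if "t < T" for t
        using that ZS by (intro trans[OF response_cong[OF real_eq] Z_response, symmetric]) auto
      show "norm (cdrive s (z (of_real \<nu>) s) - of_real \<nu> * of_real (g s) -
          (cdrive s (of_real (Z \<nu> s)) - of_real \<nu> * of_real (g s)))
          \<le> ell kap L T0 s * norm (z (of_real \<nu>) s - of_real (Z \<nu> s)) + 0" if "s < T" for s
        using lip[OF that z(2)[OF I that] ZS[OF that]] by simp
    qed (use t in auto)
    then show ?thesis by simp
  qed
  have \<zeta>Z: "l2 * z (of_real \<nu>) t + \<zeta> (of_real \<nu>) t = of_real (Zd \<nu> t)" if \<nu>: "\<bar>\<nu> - \<mu>0\<bar> < \<rho>" and t: "t < T" for \<nu> t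
  proof -
    have I: "of_real \<nu> \<in> ?I" using \<nu> \<rho>(3) by (simp add: dist_real_def abs_minus_commute)
    have "\<zeta> (of_real \<nu>) t = duhamel l1 (\<lambda>s. of_real (drive s (Z \<nu> s) - \<nu> * g s)) t"
      unfolding \<zeta>_def
    proof (rule duhamel_cong)
      fix s assume "s \<le> t"
      then have s: "s < T" using t by simp
      show "cdrive s (z (of_real \<nu>) s) - of_real \<nu> * of_real (g s) = of_real (drive s (Z \<nu> s) - \<nu> * g s)"
        using real_eq[OF s, of \<nu>] z(2)[OF I s] zZ[OF \<nu> s] by simp
    qed
    then show ?thesis using Z_deriv(3)[of \<nu> t] zZ[OF \<nu> t] by simp
  qed
  have sub: "ball (complex_of_real \<mu>0) \<rho> \<subseteq> ?I" using \<rho>(3) by (rule subset_ball)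
  show ?thesis
  proof (rule exI[of _ \<rho>], intro conjI \<rho>(1),
      rule exI[of _ "\<lambda>t \<mu>. z \<mu> t"], rule exI[of _ "\<lambda>t \<mu>. l2 * z \<mu> t + \<zeta> \<mu> t"], intro conjI allI impI)
    fix t assume t: "t < T"
    show "(\<lambda>\<mu>. z \<mu> t) holomorphic_on ball (of_real \<mu>0) \<rho>"
      by (rule holomorphic_on_subset[OF zhol(1)[OF t] sub])
    show "(\<lambda>\<mu>. l2 * z \<mu> t + \<zeta> \<mu> t) holomorphic_on ball (of_real \<mu>0) \<rho>"
      by (intro holomorphic_intros holomorphic_on_subset[OF zhol(1)[OF t] sub]
          holomorphic_on_subset[OF zhol(2)[OF t] sub])
  qed (use zZ \<zeta>Z in auto)
qed

end

text \<open>Powers of \<open>\<nu> - \<mu>0\<close> are real, so taking real parts of the Taylor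
  coefficients gives a real series, valid on the same range.\<close>

lemma holomorphic_real_power_series:
  assumes hol: "F holomorphic_on ball (of_real \<mu>0) \<rho>"
    and real: "\<And>\<nu>. \<bar>\<nu> - \<mu>0\<bar> < \<rho> \<Longrightarrow> F (of_real \<nu>) = of_real (f \<nu>)"
  shows "\<exists>c. \<forall>\<nu>. \<bar>\<nu> - \<mu>0\<bar> < \<rho> \<longrightarrow> (\<lambda>n. c n * (\<nu> - \<mu>0) ^ n) sums f \<nu>"
proof (intro exI allI impI)
  fix \<nu> assume \<nu>: "\<bar>\<nu> - \<mu>0\<bar> < \<rho>"
  let ?c = "\<lambda>n. (deriv ^^ n) F (of_real \<mu>0) / fact n"
  have "of_real \<nu> \<in> ball (complex_of_real \<mu>0) \<rho>" using \<nu> by (simp add: dist_real_def abs_minus_commute)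
  from holomorphic_power_series[OF hol this]
  have "(\<lambda>n. Re (?c n * of_real ((\<nu> - \<mu>0) ^ n))) sums Re (F (of_real \<nu>))"
    by (intro sums_Re) simp
  then show "(\<lambda>n. Re (?c n) * (\<nu> - \<mu>0) ^ n) sums f \<nu>"
    unfolding real[OF \<nu>] by (simp only: times_complex.sel Re_complex_of_real Im_complex_of_real mult_zero_right diff_zero)
qed

subsection \<open>Return to the radial variable\<close>

text \<open>With \<open>s\<close> a square root of \<open>a\<^sup>2 / 4 - c\<close>, a real
  \<open>s\<close> is smaller than \<open>a / 2\<close> because \<open>c > 0\<close>, and an
  imaginary one has real part \<open>0\<close>. Hence \<open>kap = a / 2 - \<bar>Re s\<bar>\<close>
  is positive.\<close>

lemma stable_quadratic_roots:
  fixes a c :: real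
  assumes "a > 0" "c > 0"
  obtains l1 l2 :: complex and kap :: real where "kap > 0" "Re l1 \<le> - kap" "Re l2 \<le> - kap"
    "l1 + l2 = - of_real a" "l1 * l2 = of_real c"
proof -
  define d where "d = a\<^sup>2 / 4 - c"
  define s where "s = (if d \<ge> 0 then complex_of_real (sqrt d) else \<i> * of_real (sqrt (- d)))"
  have s2: "s * s = of_real d"
    by (auto simp: s_def simp flip: of_real_mult) (simp add: algebra_simps flip: of_real_mult)
  have "\<bar>Re s\<bar> < a / 2"
  proof (cases "d \<ge> 0")
    case True
    have "sqrt d < sqrt ((a / 2)\<^sup>2)" using assms by (simp add: d_def power_divide)
    then show ?thesis using True assms by (simp add: s_def)
  qed (use assms in \<open>simp add: s_def\<close>)
  moreover have "(- of_real (a / 2) + s) * (- of_real (a / 2) - s) = of_real ((a / 2)\<^sup>2) - s * s"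
    by (simp add: algebra_simps power2_eq_square)
  then have "(- of_real (a / 2) + s) * (- of_real (a / 2) - s) = of_real c"
    unfolding s2 of_real_diff[symmetric] by (simp add: d_def power_divide)
  moreover have "(- of_real (a / 2) + s) + (- of_real (a / 2) - s) = - of_real a" by simp
  ultimately show ?thesis
    by (intro that[of "a / 2 - \<bar>Re s\<bar>" "- of_real (a / 2) + s" "- of_real (a / 2) - s"])
      (auto simp: Re_divide_numeral)
qed

lemma filterlim_exp_at_right_0: "filterlim exp (at_right (0::real)) at_bot"
  unfolding filterlim_at by (auto intro: exp_at_bot)

text \<open>The result has the shape of the input with exponent \<open>q - 1\<close>, so the rule
  serves for both \<open>U\<close> and \<open>U1\<close>.\<close>

lemma powr_mult_ln_deriv:
  assumes h: "(h has_real_derivative h') (at (ln r))" and r: "r > 0"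
  shows "((\<lambda>r. r powr q * h (ln r)) has_real_derivative r powr (q - 1) * (h' + q * h (ln r))) (at r)"
proof -
  have 1: "((\<lambda>r. r powr q) has_real_derivative q * r powr (q - 1)) (at r)"
    using r by (auto intro!: derivative_eq_intros)
  have 2: "((\<lambda>r. h (ln r)) has_real_derivative h' * (1 / r)) (at r)"
    using r by (intro DERIV_chain2[where f = h and g = ln, OF h]) (auto intro!: derivative_eq_intros)
  have "r powr q * (1 / r) = r powr (q - 1)" using r by (simp add: powr_diff)
  then have "h' * (1 / r) * r powr q = h' * r powr (q - 1)"
    by (simp only: mult.assoc mult.commute[of "1 / r"])
  then have "q * r powr (q - 1) * h (ln r) + h' * (1 / r) * r powr q = r powr (q - 1) * (h' + q * h (ln r))"
    by (simp only: distrib_left mult_ac add.commute)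
  with DERIV_mult[OF 1 2] show ?thesis by simp
qed

context emden
begin

definition U :: "real \<Rightarrow> real \<Rightarrow> real" where
  "U \<mu> r = r powr - \<theta> * (\<gamma> + Z \<mu> (ln r))"

definition U1 :: "real \<Rightarrow> real \<Rightarrow> real" where
  "U1 \<mu> r = r powr (- \<theta> - 1) * (Zd \<mu> (ln r) + - \<theta> * (\<gamma> + Z \<mu> (ln r)))"

definition Zdd :: "real \<Rightarrow> real \<Rightarrow> real" where
  "Zdd \<mu> t = - a * Zd \<mu> t - c * Z \<mu> t + (drive t (Z \<mu> t) - \<mu> * g t)"

definition U2 :: "real \<Rightarrow> real \<Rightarrow> real" where
  "U2 \<mu> r = r powr (- \<theta> - 1 - 1) * (Zdd \<mu> (ln r) + - \<theta> * Zd \<mu> (ln r)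
      + (- \<theta> - 1) * (Zd \<mu> (ln r) + - \<theta> * (\<gamma> + Z \<mu> (ln r))))"

lemma U_deriv: "r > 0 \<Longrightarrow> (U \<mu> has_real_derivative U1 \<mu> r) (at r)"
  unfolding U_def[abs_def] U1_def
  by (intro powr_mult_ln_deriv) (auto intro!: derivative_eq_intros Z_deriv(1))

lemma U1_deriv: "r > 0 \<Longrightarrow> (U1 \<mu> has_real_derivative U2 \<mu> r) (at r)"
  unfolding U1_def[abs_def] U2_def Zdd_def
  by (intro powr_mult_ln_deriv) (auto intro!: derivative_eq_intros Z_deriv(1,2))

lemma continuous_on_drive: "continuous_on S x \<Longrightarrow> continuous_on S (\<lambda>s. drive s (x s))"
  unfolding drive_def using p1 continuous_on_subset[OF k_cont]
  by (intro continuous_intros continuous_on_pos_part_powr) auto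

lemma continuous_on_U2: "continuous_on {0<..} (U2 \<mu>)"
proof -
  have "continuous_on UNIV (Zdd \<mu>)"
    unfolding Zdd_def[abs_def]
    by (intro continuous_intros continuous_on_Z continuous_on_drive g_cont)
  note c = this continuous_on_Z[of \<mu>]
  have ln: "continuous_on {0<..} (\<lambda>r::real. ln r)" by (intro continuous_intros) auto
  have "continuous_on {0<..} (\<lambda>r. h (ln r))" if "continuous_on UNIV h" for h :: "real \<Rightarrow> real"
    using continuous_on_compose2[OF that ln] by auto
  note c[THEN this]
  then show ?thesis unfolding U2_def[abs_def] by (intro continuous_intros) auto
qed

lemma U_tendsto: "((\<lambda>r. r powr \<theta> * U \<mu> r) \<longlongrightarrow> \<gamma>) (at_right 0)"
proof -
  have "((\<lambda>r. \<gamma> + Z \<mu> (ln r)) \<longlongrightarrow> \<gamma> + 0) (at_right 0)"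
    by (intro tendsto_intros filterlim_compose[OF Z_tendsto ln_at_0])
  moreover have "eventually (\<lambda>r. \<gamma> + Z \<mu> (ln r) = r powr \<theta> * U \<mu> r) (at_right 0)"
    using eventually_at_right_less[of 0]
    by eventually_elim (simp add: U_def powr_minus field_simps)
  ultimately show ?thesis by (auto elim: Lim_transform_eventually)
qed

text \<open>The left side is \<open>u'' + (N - 1) / r * u'\<close> without the common factor
  \<open>r powr (- \<theta> - 2)\<close>, with
  \<open>N - 1 = \<theta> + \<sigma> + 1\<close>.\<close>

lemma equation_lhs:
  "Zdd \<mu> t + - \<theta> * Zd \<mu> t + (- \<theta> - 1) * (Zd \<mu> t + - \<theta> * (\<gamma> + Z \<mu> t))
     + (\<theta> + \<sigma> + 1) * (Zd \<mu> t + - \<theta> * (\<gamma> + Z \<mu> t))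
   = - (k t * max (\<gamma> + Z \<mu> t) 0 powr p) - \<mu> * g t"
proof -
  have eq: "- a' * x1 - c' * x + (b' * \<gamma> + p * b' * x - K - G) + - \<theta> * x1 + (- \<theta> - 1) * (x1 + - \<theta> * (\<gamma> + x))
      + (\<theta> + \<sigma> + 1) * (x1 + - \<theta> * (\<gamma> + x)) = - K - G"
    if "a' = \<sigma> - \<theta>" "b' = \<theta> * \<sigma>" "c' = (p - 1) * b'" for a' b' c' x x1 K G :: real
    unfolding that by (simp add: algebra_simps)
  show ?thesis
    using eq[OF a_eq b_eq c_eq, of "Zd \<mu> t" "Z \<mu> t" "k t * max (\<gamma> + Z \<mu> t) 0 powr p" "\<mu> * g t"]
    by (simp only: Zdd_def drive_def add_diff_eq)
qed

lemma U_pos_iff: "r > 0 \<Longrightarrow> U \<mu> r > 0 \<longleftrightarrow> \<gamma> + Z \<mu> (ln r) > 0"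
  by (simp add: U_def zero_less_mult_iff)

lemma positivity_set:
  assumes r: "r > 0"
  shows "(\<forall>\<rho>\<in>{0<..r}. U \<mu> \<rho> > 0) \<longleftrightarrow> (\<forall>s\<le>ln r. \<gamma> + Z \<mu> s > 0)"
proof
  assume L: "\<forall>\<rho>\<in>{0<..r}. U \<mu> \<rho> > 0"
  show "\<forall>s\<le>ln r. \<gamma> + Z \<mu> s > 0"
  proof (intro allI impI)
    fix s assume "s \<le> ln r"
    then have "exp s \<in> {0<..r}" using r by (simp add: ln_ge_iff)
    with L U_pos_iff[of "exp s" \<mu>] show "\<gamma> + Z \<mu> s > 0" by auto
  qed
qed (auto simp: U_pos_iff)

lemma C1_U: "C1_on2 (\<lambda>(r, \<mu>). U \<mu> r) ({0<..} \<times> UNIV)"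
  unfolding C1_on2_def
proof (rule exI[of _ "\<lambda>(r, \<mu>). U1 \<mu> r"], rule exI[of _ "\<lambda>(r, \<mu>). r powr - \<theta> * Zm \<mu> (ln r)"], intro conjI ballI)
  fix z :: "real \<times> real" assume "z \<in> {0<..} \<times> UNIV"
  then obtain r \<mu> where z: "z = (r, \<mu>)" and r: "r > 0" by auto
  have 1: "((\<lambda>z. (ln (fst z), snd z)) has_derivative (\<lambda>h. (fst h / r, snd h))) (at (r, \<mu>))"
    using r by (auto intro!: derivative_eq_intros simp: divide_inverse mult.commute)
  have 2: "((\<lambda>z. \<gamma> + Z (snd z) (ln (fst z))) has_derivative
      (\<lambda>h. Zd \<mu> (ln r) * (fst h / r) + Zm \<mu> (ln r) * snd h)) (at (r, \<mu>))"
  proof -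
    have "((\<lambda>z. (\<lambda>(t, \<mu>). Z \<mu> t) (ln (fst z), snd z)) has_derivative
        (\<lambda>h. (\<lambda>(h, \<kappa>). Zd \<mu> (ln r) * h + Zm \<mu> (ln r) * \<kappa>) (fst h / r, snd h))) (at (r, \<mu>))"
      by (rule has_derivative_compose[OF 1]) (simp add: Z_has_derivative)
    from has_derivative_add[OF has_derivative_const[of \<gamma>] this] show ?thesis by simp
  qed
  have "((\<lambda>r. r powr - \<theta>) has_real_derivative - \<theta> * r powr (- \<theta> - 1)) (at r)"
    using r by (auto intro!: derivative_eq_intros)
  then have p: "((\<lambda>r. r powr - \<theta>) has_derivative (*) (- \<theta> * r powr (- \<theta> - 1))) (at (fst (r, \<mu>)))"
    by (simp add: has_field_derivative_def)
  have 3: "((\<lambda>z. fst z powr - \<theta>) has_derivative (\<lambda>h. - \<theta> * r powr (- \<theta> - 1) * fst h)) (at (r, \<mu>))"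
    by (rule has_derivative_compose[OF has_derivative_fst[OF has_derivative_ident] p])
  have q: "r powr - \<theta> * (x / r) = r powr (- \<theta> - 1) * x" for x using r by (simp add: powr_diff)
  show "((\<lambda>(r, \<mu>). U \<mu> r) has_derivative
      (\<lambda>h. (case z of (r, \<mu>) \<Rightarrow> U1 \<mu> r) * fst h + (case z of (r, \<mu>) \<Rightarrow> r powr - \<theta> * Zm \<mu> (ln r)) * snd h)) (at z)"
  proof (rule has_derivative_eq_rhs)
    show "((\<lambda>(r, \<mu>). U \<mu> r) has_derivative
      (\<lambda>h. r powr - \<theta> * (Zd \<mu> (ln r) * (fst h / r) + Zm \<mu> (ln r) * snd h)
        + - \<theta> * r powr (- \<theta> - 1) * fst h * (\<gamma> + Z \<mu> (ln r)))) (at z)"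
      using has_derivative_mult[OF 3 2] by (simp add: z U_def case_prod_unfold)
  next
    show "(\<lambda>h. r powr - \<theta> * (Zd \<mu> (ln r) * (fst h / r) + Zm \<mu> (ln r) * snd h)
        + - \<theta> * r powr (- \<theta> - 1) * fst h * (\<gamma> + Z \<mu> (ln r)))
      = (\<lambda>h. (case z of (r, \<mu>) \<Rightarrow> U1 \<mu> r) * fst h + (case z of (r, \<mu>) \<Rightarrow> r powr - \<theta> * Zm \<mu> (ln r)) * snd h)"
    proof
      fix h :: "real \<times> real"
      have "r powr - \<theta> * (Zd \<mu> (ln r) * (fst h / r)) = r powr (- \<theta> - 1) * (Zd \<mu> (ln r) * fst h)"
        using q[of "Zd \<mu> (ln r) * fst h"] by simp
      then show "r powr - \<theta> * (Zd \<mu> (ln r) * (fst h / r) + Zm \<mu> (ln r) * snd h)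
        + - \<theta> * r powr (- \<theta> - 1) * fst h * (\<gamma> + Z \<mu> (ln r))
      = (case z of (r, \<mu>) \<Rightarrow> U1 \<mu> r) * fst h + (case z of (r, \<mu>) \<Rightarrow> r powr - \<theta> * Zm \<mu> (ln r)) * snd h"
        by (simp only: z case_prod_conv U1_def distrib_left) (simp only: algebra_simps)
    qed
  qed
next
  have ln: "continuous_on ({0<..} \<times> UNIV) (\<lambda>z::real \<times> real. (ln (fst z), snd z))"
    by (intro continuous_intros) auto
  have "continuous_on ({0<..} \<times> UNIV) (\<lambda>z. h (snd z) (ln (fst z)))"
    if "continuous_on UNIV (\<lambda>(t, \<mu>). h \<mu> t)" for h :: "real \<Rightarrow> real \<Rightarrow> real"
    using continuous_on_compose2[OF that ln] by auto
  note c = continuous_on_Z_pair[THEN this]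
  show "continuous_on ({0<..} \<times> UNIV) (\<lambda>(r, \<mu>). U1 \<mu> r)"
    unfolding U1_def case_prod_unfold by (intro continuous_intros c) auto
  show "continuous_on ({0<..} \<times> UNIV) (\<lambda>(r, \<mu>). r powr - \<theta> * Zm \<mu> (ln r))"
    unfolding case_prod_unfold by (intro continuous_intros c) auto
qed

text \<open>The interval is open at \<open>0\<close>, so compactness alone does not keep perturbed
  solutions positive. The limit \<open>\<gamma> > 0\<close> at the singularity supplies a uniform
  lower bound up to slightly beyond \<open>ln r\<close>, and the dependence on \<open>\<mu>\<close>
  is uniform there.\<close>

lemma open_positivity_set:
  assumes r: "r > 0"
  shows "open {\<mu>. \<forall>\<rho>\<in>{0<..r}. U \<mu> \<rho> > 0}"
  unfolding open_dist
proof
  fix \<mu> assume "\<mu> \<in> {\<mu>. \<forall>\<rho>\<in>{0<..r}. U \<mu> \<rho> > 0}"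
  then have pos: "\<And>s. s \<le> ln r \<Longrightarrow> \<gamma> + Z \<mu> s > 0" using positivity_set[OF r] by auto
  have "\<exists>T m. T > ln r \<and> m > 0 \<and> (\<forall>s<T. m \<le> \<gamma> + Z \<mu> s)"
    by (rule Z_positive_beyond[of "ln r" \<mu>]) (use pos in blast)+
  then obtain T m where T: "T > ln r" "m > 0" "\<And>s. s < T \<Longrightarrow> m \<le> \<gamma> + Z \<mu> s"
    by blast
  obtain d where d: "d > 0" "\<And>\<nu> s. \<bar>\<nu> - \<mu>\<bar> < d \<Longrightarrow> s < T \<Longrightarrow> \<gamma> + Z \<nu> s > 0"
    using Z_positive_open[OF T(2,3)] by blast
  have "\<forall>s\<le>ln r. \<gamma> + Z \<nu> s > 0" if "dist \<nu> \<mu> < d" for \<nu>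
    using that T(1) by (auto simp: dist_real_def intro!: d(2))
  with d(1) show "\<exists>e>0. \<forall>\<nu>. dist \<nu> \<mu> < e \<longrightarrow> \<nu> \<in> {\<mu>. \<forall>\<rho>\<in>{0<..r}. U \<mu> \<rho> > 0}"
    unfolding mem_Collect_eq positivity_set[OF r] by blast
qed

lemma analytic_U:
  assumes r: "r > 0" and C: "C \<subseteq> {\<mu>. \<forall>\<rho>\<in>{0<..r}. U \<mu> \<rho> > 0}"
  shows "real_analytic_on (\<lambda>\<mu>. U \<mu> r) C" "real_analytic_on (\<lambda>\<mu>. deriv (U \<mu>) r) C"
proof -
  have dU: "deriv (U \<mu>) r = U1 \<mu> r" for \<mu> by (rule DERIV_imp_deriv[OF U_deriv[OF r]])
  have *: "\<exists>d>0. (\<exists>c. \<forall>\<nu>. \<bar>\<nu> - \<mu>\<bar> < d \<longrightarrow> (\<lambda>n. c n * (\<nu> - \<mu>) ^ n) sums U \<nu> r) \<and>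
    (\<exists>c. \<forall>\<nu>. \<bar>\<nu> - \<mu>\<bar> < d \<longrightarrow> (\<lambda>n. c n * (\<nu> - \<mu>) ^ n) sums U1 \<nu> r)" if "\<mu> \<in> C" for \<mu>
  proof -
    have pos: "\<And>s. s \<le> ln r \<Longrightarrow> \<gamma> + Z \<mu> s > 0" using positivity_set[OF r] C that by blast
    have "\<exists>T m. T > ln r \<and> m > 0 \<and> (\<forall>s<T. m \<le> \<gamma> + Z \<mu> s)"
      by (rule Z_positive_beyond[of "ln r" \<mu>]) (use pos in blast)+
    then obtain T m where T: "T > ln r" "m > 0" "\<And>s. s < T \<Longrightarrow> m \<le> \<gamma> + Z \<mu> s"
      by blast
    obtain \<rho> F G where \<rho>: "\<rho> > 0"
      and hol: "\<forall>t<T. F t holomorphic_on ball (of_real \<mu>) \<rho> \<and> G t holomorphic_on ball (of_real \<mu>) \<rho>"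
      and FG: "\<forall>\<nu>. \<bar>\<nu> - \<mu>\<bar> < \<rho> \<longrightarrow>
        (\<forall>t<T. F t (of_real \<nu>) = of_real (Z \<nu> t) \<and> G t (of_real \<nu>) = of_real (Zd \<nu> t))"
      using Z_complexification[OF T(2,3)] by blast
    have F: "F (ln r) holomorphic_on ball (of_real \<mu>) \<rho>" "\<And>\<nu>. \<bar>\<nu> - \<mu>\<bar> < \<rho> \<Longrightarrow> F (ln r) (of_real \<nu>) = of_real (Z \<nu> (ln r))"
      and G: "G (ln r) holomorphic_on ball (of_real \<mu>) \<rho>" "\<And>\<nu>. \<bar>\<nu> - \<mu>\<bar> < \<rho> \<Longrightarrow> G (ln r) (of_real \<nu>) = of_real (Zd \<nu> (ln r))"
      using hol FG T(1) by blast+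
    show ?thesis
    proof (intro exI[of _ \<rho>] conjI \<rho>)
      let ?u = "\<lambda>x. of_real (r powr - \<theta>) * (of_real \<gamma> + F (ln r) x)"
      show "\<exists>c. \<forall>\<nu>. \<bar>\<nu> - \<mu>\<bar> < \<rho> \<longrightarrow> (\<lambda>n. c n * (\<nu> - \<mu>) ^ n) sums U \<nu> r"
      proof (rule holomorphic_real_power_series)
        show "?u holomorphic_on ball (of_real \<mu>) \<rho>" by (intro holomorphic_intros F)
        show "?u (of_real \<nu>) = of_real (U \<nu> r)" if "\<bar>\<nu> - \<mu>\<bar> < \<rho>" for \<nu> by (simp add: U_def F(2)[OF that])
      qed
      let ?v = "\<lambda>x. of_real (r powr (- \<theta> - 1)) * (G (ln r) x + of_real (- \<theta>) * (of_real \<gamma> + F (ln r) x))"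
      show "\<exists>c. \<forall>\<nu>. \<bar>\<nu> - \<mu>\<bar> < \<rho> \<longrightarrow> (\<lambda>n. c n * (\<nu> - \<mu>) ^ n) sums U1 \<nu> r"
      proof (rule holomorphic_real_power_series)
        show "?v holomorphic_on ball (of_real \<mu>) \<rho>" by (intro holomorphic_intros F G)
        show "?v (of_real \<nu>) = of_real (U1 \<nu> r)" if "\<bar>\<nu> - \<mu>\<bar> < \<rho>" for \<nu>
          by (simp add: U1_def F(2)[OF that] G(2)[OF that])
      qed
    qed
  qed
  show "real_analytic_on (\<lambda>\<mu>. U \<mu> r) C" "real_analytic_on (\<lambda>\<mu>. deriv (U \<mu>) r) C"
    unfolding real_analytic_on_def dU using * by blast+
qed

end

section \<open>Equivalence with the singular radial equation\<close>

context emden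
begin

context
  fixes N :: nat and K f :: "real \<Rightarrow> real" and \<alpha> :: real
  assumes N: "real N = \<theta> + \<sigma> + 2" and \<alpha>: "\<theta> * p = \<theta> + 2 + \<alpha>"
    and k_eq: "\<And>t. k t = exp (- \<alpha> * t) * K (exp t)" and g_eq: "\<And>t. g t = exp ((\<theta> + 2) * t) * f (exp t)"
begin

lemma solves_sing_U: "solves_sing N K f p \<theta> \<gamma> \<mu> (U \<mu>)"
  unfolding solves_sing_def C2_on_pos_def
proof (rule conjI[OF exI[of _ "U1 \<mu>"] U_tendsto], rule exI[of _ "U2 \<mu>"], intro conjI allI impI)
  fix r :: real assume r: "r > 0"
  show "(U \<mu> has_real_derivative U1 \<mu> r) (at r)" by (rule U_deriv[OF r])
  show "(U1 \<mu> has_real_derivative U2 \<mu> r) (at r)" by (rule U1_deriv[OF r])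
  let ?w = "\<gamma> + Z \<mu> (ln r)" and ?A = "r powr (- \<theta> - 1 - 1)"
  have "real N - 1 = \<theta> + \<sigma> + 1" by (simp add: N)
  then have "(real N - 1) / r * U1 \<mu> r
      = (r powr (- \<theta> - 1) / r) * ((\<theta> + \<sigma> + 1) * (Zd \<mu> (ln r) + - \<theta> * ?w))"
    by (simp only: U1_def times_divide_eq_left times_divide_eq_right mult_ac)
  also have "r powr (- \<theta> - 1) / r = ?A" using powr_diff[of r "- \<theta> - 1" 1] r by simp
  finally have "(real N - 1) / r * U1 \<mu> r = ?A * ((\<theta> + \<sigma> + 1) * (Zd \<mu> (ln r) + - \<theta> * ?w))" .
  then have "U2 \<mu> r + (real N - 1) / r * U1 \<mu> r = ?A * (- (k (ln r) * max ?w 0 powr p) - \<mu> * g (ln r))"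
    unfolding equation_lhs[symmetric] U2_def by (simp only: distrib_left)
  moreover have "?A * (k (ln r) * max ?w 0 powr p) = K r * max (U \<mu> r) 0 powr p"
  proof -
    have "exp (- \<alpha> * ln r) = r powr - \<alpha>" using r by (simp add: powr_def)
    then have "?A * k (ln r) = (?A * r powr - \<alpha>) * K r" using r by (simp add: k_eq)
    \<comment> \<open>The scaling that fixes \<open>\<theta>\<close>: two derivatives of
      \<open>r powr - \<theta>\<close> match \<open>r powr \<alpha>\<close> times its
      \<open>p\<close>-th power.\<close>
    also have "?A * r powr - \<alpha> = r powr (- \<theta> * p)"
    proof -
      have "- \<theta> - 1 - 1 + - \<alpha> = - \<theta> * p" using \<alpha> by simp
      then show ?thesis by (simp only: powr_add[symmetric])
    qed
    finally have 1: "?A * k (ln r) = r powr (- \<theta> * p) * K r" .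
    have "max (U \<mu> r) 0 = r powr - \<theta> * max ?w 0"
      by (simp add: U_def max_def zero_le_mult_iff mult_le_0_iff)
    then have "max (U \<mu> r) 0 powr p = r powr (- \<theta> * p) * max ?w 0 powr p"
      by (simp add: powr_mult powr_powr)
    with 1 show ?thesis by simp
  qed
  moreover have "?A * g (ln r) = f r"
  proof -
    have "exp ((\<theta> + 2) * ln r) = r powr (\<theta> + 2)" using r by (simp add: powr_def)
    then have "?A * g (ln r) = (?A * r powr (\<theta> + 2)) * f r" using r by (simp add: g_eq)
    also have "?A * r powr (\<theta> + 2) = 1" using r by (simp flip: powr_add)
    finally show ?thesis by simp
  qed
  ultimately show "U2 \<mu> r + (real N - 1) / r * U1 \<mu> r + K r * max (U \<mu> r) 0 powr p + \<mu> * f r = 0"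
    by (simp add: right_diff_distrib mult.left_commute)
next
  show "continuous_on {0<..} (U2 \<mu>)" by (rule continuous_on_U2)
qed

text \<open>Reversing the change of variables turns any competitor into a solution that tends to
  \<open>0\<close> at minus infinity; nothing about its derivative near the singularity is
  required.\<close>

lemma solves_sing_unique:
  assumes "solves_sing N K f p \<theta> \<gamma> \<mu> v" and r: "r > 0"
  shows "v r = U \<mu> r"
proof -
  obtain v1 v2 where v: "\<And>r. r > 0 \<Longrightarrow> (v has_real_derivative v1 r) (at r)"
    and v1: "\<And>r. r > 0 \<Longrightarrow> (v1 has_real_derivative v2 r) (at r)"
    and eq: "\<And>r. r > 0 \<Longrightarrow> v2 r + (real N - 1) / r * v1 r + K r * max (v r) 0 powr p + \<mu> * f r = 0"
    and lim: "((\<lambda>r. r powr \<theta> * v r) \<longlongrightarrow> \<gamma>) (at_right 0)"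
    using assms(1) unfolding solves_sing_def C2_on_pos_def by blast
  define x where "x t = exp (\<theta> * t) * v (exp t) - \<gamma>" for t
  \<comment> \<open>\<open>q\<close> equals \<open>w' - \<theta> w\<close>, the quantity
    \<open>V\<close> of the a priori bound; its linear rate is
    \<open>\<theta> + 2 - N = - \<sigma>\<close>.\<close>
  define q where "q t = exp (\<theta> * t) * (exp t * v1 (exp t))" for t
  define x1 where "x1 t = q t + \<theta> * (\<gamma> + x t)" for t
  have dv: "((\<lambda>t. v (exp t)) has_real_derivative v1 (exp t) * exp t) (at t)" for t
    by (rule DERIV_chain2[where f = v and g = exp, OF v]) (auto intro: DERIV_exp)
  have dv1: "((\<lambda>t. v1 (exp t)) has_real_derivative v2 (exp t) * exp t) (at t)" for t
    by (rule DERIV_chain2[where f = v1 and g = exp, OF v1]) (auto intro: DERIV_exp)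
  have dx: "(x has_real_derivative x1 t) (at t)" for t
    unfolding x_def[abs_def] x1_def q_def
    by (rule derivative_eq_intros dv refl | simp)+
  have dx1: "(x1 has_real_derivative - a * x1 t - c * x t + (drive t (x t) - \<mu> * g t)) (at t)" for t
  proof -
    let ?e = "exp t"
    have dq: "(q has_real_derivative (\<theta> + 1) * q t + exp (\<theta> * t) * (?e * ?e * v2 ?e)) (at t)"
      unfolding q_def[abs_def]
      by (rule derivative_eq_intros dv1 refl | simp)+ (simp add: algebra_simps)
    have "exp (\<theta> * t) * (?e * ?e * v2 ?e) = - (real N - 1) * q t - k t * max (\<gamma> + x t) 0 powr p - \<mu> * g t"
    proof -
      have m1: "?e * ?e * v2 ?e = - (real N - 1) * (?e * v1 ?e) - ?e * ?e * (K ?e * max (v ?e) 0 powr p) - \<mu> * (?e * ?e * f ?e)"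
      proof -
        have "v2 ?e = - ((real N - 1) / ?e * v1 ?e) - K ?e * max (v ?e) 0 powr p - \<mu> * f ?e"
          using eq[of ?e] by simp
        then have "?e * ?e * v2 ?e = - (?e * ?e * ((real N - 1) / ?e * v1 ?e))
            - ?e * ?e * (K ?e * max (v ?e) 0 powr p) - \<mu> * (?e * ?e * f ?e)"
          by (simp only: right_diff_distrib mult_minus_right mult.left_commute)
        moreover have "?e * ?e * ((real N - 1) / ?e * v1 ?e) = (real N - 1) * (?e * v1 ?e)" by simp
        ultimately show ?thesis by (simp add: algebra_simps)
      qed
      have m2: "exp (\<theta> * t) * (?e * ?e * (K ?e * max (v ?e) 0 powr p)) = k t * max (\<gamma> + x t) 0 powr p"
      proof -
        have "max (\<gamma> + x t) 0 = exp (\<theta> * t) * max (v ?e) 0"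
          by (simp add: x_def max_def zero_le_mult_iff mult_le_0_iff)
        then have "max (\<gamma> + x t) 0 powr p = exp (\<theta> * t) powr p * max (v ?e) 0 powr p"
          by (simp add: powr_mult)
        also have "exp (\<theta> * t) powr p = exp ((\<theta> * p) * t)" by (simp add: powr_def)
        finally have "k t * max (\<gamma> + x t) 0 powr p
            = (exp (- \<alpha> * t) * exp ((\<theta> * p) * t)) * (K ?e * max (v ?e) 0 powr p)"
          by (simp add: k_eq)
        also have "exp (- \<alpha> * t) * exp ((\<theta> * p) * t) = exp (\<theta> * t) * (?e * ?e)"
          unfolding \<alpha> by (simp add: algebra_simps flip: exp_add)
        finally show ?thesis by simp
      qed
      have m3: "exp (\<theta> * t) * (?e * ?e * f ?e) = g t"
      proof -
        have "exp ((\<theta> + 2) * t) = exp (\<theta> * t) * (?e * ?e)" by (simp add: algebra_simps flip: exp_add)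
        then show ?thesis by (simp add: g_eq)
      qed
      have "exp (\<theta> * t) * (?e * ?e * v2 ?e) = - (real N - 1) * (exp (\<theta> * t) * (?e * v1 ?e))
          - exp (\<theta> * t) * (?e * ?e * (K ?e * max (v ?e) 0 powr p)) - \<mu> * (exp (\<theta> * t) * (?e * ?e * f ?e))"
        unfolding m1 by (simp only: right_diff_distrib mult.left_commute)
      then show ?thesis by (simp only: m2 m3 q_def)
    qed
    then have 1: "(x1 has_real_derivative (\<theta> + 1) * q t + (- (real N - 1) * q t - k t * max (\<gamma> + x t) 0 powr p - \<mu> * g t)
        + \<theta> * x1 t) (at t)"
      using dq unfolding x1_def[abs_def] by (auto intro!: derivative_eq_intros dx simp: x1_def)
    have alg: "(\<theta> + 1) * q0 + (- (\<theta> + \<sigma> + 2 - 1) * q0 - W - G) + \<theta> * (q0 + \<theta> * (\<gamma> + y))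
       = - a' * (q0 + \<theta> * (\<gamma> + y)) - c' * y + (b' * \<gamma> + p * b' * y - W - G)"
      if "a' = \<sigma> - \<theta>" "b' = \<theta> * \<sigma>" "c' = (p - 1) * b'" for a' b' c' q0 W G y :: real
      unfolding that by (simp add: algebra_simps)
    show ?thesis
      using 1 alg[OF a_eq b_eq c_eq, of "q t" "k t * max (\<gamma> + x t) 0 powr p" "\<mu> * g t" "x t"]
      by (simp only: N x1_def drive_def)
  qed
  have "(x \<longlongrightarrow> 0) at_bot"
  proof -
    have "((\<lambda>t. exp t powr \<theta> * v (exp t) - \<gamma>) \<longlongrightarrow> \<gamma> - \<gamma>) at_bot"
      by (intro tendsto_intros filterlim_compose[OF lim filterlim_exp_at_right_0])
    then show ?thesis by (simp add: x_def[abs_def] powr_def mult.commute)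
  qed
  then have "Z \<mu> (ln r) = x (ln r)"
    using ode_imp_solution[OF dx dx1] by (intro Z_eq[of "ln r + 1"]) auto
  then show ?thesis using r by (simp add: U_def x_def powr_def flip: exp_add mult.assoc)
qed

end

end

section \<open>Verification of the Emden-Fowler data\<close>

theorem theorem3p3:
  fixes N :: nat and K f :: "real \<Rightarrow> real" and \<alpha> k0 \<nu> p :: real
  assumes N3: "N \<ge> 3"
    and K_cont: "continuous_on {0<..} K" and K_pos: "\<forall>r>0. K r > 0"
    and alpha: "\<alpha> > -2" and k0: "k0 > 0"
    and K_asymp: "((\<lambda>r. K r / r powr \<alpha>) \<longlongrightarrow> k0) (at_right 0)"
    and f_cont: "continuous_on {0<..} f" and f_nonneg: "\<forall>r>0. f r \<ge> 0"
    and f_nonzero: "\<exists>r>0. f r \<noteq> 0"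
    and nu: "\<nu> > -2" and f_bigo: "f \<in> O[at_right 0](\<lambda>r. r powr \<nu>)"
    and p: "p > (real N + 2 + 2 * \<alpha>) / (real N - 2)"
  shows "let \<theta> = (2 + \<alpha>) / (p - 1);
             \<gamma> = k0 powr (-1 / (p - 1)) * (\<theta> * (real N - 2 - \<theta>)) powr (1 / (p - 1))
         in \<exists>U :: real \<Rightarrow> real \<Rightarrow> real.
              (\<forall>\<mu>. solves_sing N K f p \<theta> \<gamma> \<mu> (U \<mu>)
                   \<and> (\<forall>v. solves_sing N K f p \<theta> \<gamma> \<mu> v \<longrightarrow> (\<forall>r>0. v r = U \<mu> r)))
            \<and> C1_on2 (\<lambda>(r, \<mu>). U \<mu> r) ({0<..} \<times> UNIV)
            \<and> (\<forall>r>0. let P = {\<mu>. \<forall>\<rho>\<in>{0<..r}. U \<mu> \<rho> > 0} in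
                  open P
                  \<and> (\<forall>C\<in>components P.
                        real_analytic_on (\<lambda>\<mu>. U \<mu> r) C
                      \<and> real_analytic_on (\<lambda>\<mu>. deriv (U \<mu>) r) C))"
proof -
  define \<theta> where "\<theta> = (2 + \<alpha>) / (p - 1)"
  define \<sigma> where "\<sigma> = real N - 2 - \<theta>"
  define \<gamma> where "\<gamma> = k0 powr (-1 / (p - 1)) * (\<theta> * \<sigma>) powr (1 / (p - 1))"
  have n: "real N - 2 > 0" using N3 by simp
  have pn: "p * (real N - 2) > real N + 2 + 2 * \<alpha>" using p n by (simp add: pos_divide_less_eq)
  have p1: "p > 1"
  proof -
    \<comment> \<open>The critical exponent exceeds \<open>1\<close> by
      \<open>(4 + 2 * \<alpha>) / (N - 2)\<close>, which is positive because
      \<open>\<alpha> > -2\<close>.\<close>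
    have "(p - 1) * (real N - 2) > 0" using pn alpha by (simp add: algebra_simps)
    then show ?thesis using n by (simp add: zero_less_mult_iff)
  qed
  have \<theta>: "\<theta> > 0" "\<theta> * (p - 1) = 2 + \<alpha>" using p1 alpha by (simp_all add: \<theta>_def)
  \<comment> \<open>The assumption on \<open>p\<close> in the form
    \<open>2 * (2 + \<alpha>) < (N - 2) * (p - 1)\<close>.\<close>
  have "2 * \<theta> < real N - 2"
  proof -
    have "(2 * \<theta>) * (p - 1) < (real N - 2) * (p - 1)"
      using pn \<theta>(2) by (simp add: algebra_simps)
    then show ?thesis using p1 by simp
  qed
  then have \<sigma>: "\<sigma> > 0" "\<sigma> - \<theta> > 0" using \<theta> by (simp_all add: \<sigma>_def)
  have b: "\<theta> * \<sigma> > 0" using \<theta> \<sigma> by simp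
  have \<gamma>: "\<gamma> > 0" unfolding \<gamma>_def using k0 b by (intro mult_pos_pos powr_gt_zero[THEN iffD2]) auto
  have b_eq: "\<theta> * \<sigma> = k0 * \<gamma> powr (p - 1)"
  proof -
    have "\<gamma> powr (p - 1) = (k0 powr (-1 / (p - 1))) powr (p - 1) * ((\<theta> * \<sigma>) powr (1 / (p - 1))) powr (p - 1)"
      unfolding \<gamma>_def by (rule powr_mult)
    also have "\<dots> = k0 powr - 1 * (\<theta> * \<sigma>) powr 1" using p1 by (simp only: powr_powr) simp
    finally have "\<gamma> powr (p - 1) = k0 powr - 1 * (\<theta> * \<sigma>) powr 1" .
    moreover have "k0 * k0 powr - 1 = 1" using k0 by (simp add: powr_minus)
    ultimately show ?thesis using \<theta> \<sigma> by simp
  qed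
  have c: "(p - 1) * (\<theta> * \<sigma>) > 0" using p1 b by simp
  obtain l1 l2 :: complex and kap where roots: "kap > 0" "Re l1 \<le> - kap" "Re l2 \<le> - kap"
    "l1 + l2 = - of_real (\<sigma> - \<theta>)" "l1 * l2 = of_real ((p - 1) * (\<theta> * \<sigma>))"
    by (rule stable_quadratic_roots[OF \<sigma>(2) c], rule that)
  define k where "k t = exp (- \<alpha> * t) * K (exp t)" for t
  define g where "g t = exp ((\<theta> + 2) * t) * f (exp t)" for t
  have exp_cont: "continuous_on UNIV (\<lambda>t. h (exp t))" if "continuous_on {0<..} h" for h :: "real \<Rightarrow> real"
    by (rule continuous_on_compose2[OF that]) (auto intro: continuous_intros)
  have k_cont: "continuous_on UNIV k"
    unfolding k_def[abs_def] by (intro continuous_on_mult exp_cont[OF K_cont]) (intro continuous_intros)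
  have g_cont: "continuous_on UNIV g"
    unfolding g_def[abs_def] by (intro continuous_on_mult exp_cont[OF f_cont]) (intro continuous_intros)
  have k_lim: "(k \<longlongrightarrow> k0) at_bot"
  proof -
    have "((\<lambda>t. K (exp t) / exp t powr \<alpha>) \<longlongrightarrow> k0) at_bot"
      by (rule filterlim_compose[OF K_asymp filterlim_exp_at_right_0])
    moreover have "K (exp t) / exp t powr \<alpha> = k t" for t
      by (simp add: k_def powr_def exp_minus field_simps)
    ultimately show ?thesis by simp
  qed
  have g_lim: "(g \<longlongrightarrow> 0) at_bot"
  proof -
    obtain C where "eventually (\<lambda>r. norm (f r) \<le> C * norm (r powr \<nu>)) (at_right 0)"
      using f_bigo by (rule landau_o.bigE)
    then have "eventually (\<lambda>t. norm (f (exp t)) \<le> C * norm (exp t powr \<nu>)) at_bot"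
      by (rule filterlim_exp_at_right_0[unfolded filterlim_iff, rule_format])
    \<comment> \<open>The growth bound on \<open>f\<close> becomes exponential decay of
      \<open>g\<close> at rate \<open>\<theta> + 2 + \<nu>\<close>, positive because
      \<open>\<nu> > -2\<close>.\<close>
    then have le: "eventually (\<lambda>t. norm (g t) \<le> C * exp ((\<theta> + 2 + \<nu>) * t)) at_bot"
    proof eventually_elim
      case (elim t)
      have "norm (g t) = exp ((\<theta> + 2) * t) * norm (f (exp t))" by (simp add: g_def abs_mult)
      also have "\<dots> \<le> exp ((\<theta> + 2) * t) * (C * norm (exp t powr \<nu>))" using elim by (intro mult_left_mono) auto
      also have "\<dots> = C * exp ((\<theta> + 2 + \<nu>) * t)"
        by (simp add: powr_def algebra_simps exp_add)
      finally show ?case .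
    qed
    have "((\<lambda>t. C * exp ((\<theta> + 2 + \<nu>) * t)) \<longlongrightarrow> C * 0) at_bot"
      using \<theta> nu by (intro tendsto_intros filterlim_compose[OF exp_at_bot]
        filterlim_tendsto_pos_mult_at_bot[OF tendsto_const _ filterlim_ident]) auto
    then show ?thesis using Lim_null_comparison[OF le] by simp
  qed
  have k_nonneg: "k s \<ge> 0" for s using K_pos by (simp add: k_def less_imp_le)
  have N_eq: "real N = \<theta> + \<sigma> + 2" by (simp add: \<sigma>_def)
  have \<alpha>_eq: "\<theta> * p = \<theta> + 2 + \<alpha>" using \<theta>(2) by (simp add: algebra_simps)
  interpret emden l1 l2 kap "\<sigma> - \<theta>" "(p - 1) * (\<theta> * \<sigma>)" k g k0 p \<gamma> \<theta> \<sigma> "\<theta> * \<sigma>"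
    by unfold_locales (fact roots \<theta>(1) \<sigma>(1) p1 \<gamma> b_eq k_cont k_lim k_nonneg g_cont g_lim refl)+
  have solves: "\<forall>\<mu>. solves_sing N K f p \<theta> \<gamma> \<mu> (U \<mu>)
      \<and> (\<forall>v. solves_sing N K f p \<theta> \<gamma> \<mu> v \<longrightarrow> (\<forall>r>0. v r = U \<mu> r))"
    using solves_sing_U[OF N_eq \<alpha>_eq k_def g_def] solves_sing_unique[OF N_eq \<alpha>_eq k_def g_def] by blast
  have "\<forall>r>0. open {\<mu>. \<forall>\<rho>\<in>{0<..r}. U \<mu> \<rho> > 0} \<and>
      (\<forall>C\<in>components {\<mu>. \<forall>\<rho>\<in>{0<..r}. U \<mu> \<rho> > 0}.
         real_analytic_on (\<lambda>\<mu>. U \<mu> r) C \<and> real_analytic_on (\<lambda>\<mu>. deriv (U \<mu>) r) C)"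
  proof (intro allI impI conjI ballI)
    fix r :: real assume r: "r > 0"
    show "open {\<mu>. \<forall>\<rho>\<in>{0<..r}. U \<mu> \<rho> > 0}" by (rule open_positivity_set[OF r])
    fix C assume "C \<in> components {\<mu>. \<forall>\<rho>\<in>{0<..r}. U \<mu> \<rho> > 0}"
    from in_components_subset[OF this]
    show "real_analytic_on (\<lambda>\<mu>. U \<mu> r) C" "real_analytic_on (\<lambda>\<mu>. deriv (U \<mu>) r) C"
      by (rule analytic_U[OF r])+
  qed
  then show ?thesis
    unfolding Let_def \<theta>_def[symmetric] \<sigma>_def[symmetric] \<gamma>_def[symmetric]
    by (intro exI[of _ U] conjI solves C1_U)
qed

end
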